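(* Let $Q,T$ range over the Lagrangian Grassmannian $\mathrm{LGr}(\mathcal H)$. Then: a) For every double coset $\mathfrak g\in\mathbf K\setminus\mathbf G/\mathbf K$, $\chi_{\mathfrak g}(Q,T)$ is a Lagrangian subspace of $\mathcal V\oplus\mathcal V$ (with respect to the form $B^\ominus$). b) For every $\mathfrak g$, the map $\chi_{\mathfrak g}:\mathrm{LGr}(\mathcal H)\times\mathrm{LGr}(\mathcal H)\to\mathrm{LGr}(\mathcal V\oplus\mathcal V)$ is rational. c) For $\mathfrak g$ in a general position, $\chi_{\mathfrak g}(Q,T)\in\mathrm{Sp}(\mathcal V,\mathbb Q_p)$ (i.e. $\chi_{\mathfrak g}(Q,T)$ is the graph of a symplectic operator $\mathcal V\to\mathcal V$) almost surely on $\mathrm{LGr}(\mathcal H)\times\mathrm{LGr}(\mathcal H)$.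
   Context: Let $p$ be a prime, $\alpha\ge 0$ and $k\ge 1$ integers. $\mathbf G=\mathrm{GL}(\alpha+k\infty,\mathbb Q_p)$ is the group of finitary ($g-1$ has finitely many nonzero entries) invertible block matrices over $\mathbb Q_p$ of size $\alpha+\infty+\dots+\infty$ ($k$ copies of $\infty=\mathbb N$). It is the union of the subgroups $\mathrm{GL}(\alpha+km,\mathbb Q_p)$, where in each of the $k$ infinite blocks only the first $m$ coordinates are involved. $\mathrm O(\infty,\mathbb Z_p)$ is the group of finitary infinite orthogonal matrices with entries in $\mathbb Z_p$, embedded in $\mathbf G$ by $\mathfrak I(u)=\mathrm{diag}(1_\alpha,u,\dots,u)$; its image is $\mathbf K$. $\mathcal V=\mathbb Q_p^\alpha\oplus\mathbb Q_p^\alpha$ and $\mathcal H=\mathbb Q_p^k\oplus\mathbb Q_p^k$ carry the standard skew-symmetric forms $B_{\mathcal V},B_{\mathcal H}$ with matrix $\begin{pmatrix}0&1\\ -1&0\end{pmatrix}$; $\mathcal V\oplus\mathcal V$ carries the form $B^\ominus(u\oplus v,u'\oplus v')=B_{\mathcal V}(u,u')-B_{\mathcal V}(v,v')$. For a symplectic space $V$, $\mathrm{LGr}(V)$ is the set of Lagrangian (maximal isotropic) linear subspaces. "Almost surely" means outside a set of measure zero for the natural measure class on the $p$-adic manifold. "Rational" means: given by rational functions in the natural coordinates of the Grassmannians outside a proper algebraic subvariety. A vector $x=(x_1^+,\dots,x_k^+,x_1^-,\dots,x_k^-)$ with $x_j^\pm\in\mathbb Q_p^m$ is regarded as an element of $\mathcal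 H\otimes\mathbb Q_p^m$; for a $\mathbb Z_p$-submodule $Q\subset\mathcal H$, $Q\otimes\mathbb Z_p^m$ is the direct sum of $m$ copies of $Q$, i.e. the set of $x$ such that for each $i=1,\dots,m$ the vector of $i$-th coordinates $(x_{1,i}^+,\dots,x_{k,i}^+,x_{1,i}^-,\dots,x_{k,i}^-)$ lies in $Q$ (a Lagrangian subspace is in particular a $\mathbb Z_p$-submodule). Characteristic function: let $g\in\mathrm{GL}(\alpha+km,\mathbb Q_p)$ represent the double coset $\mathfrak g$. $\chi_{\mathfrak g}(Q,T)\subset\mathcal V\oplus\mathcal V$ is the set of all $u\oplus v$, $u=u^+\oplus u^-$, $v=v^+\oplus v^-$, for which there exist $x\in Q\otimes\mathbb Z_p^m$, $y\in T\otimes\mathbb Z_p^m$ with $$\begin{pmatrix}v^+\\ y^+\end{pmatrix}=g\begin{pmatrix}u^+\\ x^+\end{pmatrix},\qquad \begin{pmatrix}v^-\\ y^-\end{pmatrix}=(g^t)^{-1}\begin{pmatrix}u^-\\ x^-\end{pmatrix},$$ where $x^\pm=(x_1^\pm,\dots,x_k^\pm)$, $y^\pm=(y_1^\pm,\dots,y_k^\pm)$ are columns. It depends only on $\mathfrak g$, not on $m$ or the representative $g$. General position: a property of a double coset holds in a general position if for any sufficiently large $m$ the set of $g\in\mathrm{GL}(\alpha+km,\mathbb Q_p)$ for which the property does not hold is a proper algebraic subvariety of $\mathrm{GL}(\alpha+km,\mathbb Q_p)$. *)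

theory Defs
  imports
    "HOL-Library.Groups_Big_Fun"
    "HOL-Computational_Algebra.Fraction_Field"
    "Berlekamp_Zassenhaus.Finite_Field"
    "Jordan_Normal_Form.VS_Connect"
    "Jordan_Normal_Form.Gauss_Jordan_Elimination"
begin

section \<open>The field of p-adic numbers\<close>

text \<open>
  The prime is the cardinality of a type \<open>'p\<close> of class \<open>prime_card\<close>.  The ring of p-adic
  integers is the inverse limit of the rings of residues modulo \<open>p ^ n\<close>, the element at
  position \<open>n\<close> being the representative in \<open>{0..<p ^ n}\<close>; the field of p-adic numbers is its
  field of fractions.
\<close>

typedef (overloaded) ('p::prime_card) padic_int =
  "{x :: nat \<Rightarrow> int. \<forall>n. x (Suc n) mod int CARD('p) ^ n = x n}"
  morphisms residue Abs_padic_int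
  by (rule exI[of _ "\<lambda>_. 0"]) simp

setup_lifting type_definition_padic_int

lemma residue_Suc:
  fixes x :: "'p::prime_card padic_int"
  shows "residue x (Suc n) mod int CARD('p) ^ n = residue x n"
  using residue[of x] by simp

lemma residue_mod:
  fixes x :: "'p::prime_card padic_int"
  assumes "n \<le> m"
  shows "residue x m mod int CARD('p) ^ n = residue x n"
  using assms
proof (induction m rule: dec_induct)
  case base
  show ?case by (metis residue_Suc mod_mod_trivial)
next
  case (step m)
  have "residue x (Suc m) mod int CARD('p) ^ m mod int CARD('p) ^ n
      = residue x (Suc m) mod int CARD('p) ^ n"
    using step(1) by (intro mod_mod_cancel le_imp_power_dvd)
  with step.IH show ?case by (simp add: residue_Suc)
qed

lemma mod_power_Suc_cancel: "a mod (b::int) ^ Suc n mod b ^ n = a mod b ^ n"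
  by (intro mod_mod_cancel le_imp_power_dvd) simp

instantiation padic_int :: (prime_card) comm_ring_1
begin

lift_definition zero_padic_int :: "'a padic_int" is "\<lambda>_. 0"
  by simp

lift_definition one_padic_int :: "'a padic_int" is "\<lambda>n. 1 mod int CARD('a) ^ n"
  by (simp only: mod_power_Suc_cancel)

lift_definition plus_padic_int :: "'a padic_int \<Rightarrow> 'a padic_int \<Rightarrow> 'a padic_int"
  is "\<lambda>x y n. (x n + y n) mod int CARD('a) ^ n"
  unfolding mod_power_Suc_cancel by (metis mod_add_eq)

lift_definition uminus_padic_int :: "'a padic_int \<Rightarrow> 'a padic_int"
  is "\<lambda>x n. (- x n) mod int CARD('a) ^ n"
  unfolding mod_power_Suc_cancel by (metis mod_minus_eq)

lift_definition minus_padic_int :: "'a padic_int \<Rightarrow> 'a padic_int \<Rightarrow> 'a padic_int"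
  is "\<lambda>x y n. (x n - y n) mod int CARD('a) ^ n"
  unfolding mod_power_Suc_cancel by (metis mod_diff_eq)

lift_definition times_padic_int :: "'a padic_int \<Rightarrow> 'a padic_int \<Rightarrow> 'a padic_int"
  is "\<lambda>x y n. (x n * y n) mod int CARD('a) ^ n"
  unfolding mod_power_Suc_cancel by (metis mod_mult_eq)

instance
proof
  have card_gt_1: "1 < int CARD('a)"
    using prime_card[where ?'a = 'a] prime_gt_1_nat[of "CARD('a)"] by simp
  show "(0::'a padic_int) \<noteq> 1"
  proof
    assume "(0::'a padic_int) = 1"
    then have "residue (0::'a padic_int) 1 = residue (1::'a padic_int) 1" by simp
    with card_gt_1 show False by transfer simp
  qed
qed (transfer; (simp add: fun_eq_iff mod_simps algebra_simps; (metis mod_mod_trivial)?))+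

end

instance padic_int :: (prime_card) idom
proof
  fix x y :: "'a padic_int"
  assume "x \<noteq> 0" "y \<noteq> 0"
  then obtain a b where a: "residue x a \<noteq> 0" and b: "residue y b \<noteq> 0"
    by (auto simp: residue_inject[symmetric] zero_padic_int.rep_eq fun_eq_iff)
  let ?p = "int CARD('a)"
  have p: "prime ?p" using prime_card[where ?'a = 'a] by simp
  have nx: "\<not> ?p ^ a dvd residue x (a + b)"
    using residue_mod[of a "a + b" x] a by (simp add: dvd_eq_mod_eq_0)
  have ny: "\<not> ?p ^ b dvd residue y (a + b)"
    using residue_mod[of b "a + b" y] b by (simp add: dvd_eq_mod_eq_0)
  let ?u = "residue x (a + b)" and ?v = "residue y (a + b)"
  have nz: "?u \<noteq> 0" "?v \<noteq> 0" using nx ny by auto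
  have "\<not> is_unit ?p" using p not_prime_unit by blast
  then have "multiplicity ?p ?u < a" "multiplicity ?p ?v < b"
    using nx ny nz by (simp_all add: power_dvd_iff_le_multiplicity)
  then have "multiplicity ?p (?u * ?v) < a + b"
    using nz p by (simp add: prime_elem_multiplicity_mult_distrib)
  then have "\<not> ?p ^ (a + b) dvd ?u * ?v"
    using nz \<open>\<not> is_unit ?p\<close> by (simp add: power_dvd_iff_le_multiplicity)
  then have "residue (x * y) (a + b) \<noteq> 0"
    by (simp add: times_padic_int.rep_eq dvd_eq_mod_eq_0)
  then show "x * y \<noteq> 0" by (auto simp: zero_padic_int.rep_eq)
qed

type_synonym 'p padic = "'p padic_int fract"

definition padic_integers :: "'p::prime_card padic set"
  where "padic_integers = range to_fract"


section \<open>Finitary matrices, the group G and double cosets\<close>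

text \<open>
  Infinite matrices are functions of two indices.  A finitary matrix over an index set \<open>I\<close>
  agrees with the identity matrix outside \<open>I \<times> I\<close>, so that every matrix has exactly one
  representation.
\<close>

type_synonym ('i, 'a) imat = "'i \<Rightarrow> 'i \<Rightarrow> 'a"

definition imat_one :: "('i, 'a::field) imat"
  where "imat_one r s = (if r = s then 1 else 0)"

definition finitary :: "'i set \<Rightarrow> ('i, 'a::field) imat \<Rightarrow> bool"
  where "finitary I g \<longleftrightarrow>
    finite {(r, s). g r s \<noteq> imat_one r s} \<and>
    (\<forall>r s. r \<notin> I \<or> s \<notin> I \<longrightarrow> g r s = imat_one r s)"

text \<open>For finitary factors the sum has finitely many nonzero terms, as \<open>Sum_any\<close> requires.\<close>

definition imat_mult :: "('i, 'a::field) imat \<Rightarrow> ('i, 'a) imat \<Rightarrow> ('i, 'a) imat"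
  where "imat_mult g h r t = Sum_any (\<lambda>s. g r s * h s t)"

definition fin_GL :: "'i set \<Rightarrow> ('i, 'a::field) imat set"
  where "fin_GL I = {g. finitary I g \<and>
    (\<exists>h. finitary I h \<and> imat_mult g h = imat_one \<and> imat_mult h g = imat_one)}"

definition fin_O :: "(nat, 'p::prime_card padic) imat set"
  where "fin_O = {u \<in> fin_GL UNIV. (\<forall>i j. u i j \<in> padic_integers) \<and>
    imat_mult u (\<lambda>i j. u j i) = imat_one \<and> imat_mult (\<lambda>i j. u j i) u = imat_one}"

text \<open>
  Indices of matrices of size \<open>\<alpha> + k \<infinity>\<close>: \<open>Inl a\<close> with \<open>a < \<alpha>\<close>, and \<open>Inr (j, i)\<close>, the
  \<open>i\<close>-th coordinate in the \<open>j\<close>-th infinite block, \<open>j < k\<close>.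
\<close>

type_synonym index = "nat + nat \<times> nat"

definition indices :: "nat \<Rightarrow> nat \<Rightarrow> index set"
  where "indices \<alpha> k = Sum_Type.Plus {..<\<alpha>} ({..<k} \<times> UNIV)"

definition block_embed :: "nat \<Rightarrow> (nat, 'a::field) imat \<Rightarrow> (index, 'a) imat"
  where "block_embed k u r s =
    (case (r, s) of
       (Inr (j, i), Inr (j', i')) \<Rightarrow> if j = j' \<and> j < k then u i i' else imat_one r s
     | _ \<Rightarrow> imat_one r s)"

definition G_group :: "nat \<Rightarrow> nat \<Rightarrow> (index, 'p::prime_card padic) imat set"
  where "G_group \<alpha> k = fin_GL (indices \<alpha> k)"

definition K_group :: "nat \<Rightarrow> (index, 'p::prime_card padic) imat set"
  where "K_group k = block_embed k ` fin_O"

definition double_coset ::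
    "nat \<Rightarrow> (index, 'p::prime_card padic) imat \<Rightarrow> (index, 'p padic) imat set"
  where "double_coset k g = {imat_mult (imat_mult a g) b | a b. a \<in> K_group k \<and> b \<in> K_group k}"

definition double_cosets :: "nat \<Rightarrow> nat \<Rightarrow> (index, 'p::prime_card padic) imat set set"
  where "double_cosets \<alpha> k = double_coset k ` G_group \<alpha> k"

definition GL :: "nat \<Rightarrow> 'a::field mat set"
  where "GL n = {g \<in> carrier_mat n n. invertible_mat g}"

text \<open>
  In a vector of dimension \<open>\<alpha> + k * m\<close> the first \<open>\<alpha>\<close> coordinates are followed by \<open>k\<close>
  consecutive blocks of length \<open>m\<close>.
\<close>

definition level_indices :: "nat \<Rightarrow> nat \<Rightarrow> nat \<Rightarrow> index set"
  where "level_indices \<alpha> k m = Sum_Type.Plus {..<\<alpha>} ({..<k} \<times> {..<m})"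

definition position :: "nat \<Rightarrow> nat \<Rightarrow> index \<Rightarrow> nat"
  where "position \<alpha> m r = (case r of Inl a \<Rightarrow> a | Inr (j, i) \<Rightarrow> \<alpha> + j * m + i)"

definition level_embed :: "nat \<Rightarrow> nat \<Rightarrow> nat \<Rightarrow> 'a::field mat \<Rightarrow> (index, 'a) imat"
  where "level_embed \<alpha> k m g r s =
    (if r \<in> level_indices \<alpha> k m \<and> s \<in> level_indices \<alpha> k m
     then g $$ (position \<alpha> m r, position \<alpha> m s) else imat_one r s)"


section \<open>Symplectic spaces and Lagrangian subspaces\<close>

text \<open>A bilinear form on a space of column vectors is given by its Gram matrix \<open>\<Omega>\<close>.\<close>

definition bilin :: "'a::field mat \<Rightarrow> 'a vec \<Rightarrow> 'a vec \<Rightarrow> 'a"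
  where "bilin \<Omega> x y = x \<bullet> (\<Omega> *\<^sub>v y)"

definition isotropic :: "'a::field mat \<Rightarrow> 'a vec set \<Rightarrow> bool"
  where "isotropic \<Omega> L \<longleftrightarrow>
    subspace class_ring L (module_vec TYPE('a) (dim_row \<Omega>)) \<and> (\<forall>x\<in>L. \<forall>y\<in>L. bilin \<Omega> x y = 0)"

definition LGr :: "'a::field mat \<Rightarrow> 'a vec set set"
  where "LGr \<Omega> = {L. isotropic \<Omega> L \<and> (\<forall>M. isotropic \<Omega> M \<longrightarrow> L \<subseteq> M \<longrightarrow> M = L)}"

text \<open>
  The direct sum of two copies of the space of \<open>n\<close>-vectors is represented by concatenated
  vectors \<open>x\<^sup>+ @\<^sub>v x\<^sup>-\<close> of dimension \<open>n + n\<close>.  For \<open>n = k\<close> and \<open>n = \<alpha>\<close> the matrix below is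
  the Gram matrix of \<open>\<H>\<close> and of \<open>\<V>\<close>.
\<close>

definition J_mat :: "nat \<Rightarrow> 'a::field mat"
  where "J_mat n = four_block_mat (0\<^sub>m n n) (1\<^sub>m n) (- 1\<^sub>m n) (0\<^sub>m n n)"

definition J_ominus :: "nat \<Rightarrow> 'a::field mat"
  where "J_ominus n = four_block_mat (J_mat n) (0\<^sub>m (n + n) (n + n)) (0\<^sub>m (n + n) (n + n)) (- J_mat n)"

definition Sp :: "nat \<Rightarrow> 'a::field mat set"
  where "Sp n = {A \<in> carrier_mat (n + n) (n + n). A\<^sup>T * J_mat n * A = J_mat n}"

definition graph_of :: "nat \<Rightarrow> 'a::field mat \<Rightarrow> 'a vec set"
  where "graph_of N A = {u @\<^sub>v (A *\<^sub>v u) | u. u \<in> carrier_vec N}"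


section \<open>The characteristic function\<close>

definition tensor :: "nat \<Rightarrow> nat \<Rightarrow> 'a::field vec set \<Rightarrow> ('a vec \<times> 'a vec) set"
  where "tensor k m Q = {(xp, xm). xp \<in> carrier_vec (k * m) \<and> xm \<in> carrier_vec (k * m) \<and>
    (\<forall>i<m. vec k (\<lambda>j. xp $ (j * m + i)) @\<^sub>v vec k (\<lambda>j. xm $ (j * m + i)) \<in> Q)}"

definition chi_matrix ::
    "nat \<Rightarrow> nat \<Rightarrow> nat \<Rightarrow> 'a::field mat \<Rightarrow> 'a vec set \<Rightarrow> 'a vec set \<Rightarrow> 'a vec set"
  where "chi_matrix \<alpha> k m g Q T =
    {(up @\<^sub>v um) @\<^sub>v (vp @\<^sub>v vm) | up um vp vm.
       up \<in> carrier_vec \<alpha> \<and> um \<in> carrier_vec \<alpha> \<and> vp \<in> carrier_vec \<alpha> \<and> vm \<in> carrier_vec \<alpha> \<and>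
       (\<exists>xp xm yp ym. (xp, xm) \<in> tensor k m Q \<and> (yp, ym) \<in> tensor k m T \<and>
          vp @\<^sub>v yp = g *\<^sub>v (up @\<^sub>v xp) \<and>
          vm @\<^sub>v ym = the (mat_inverse g\<^sup>T) *\<^sub>v (um @\<^sub>v xm))}"

text \<open>
  The value of \<open>chi_matrix\<close> depends neither on \<open>m\<close> nor on the representative \<open>g\<close> of the double
  coset, hence the union is the common value for all representatives.
\<close>

definition chi ::
    "nat \<Rightarrow> nat \<Rightarrow> (index, 'p::prime_card padic) imat set \<Rightarrow>
     'p padic vec set \<Rightarrow> 'p padic vec set \<Rightarrow> 'p padic vec set"
  where "chi \<alpha> k \<gg> Q T =
    \<Union> {chi_matrix \<alpha> k m g Q T | m g. g \<in> GL (\<alpha> + k * m) \<and> level_embed \<alpha> k m g \<in> \<gg>}"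


section \<open>Polynomial functions and the general position\<close>

text \<open>
  The field being infinite, polynomials in the variables \<open>E\<close> are identified with polynomial
  functions.
\<close>

inductive_set poly_fun :: "'e set \<Rightarrow> (('e \<Rightarrow> 'a::field) \<Rightarrow> 'a) set" for E :: "'e set"
  where
    const: "(\<lambda>_. c) \<in> poly_fun E"
  | var: "e \<in> E \<Longrightarrow> (\<lambda>w. w e) \<in> poly_fun E"
  | add: "f \<in> poly_fun E \<Longrightarrow> g \<in> poly_fun E \<Longrightarrow> (\<lambda>w. f w + g w) \<in> poly_fun E"
  | mult: "f \<in> poly_fun E \<Longrightarrow> g \<in> poly_fun E \<Longrightarrow> (\<lambda>w. f w * g w) \<in> poly_fun E"

definition proper_subvariety_GL :: "nat \<Rightarrow> 'a::field mat set \<Rightarrow> bool"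
  where "proper_subvariety_GL n X \<longleftrightarrow> X \<noteq> GL n \<and>
    (\<exists>F \<subseteq> poly_fun ({..<n} \<times> {..<n}). X = {g \<in> GL n. \<forall>f\<in>F. f (\<lambda>e. g $$ e) = 0})"

definition general_position ::
    "nat \<Rightarrow> nat \<Rightarrow> ((index, 'p::prime_card padic) imat set \<Rightarrow> bool) \<Rightarrow> bool"
  where "general_position \<alpha> k P \<longleftrightarrow>
    (\<exists>m0. \<forall>m\<ge>m0. proper_subvariety_GL (\<alpha> + k * m)
       {g \<in> GL (\<alpha> + k * m). \<not> P (double_coset k (level_embed \<alpha> k m g))})"


section \<open>Coordinates on Lagrangian Grassmannians\<close>

text \<open>
  Let \<open>q i\<close>, \<open>p i\<close> for \<open>i < n\<close> be Darboux coordinates, in which the form is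
  \<open>\<Sum>i<n. q i x * p i y - p i x * q i y\<close>.  Replacing the pairs \<open>(q i, p i)\<close> with \<open>i \<in> \<epsilon>\<close> by
  \<open>(p i, - q i)\<close> gives Darboux coordinates again; the Lagrangian subspaces on which the new
  \<open>q\<close> form a coordinate system are exactly the graphs \<open>p = S q\<close> with symmetric \<open>S\<close>.  These
  \<open>2 ^ n\<close> charts, with the entries \<open>S i j\<close>, \<open>i \<le> j\<close>, as coordinates, are the standard atlas of
  the Lagrangian Grassmannian.
\<close>

definition sym_coords :: "nat \<Rightarrow> (nat \<times> nat) set"
  where "sym_coords n = {(i, j). i \<le> j \<and> j < n}"

definition lag_chart ::
    "nat \<Rightarrow> (nat \<Rightarrow> 'a::field vec \<Rightarrow> 'a) \<Rightarrow> (nat \<Rightarrow> 'a vec \<Rightarrow> 'a) \<Rightarrow>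
     nat set \<Rightarrow> (nat \<times> nat \<Rightarrow> 'a) \<Rightarrow> 'a vec set"
  where "lag_chart n q p \<epsilon> s = {x \<in> carrier_vec (n + n). \<forall>j<n.
    (if j \<in> \<epsilon> then - q j x else p j x) =
    (\<Sum>i<n. s (min i j, max i j) * (if i \<in> \<epsilon> then p i x else q i x))}"

text \<open>Darboux coordinates for \<open>J_mat k\<close> and for \<open>J_ominus \<alpha>\<close>: in the latter case
  \<open>q = (u\<^sup>+, v\<^sup>+)\<close> and \<open>p = (u\<^sup>-, - v\<^sup>-)\<close>.\<close>

definition q_H :: "nat \<Rightarrow> nat \<Rightarrow> 'a::field vec \<Rightarrow> 'a"
  where "q_H k i x = x $ i"

definition p_H :: "nat \<Rightarrow> nat \<Rightarrow> 'a::field vec \<Rightarrow> 'a"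
  where "p_H k i x = x $ (k + i)"

definition q_VV :: "nat \<Rightarrow> nat \<Rightarrow> 'a::field vec \<Rightarrow> 'a"
  where "q_VV \<alpha> i x = (if i < \<alpha> then x $ i else x $ (\<alpha> + i))"

definition p_VV :: "nat \<Rightarrow> nat \<Rightarrow> 'a::field vec \<Rightarrow> 'a"
  where "p_VV \<alpha> i x = (if i < \<alpha> then x $ (\<alpha> + i) else - (x $ (2 * \<alpha> + i)))"

lemma sum_lessThan_add:
  "(\<Sum>i<m + n. f i) = (\<Sum>i<m. f i) + (\<Sum>i<n. f (m + i :: nat) :: 'a::field)"
  by (induction n) (simp_all add: add.assoc)

lemma J_mat_carrier [simp]: "J_mat n \<in> carrier_mat (n + n) (n + n)"
  unfolding J_mat_def by simp

lemma append_vec_cases: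
  assumes "x \<in> carrier_vec (n + m)"
  obtains a b where "a \<in> carrier_vec n" "b \<in> carrier_vec m" "x = a @\<^sub>v b"
  using assms by (metis vec_first_carrier vec_first_last_append vec_last_carrier)

lemma zero_mat_mult_vec:
  assumes "v \<in> carrier_vec m"
  shows "0\<^sub>m n m *\<^sub>v (v :: 'a::field vec) = 0\<^sub>v n"
  using assms by (intro eq_vecI) (auto simp: scalar_prod_def)

lemma bilin_J_mat:
  fixes x y :: "'a::field vec"
  assumes "x \<in> carrier_vec (n + n)" "y \<in> carrier_vec (n + n)"
  shows "bilin (J_mat n) x y = (\<Sum>i<n. q_H n i x * p_H n i y - p_H n i x * q_H n i y)"
proof -
  obtain a b where x: "a \<in> carrier_vec n" "b \<in> carrier_vec n" "x = a @\<^sub>v b"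
    using assms(1) by (rule append_vec_cases)
  obtain c d where y: "c \<in> carrier_vec n" "d \<in> carrier_vec n" "y = c @\<^sub>v d"
    using assms(2) by (rule append_vec_cases)
  have "J_mat n *\<^sub>v y = (0\<^sub>m n n *\<^sub>v c + 1\<^sub>m n *\<^sub>v d) @\<^sub>v (- 1\<^sub>m n *\<^sub>v c + 0\<^sub>m n n *\<^sub>v d)"
    unfolding J_mat_def y(3) by (rule four_block_mat_mult_vec) (use y in auto)
  also have "\<dots> = d @\<^sub>v (- c)"
    using y by (simp add: uminus_mult_mat_vec zero_mat_mult_vec)
  finally have "bilin (J_mat n) x y = a \<bullet> d + b \<bullet> (- c)"
    using x y by (simp add: bilin_def scalar_prod_append[of _ n _ n])
  then show ?thesis
    using x y by (simp add: scalar_prod_def q_H_def p_H_def sum_subtractf sum_negf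
        atLeast0LessThan)
qed

lemma bilin_J_ominus:
  fixes x y :: "'a::field vec"
  assumes "x \<in> carrier_vec ((n + n) + (n + n))" "y \<in> carrier_vec ((n + n) + (n + n))"
  shows "bilin (J_ominus n) x y =
    (\<Sum>i<n + n. q_VV n i x * p_VV n i y - p_VV n i x * q_VV n i y)"
proof -
  obtain a b where x: "a \<in> carrier_vec (n + n)" "b \<in> carrier_vec (n + n)" "x = a @\<^sub>v b"
    using assms(1) by (rule append_vec_cases)
  obtain c d where y: "c \<in> carrier_vec (n + n)" "d \<in> carrier_vec (n + n)" "y = c @\<^sub>v d"
    using assms(2) by (rule append_vec_cases)
  have Jc: "J_mat n *\<^sub>v c \<in> carrier_vec (n + n)" and Jd: "J_mat n *\<^sub>v d \<in> carrier_vec (n + n)"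
    using y by (auto intro: mult_mat_vec_carrier[OF J_mat_carrier])
  have "J_ominus n *\<^sub>v y =
      (J_mat n *\<^sub>v c + 0\<^sub>m (n + n) (n + n) *\<^sub>v d) @\<^sub>v (0\<^sub>m (n + n) (n + n) *\<^sub>v c + - J_mat n *\<^sub>v d)"
    unfolding J_ominus_def y(3) by (rule four_block_mat_mult_vec) (use y in auto)
  also have "\<dots> = (J_mat n *\<^sub>v c) @\<^sub>v (- (J_mat n *\<^sub>v d))"
    using y Jc Jd carrier_matD[OF J_mat_carrier[of n, where 'a = 'a]]
    by (simp add: uminus_mult_mat_vec zero_mat_mult_vec)
  moreover have "b \<bullet> (- (J_mat n *\<^sub>v d)) = - (b \<bullet> (J_mat n *\<^sub>v d))"
    using x carrier_vecD[OF Jd] by (intro scalar_prod_uminus_right) simp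
  ultimately have "bilin (J_ominus n) x y = bilin (J_mat n) a c - bilin (J_mat n) b d"
    using x y Jc Jd by (simp add: bilin_def scalar_prod_append[of _ "n + n" _ "n + n"])
  then show ?thesis
    using x y by (simp add: bilin_J_mat sum_lessThan_add q_H_def p_H_def q_VV_def p_VV_def
        sum_subtractf sum_negf add.assoc)
qed

definition chart_H :: "nat \<Rightarrow> nat set \<Rightarrow> (nat \<times> nat \<Rightarrow> 'a::field) \<Rightarrow> 'a vec set"
  where "chart_H k = lag_chart k (q_H k) (p_H k)"

definition chart_VV :: "nat \<Rightarrow> nat set \<Rightarrow> (nat \<times> nat \<Rightarrow> 'a::field) \<Rightarrow> 'a vec set"
  where "chart_VV \<alpha> = lag_chart (\<alpha> + \<alpha>) (q_VV \<alpha>) (p_VV \<alpha>)"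

definition pair_coords :: "nat \<Rightarrow> (nat \<times> nat + nat \<times> nat) set"
  where "pair_coords k = Sum_Type.Plus (sym_coords k) (sym_coords k)"

definition pair_chart ::
    "nat \<Rightarrow> nat set \<Rightarrow> nat set \<Rightarrow> (nat \<times> nat + nat \<times> nat \<Rightarrow> 'a::field) \<Rightarrow> 'a vec set \<times> 'a vec set"
  where "pair_chart k \<epsilon> \<delta> w = (chart_H k \<epsilon> (\<lambda>e. w (Inl e)), chart_H k \<delta> (\<lambda>e. w (Inr e)))"


section \<open>Rational maps\<close>

text \<open>Zariski closed subsets of \<open>LGr(\<H>) \<times> LGr(\<H>)\<close>: those that are so in each chart.\<close>

definition subvariety_LGr2 :: "nat \<Rightarrow> ('a::field vec set \<times> 'a vec set) set \<Rightarrow> bool"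
  where "subvariety_LGr2 k Z \<longleftrightarrow> Z \<subseteq> LGr (J_mat k) \<times> LGr (J_mat k) \<and>
    (\<forall>\<epsilon> \<subseteq> {..<k}. \<forall>\<delta> \<subseteq> {..<k}. \<exists>F \<subseteq> poly_fun (pair_coords k).
       \<forall>w. pair_chart k \<epsilon> \<delta> w \<in> Z \<longleftrightarrow> (\<forall>f\<in>F. f w = 0))"

text \<open>
  Outside a proper subvariety \<open>Z\<close>, the coordinates of the image, in a suitable chart of
  \<open>LGr(\<V> \<oplus> \<V>)\<close>, are quotients \<open>P e / D e\<close> of polynomials in the coordinates of the
  arguments.
\<close>

definition rational_LGr2 ::
    "nat \<Rightarrow> nat \<Rightarrow> ('a::field vec set \<Rightarrow> 'a vec set \<Rightarrow> 'a vec set) \<Rightarrow> bool"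
  where "rational_LGr2 \<alpha> k \<Phi> \<longleftrightarrow>
    (\<exists>Z. subvariety_LGr2 k Z \<and> Z \<noteq> LGr (J_mat k) \<times> LGr (J_mat k) \<and>
      (\<forall>\<epsilon> \<subseteq> {..<k}. \<forall>\<delta> \<subseteq> {..<k}. \<exists>\<kappa> \<subseteq> {..<\<alpha> + \<alpha>}. \<exists>P D.
        (\<forall>e \<in> sym_coords (\<alpha> + \<alpha>). P e \<in> poly_fun (pair_coords k) \<and> D e \<in> poly_fun (pair_coords k)) \<and>
        (\<forall>w. pair_chart k \<epsilon> \<delta> w \<notin> Z \<longrightarrow>
          (\<forall>e \<in> sym_coords (\<alpha> + \<alpha>). D e w \<noteq> 0) \<and>
          case_prod \<Phi> (pair_chart k \<epsilon> \<delta> w) = chart_VV \<alpha> \<kappa> (\<lambda>e. P e w / D e w))))"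


section \<open>Null sets\<close>

text \<open>
  Haar measure on the vectors indexed by a finite nonempty set \<open>E\<close>, normalised on the unit ball, gives
  the ball of radius \<open>p ^ (- r)\<close> around \<open>c\<close> the measure \<open>p ^ (- r * card E)\<close>.  Null sets are those
  of outer measure zero.  Coordinates outside \<open>E\<close> are irrelevant.
\<close>

definition padic_ball ::
    "'e set \<Rightarrow> ('e \<Rightarrow> 'p::prime_card padic) \<Rightarrow> nat \<Rightarrow> ('e \<Rightarrow> 'p padic) set"
  where "padic_ball E c r =
    {w. \<forall>e\<in>E. \<exists>z\<in>padic_integers. w e = c e + of_nat CARD('p) ^ r * z}"

definition haar_null :: "'e set \<Rightarrow> ('e \<Rightarrow> 'p::prime_card padic) set \<Rightarrow> bool"
  where "haar_null E A \<longleftrightarrow>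
    (\<forall>\<eta>>0. \<exists>c r. A \<subseteq> (\<Union>n::nat. padic_ball E (c n) (r n)) \<and>
       summable (\<lambda>n. (1 / real CARD('p)) ^ (r n * card E)) \<and>
       suminf (\<lambda>n. (1 / real CARD('p)) ^ (r n * card E)) < \<eta>)"

text \<open>A subset of the manifold is null if it is null in each chart of the atlas.\<close>

definition almost_surely_LGr2 ::
    "nat \<Rightarrow> ('p::prime_card padic vec set \<Rightarrow> 'p padic vec set \<Rightarrow> bool) \<Rightarrow> bool"
  where "almost_surely_LGr2 k R \<longleftrightarrow>
    (\<forall>\<epsilon> \<subseteq> {..<k}. \<forall>\<delta> \<subseteq> {..<k}.
       haar_null (pair_coords k) {w. \<not> case_prod R (pair_chart k \<epsilon> \<delta> w)})"

end

theory Submission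
  imports
    "HOL-Probability.Infinite_Product_Measure"
    "HOL-Probability.Probability_Mass_Function"
    "Jordan_Normal_Form.Char_Poly"
    Defs
begin

text \<open>
  In the coordinates \<open>u\<^sup>+, x\<^sup>+, v\<^sup>-, y\<^sup>-\<close> the characteristic function is the image of the solutions of a
  homogeneous linear system that involves only \<open>g\<close> and \<open>g\<^sup>t\<close>.  Since \<open>g \<oplus> (g\<^sup>t)\<^sup>-\<^sup>1\<close> preserves the
  symplectic forms and \<open>Q\<close>, \<open>T\<close> are their own orthogonal complements, a functional that vanishes on
  the orthogonal complement of the image comes from a point of the image; hence the image is
  Lagrangian.  In the standard charts of the Lagrangian Grassmannians the system, completed by
  equations prescribing \<open>2\<alpha>\<close> of the outer coordinates, is square with polynomial coefficients, so
  Cramer's rule gives rational charts for \<open>\<chi>\<close> where its determinant does not vanish.  Prescribing \<open>u\<^sup>+\<close>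
  and \<open>v\<^sup>-\<close> there is always a pair \<open>(Q, T)\<close> with nonzero determinant.  Prescribing \<open>u\<^sup>+\<close> and \<open>u\<^sup>-\<close> the
  determinant is nonzero exactly where \<open>\<chi>\<close> is a graph; as a polynomial in the entries of \<open>g\<close> it
  does not vanish at \<open>g = 1\<close>, and for fixed \<open>g\<close> its zero set is null unless it is everything.  That
  zero sets of polynomials are null, and the whole space is not, is seen by counting residues
  modulo powers of \<open>p\<close>, respectively by choosing the digits of a \<open>p\<close>-adic integer independently.
\<close>

unbundle no vec_syntax
unbundle no inner_syntax
hide_const (open) up_ring.coeff

section \<open>Polynomial functions and square systems of linear equations\<close>

text \<open>Part c) asks for more than genericity: the exceptional set of matrices must itself be
  cut out by polynomials, so almost sure failure has to be equivalent to the vanishing of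
  determinants, not merely imply it. The obstacle is that a determinant also vanishes when the
  system has a nonzero solution whose outer coordinates are all zero. Such a solution is invisible
  in \<open>chi\<close>, which may still be a graph. The determinant for \<open>u\<^sup>+\<close>
  and \<open>v\<^sup>-\<close> excludes these solutions, and for every \<open>g\<close> it is
  nonzero somewhere in every chart. To use it one needs a point outside two null sets; this is why
  the whole space has to be shown not to be null. Elements of K may involve arbitrarily many
  coordinates and leave any given level. Independence of the level and of the representative is
  therefore obtained from a level-free relation between finitely supported vectors. The test pairs
  consist of subspaces \<open>x\<^sup>- = c x\<^sup>+\<close> with nonzero slope. These lie in every
  chart, so one pair serves all charts.\<close>

lemma poly_fun_sum:
  "(\<And>i. i \<in> S \<Longrightarrow> f i \<in> poly_fun E) \<Longrightarrow> (\<lambda>w. \<Sum>i\<in>S. f i w) \<in> poly_fun E"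
  by (induction S rule: infinite_finite_induct) (auto intro: poly_fun.intros)

lemma poly_fun_prod:
  "(\<And>i. i \<in> S \<Longrightarrow> f i \<in> poly_fun E) \<Longrightarrow> (\<lambda>w. \<Prod>i\<in>S. f i w) \<in> poly_fun E"
  by (induction S rule: infinite_finite_induct) (auto intro: poly_fun.intros)

lemma poly_fun_det:
  assumes "\<And>w. A w \<in> carrier_mat n n"
    and "\<And>i j. i < n \<Longrightarrow> j < n \<Longrightarrow> (\<lambda>w. A w $$ (i, j)) \<in> poly_fun E"
  shows "(\<lambda>w. det (A w)) \<in> poly_fun E"
proof -
  have "(\<lambda>w. det (A w)) =
      (\<lambda>w. \<Sum>q | q permutes {0..<n}. signof q * (\<Prod>i = 0..<n. A w $$ (i, q i)))"
    using det_def'[OF assms(1)] by auto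
  also have "\<dots> \<in> poly_fun E"
    by (intro poly_fun_sum poly_fun.mult poly_fun.const poly_fun_prod assms(2))
      (auto simp: permutes_in_image)
  finally show ?thesis .
qed

lemma poly_fun_adj_mat:
  assumes A: "\<And>w. A w \<in> carrier_mat n n"
    and p: "\<And>i j. i < n \<Longrightarrow> j < n \<Longrightarrow> (\<lambda>w. A w $$ (i, j)) \<in> poly_fun E"
    and ij: "i < n" "j < n"
  shows "(\<lambda>w. adj_mat (A w) $$ (i, j)) \<in> poly_fun E"
proof -
  have *: "adj_mat (A w) $$ (i, j) = (- 1) ^ (j + i) * det (mat_delete (A w) j i)" for w
    using A[of w] ij by (simp add: adj_mat_def cofactor_def)
  show ?thesis
    unfolding *
  proof (intro poly_fun.mult poly_fun.const poly_fun_det)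
    show "mat_delete (A w) j i \<in> carrier_mat (n - 1) (n - 1)" for w
      using A[of w] by (rule mat_delete_carrier)
    fix r s assume rs: "r < n - 1" "s < n - 1"
    have "mat_delete (A w) j i $$ (r, s)
        = A w $$ (if r < j then r else Suc r, if s < i then s else Suc s)" for w
      using A[of w] rs by (simp add: mat_delete_def)
    then show "(\<lambda>w. mat_delete (A w) j i $$ (r, s)) \<in> poly_fun E"
      using rs by (auto intro!: p)
  qed
qed

text \<open>Two kinds of variables are kept apart: the parameters \<open>w\<close> (chart
  coordinates, or entries of \<open>g\<close>) enter polynomially, the unknowns \<open>z\<close>
  linearly. Only the values of \<open>z\<close> on \<open>U\<close> matter.\<close>

definition lin_forms ::
    "'v set \<Rightarrow> 'u set \<Rightarrow> (('v \<Rightarrow> 'a::field) \<Rightarrow> ('u \<Rightarrow> 'a) \<Rightarrow> 'a) set"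
  where "lin_forms V U =
    {L. \<exists>a. (\<forall>f\<in>U. a f \<in> poly_fun V) \<and> (\<forall>w z. L w z = (\<Sum>f\<in>U. a f w * z f))}"

lemma lin_forms_var:
  assumes "finite U" "f \<in> U"
  shows "(\<lambda>w z. z f) \<in> lin_forms V U"
  unfolding lin_forms_def mem_Collect_eq
  by (rule exI[of _ "\<lambda>e w. if e = f then 1 else 0"])
    (use assms in \<open>auto intro: poly_fun.const simp: if_distrib[of "\<lambda>x. x * _"] cong: if_cong\<close>)

lemma lin_forms_zero: "(\<lambda>w z. 0) \<in> lin_forms V U"
  unfolding lin_forms_def mem_Collect_eq
  by (rule exI[of _ "\<lambda>e w. 0"]) (auto intro: poly_fun.const)

lemma lin_forms_add:
  assumes "L \<in> lin_forms V U" "L' \<in> lin_forms V U"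
  shows "(\<lambda>w z. L w z + L' w z) \<in> lin_forms V U"
proof -
  from assms obtain a b where "\<forall>f\<in>U. a f \<in> poly_fun V" "\<forall>f\<in>U. b f \<in> poly_fun V"
    and "\<forall>w z. L w z = (\<Sum>f\<in>U. a f w * z f)" "\<forall>w z. L' w z = (\<Sum>f\<in>U. b f w * z f)"
    unfolding lin_forms_def by blast
  then show ?thesis
    unfolding lin_forms_def mem_Collect_eq
    by (intro exI[of _ "\<lambda>e w. a e w + b e w"])
      (auto intro: poly_fun.add simp: sum.distrib distrib_right)
qed

lemma lin_forms_scale:
  assumes "h \<in> poly_fun V" "L \<in> lin_forms V U"
  shows "(\<lambda>w z. h w * L w z) \<in> lin_forms V U"
proof -
  from assms(2) obtain a where "\<forall>f\<in>U. a f \<in> poly_fun V"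
    and "\<forall>w z. L w z = (\<Sum>f\<in>U. a f w * z f)"
    unfolding lin_forms_def by blast
  then show ?thesis
    unfolding lin_forms_def mem_Collect_eq
    by (intro exI[of _ "\<lambda>e w. h w * a e w"])
      (auto intro: poly_fun.mult assms simp: sum_distrib_left mult.assoc)
qed

lemma lin_forms_uminus: "L \<in> lin_forms V U \<Longrightarrow> (\<lambda>w z. - L w z) \<in> lin_forms V U"
  using lin_forms_scale[OF poly_fun.const[of "-1"]] by fastforce

lemma lin_forms_diff:
  "L \<in> lin_forms V U \<Longrightarrow> L' \<in> lin_forms V U \<Longrightarrow> (\<lambda>w z. L w z - L' w z) \<in> lin_forms V U"
  using lin_forms_add[OF _ lin_forms_uminus[of L']] by fastforce

lemma lin_forms_sum:
  "(\<And>i. i \<in> S \<Longrightarrow> L i \<in> lin_forms V U) \<Longrightarrow> (\<lambda>w z. \<Sum>i\<in>S. L i w z) \<in> lin_forms V U"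
  by (induction S rule: infinite_finite_induct) (auto intro: lin_forms_zero lin_forms_add)

lemma lin_forms_linear:
  assumes "L \<in> lin_forms V U"
  shows "L w (\<lambda>f. \<Sum>i\<in>S. c i * z i f) = (\<Sum>i\<in>S. c i * L w (z i))"
proof -
  from assms obtain a where a: "\<And>w z. L w z = (\<Sum>f\<in>U. a f w * z f)"
    unfolding lin_forms_def by blast
  show ?thesis
    unfolding a sum_distrib_left by (subst sum.swap) (simp add: mult.left_commute)
qed

lemma poly_fun_lin_forms:
  assumes "L \<in> lin_forms V U" "\<And>f. f \<in> U \<Longrightarrow> (\<lambda>w. z w f) \<in> poly_fun V"
  shows "(\<lambda>w. L w (z w)) \<in> poly_fun V"
proof -
  from assms obtain a where "\<forall>f\<in>U. a f \<in> poly_fun V" "\<And>w z. L w z = (\<Sum>f\<in>U. a f w * z f)"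
    unfolding lin_forms_def by blast
  with assms(2) show ?thesis by (auto intro!: poly_fun_sum poly_fun.mult)
qed

text \<open>Cramer's rule without division: \<open>D\<close> is the determinant and
  \<open>P g\<close> the column of the adjugate belonging to \<open>g\<close>, so the last identity
  also holds where \<open>D\<close> vanishes. Indexing equations and unknowns by the same set
  \<open>U\<close> makes the system square.\<close>

lemma square_system:
  fixes L :: "'u \<Rightarrow> ('v \<Rightarrow> 'a::field) \<Rightarrow> ('u \<Rightarrow> 'a) \<Rightarrow> 'a"
  assumes U: "finite U" and L: "\<And>e. e \<in> U \<Longrightarrow> L e \<in> lin_forms V U"
  shows "\<exists>D P. D \<in> poly_fun V \<and> (\<forall>e\<in>U. \<forall>f\<in>U. (\<lambda>w. P e w f) \<in> poly_fun V) \<and>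
    (\<forall>w. D w = 0 \<longleftrightarrow> (\<exists>z. (\<exists>f\<in>U. z f \<noteq> 0) \<and> (\<forall>e\<in>U. L e w z = 0))) \<and>
    (\<forall>w. \<forall>e\<in>U. \<forall>g\<in>U. L e w (P g w) = (if e = g then D w else 0))"
proof -
  have "\<forall>e\<in>U. \<exists>a. (\<forall>f\<in>U. a f \<in> poly_fun V) \<and> (\<forall>w z. L e w z = (\<Sum>f\<in>U. a f w * z f))"
    using L unfolding lin_forms_def by blast
  from bchoice[OF this] obtain a
    where a: "\<And>e f. e \<in> U \<Longrightarrow> f \<in> U \<Longrightarrow> a e f \<in> poly_fun V"
      and La: "\<And>e w z. e \<in> U \<Longrightarrow> L e w z = (\<Sum>f\<in>U. a e f w * z f)"
    by blast
  define n where "n = card U"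
  obtain h where h: "bij_betw h {0..<n} U"
    using U ex_bij_betw_nat_finite n_def by blast
  define h' where "h' = the_inv_into {0..<n} h"
  have h'h: "h' (h i) = i" if "i < n" for i
    using h that unfolding h'_def by (simp add: the_inv_into_f_f bij_betw_def)
  have hh': "h (h' e) = e" "h' e < n" if "e \<in> U" for e
    using h that bij_betwE[OF bij_betw_the_inv_into[OF h]] unfolding h'_def
    by (auto simp: f_the_inv_into_f_bij_betw)
  have hU: "h i \<in> U" if "i < n" for i using h that by (auto simp: bij_betw_def)
  have sumU: "(\<Sum>f\<in>U. F f) = (\<Sum>i = 0..<n. F (h i))" for F :: "'u \<Rightarrow> 'a"
    using sum.reindex_bij_betw[OF h, of F] by simp
  define A where "A w = mat n n (\<lambda>(i, j). a (h i) (h j) w)" for w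
  have A: "A w \<in> carrier_mat n n" for w by (simp add: A_def)
  have Ap: "(\<lambda>w. A w $$ (i, j)) \<in> poly_fun V" if "i < n" "j < n" for i j
    using that a hU by (simp add: A_def)
  show ?thesis
  proof (intro exI[of _ "\<lambda>w. det (A w)"] exI[of _ "\<lambda>e w f. adj_mat (A w) $$ (h' f, h' e)"]
      conjI ballI allI)
    show "(\<lambda>w. det (A w)) \<in> poly_fun V" using A Ap by (rule poly_fun_det)
    show "(\<lambda>w. adj_mat (A w) $$ (h' f, h' e)) \<in> poly_fun V" if "e \<in> U" "f \<in> U" for e f
      by (rule poly_fun_adj_mat[OF A Ap]) (use that hh' in auto)
    show "L e w (\<lambda>f. adj_mat (A w) $$ (h' f, h' g)) = (if e = g then det (A w) else 0)"
      if e: "e \<in> U" and g: "g \<in> U" for w e g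
    proof -
      have "L e w (\<lambda>f. adj_mat (A w) $$ (h' f, h' g))
          = (\<Sum>i = 0..<n. a e (h i) w * adj_mat (A w) $$ (i, h' g))"
        by (simp add: La[OF e] sumU h'h)
      also have "\<dots> = (A w * adj_mat (A w)) $$ (h' e, h' g)"
        using A[of w] adj_mat(1)[OF A[of w]] hh' e g
        by (auto simp: scalar_prod_def A_def intro!: sum.cong)
      also have "\<dots> = (if e = g then det (A w) else 0)"
        using hh'[OF e] hh'[OF g] by (subst adj_mat(2)[OF A]) auto
      finally show ?thesis .
    qed
    show "det (A w) = 0 \<longleftrightarrow> (\<exists>z. (\<exists>f\<in>U. z f \<noteq> 0) \<and> (\<forall>e\<in>U. L e w z = 0))" for w
    proof
      assume "det (A w) = 0"
      then obtain v where v: "v \<in> carrier_vec n" "v \<noteq> 0\<^sub>v n" "A w *\<^sub>v v = 0\<^sub>v n"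
        using det_0_iff_vec_prod_zero_field[OF A] by blast
      from v(1,2) obtain i where i: "i < n" "v $ i \<noteq> 0" by (auto simp: vec_eq_iff)
      have "L e w (\<lambda>f. v $ h' f) = 0" if e: "e \<in> U" for e
      proof -
        have "L e w (\<lambda>f. v $ h' f) = (\<Sum>i = 0..<n. a e (h i) w * v $ i)"
          by (simp add: La[OF e] sumU h'h)
        also have "\<dots> = (A w *\<^sub>v v) $ h' e"
          using v(1) hh'[OF e] by (auto simp: A_def scalar_prod_def intro!: sum.cong)
        also have "\<dots> = 0" using v(3) hh'[OF e] by simp
        finally show ?thesis .
      qed
      then show "\<exists>z. (\<exists>f\<in>U. z f \<noteq> 0) \<and> (\<forall>e\<in>U. L e w z = 0)"
        using i hU[OF i(1)] h'h[OF i(1)]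
        by (intro exI[of _ "\<lambda>f. v $ h' f"] conjI bexI[of _ "h i"]) auto
    next
      assume "\<exists>z. (\<exists>f\<in>U. z f \<noteq> 0) \<and> (\<forall>e\<in>U. L e w z = 0)"
      then obtain z f where z: "f \<in> U" "z f \<noteq> 0" "\<And>e. e \<in> U \<Longrightarrow> L e w z = 0" by blast
      have "vec n (\<lambda>i. z (h i)) $ h' f \<noteq> 0\<^sub>v n $ h' f" using z hh'[OF z(1)] by simp
      then have "vec n (\<lambda>i. z (h i)) \<noteq> 0\<^sub>v n" by metis
      moreover have "A w *\<^sub>v vec n (\<lambda>i. z (h i)) = 0\<^sub>v n"
      proof (rule eq_vecI)
        fix i assume i: "i < dim_vec (0\<^sub>v n :: 'a vec)"
        then have "(A w *\<^sub>v vec n (\<lambda>i. z (h i))) $ i = (\<Sum>j = 0..<n. a (h i) (h j) w * z (h j))"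
          by (auto simp: A_def scalar_prod_def)
        also have "\<dots> = L (h i) w z" using i by (simp add: La hU sumU)
        finally show "(A w *\<^sub>v vec n (\<lambda>i. z (h i))) $ i = 0\<^sub>v n $ i" using i z(3) hU by simp
      qed (simp add: A_def)
      ultimately show "det (A w) = 0"
        using det_0_iff_vec_prod_zero_field[OF A[of w]] by (metis vec_carrier)
    qed
  qed
qed

text \<open>Eigenvalues are roots of the characteristic polynomial, which is monic and hence
  nonzero. Over an infinite field this leaves scalars that are not eigenvalues; the slope of a test
  subspace is chosen among them.\<close>

lemma finite_eigenvalues:
  fixes N :: "'u \<Rightarrow> 'u \<Rightarrow> 'a::field"
  assumes U: "finite U"
  shows "finite {c. \<exists>z. (\<exists>f\<in>U. z f \<noteq> 0) \<and> (\<forall>e\<in>U. (\<Sum>f\<in>U. N e f * z f) = c * z e)}"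
proof -
  define n where "n = card U"
  obtain h where h: "bij_betw h {0..<n} U"
    using U ex_bij_betw_nat_finite n_def by blast
  have hU: "h i \<in> U" if "i < n" for i using h that by (auto simp: bij_betw_def)
  define A where "A = mat n n (\<lambda>(i, j). N (h i) (h j))"
  have A: "A \<in> carrier_mat n n" by (simp add: A_def)
  have "char_poly A \<noteq> 0" using degree_monic_char_poly[OF A] by auto
  then have "finite {c. poly (char_poly A) c = 0}" by (rule poly_roots_finite)
  moreover have "poly (char_poly A) c = 0"
    if z: "f \<in> U" "z f \<noteq> 0" "\<And>e. e \<in> U \<Longrightarrow> (\<Sum>f\<in>U. N e f * z f) = c * z e" for c z f
  proof -
    obtain i where i: "i < n" "h i = f" using h z(1) by (auto simp: bij_betw_def)
    have "vec n (\<lambda>i. z (h i)) $ i \<noteq> 0\<^sub>v n $ i" using i z(2) by simp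
    then have "vec n (\<lambda>i. z (h i)) \<noteq> 0\<^sub>v n" by metis
    moreover have "A *\<^sub>v vec n (\<lambda>i. z (h i)) = c \<cdot>\<^sub>v vec n (\<lambda>i. z (h i))"
    proof (rule eq_vecI)
      fix i assume "i < dim_vec (c \<cdot>\<^sub>v vec n (\<lambda>i. z (h i)))"
      then show "(A *\<^sub>v vec n (\<lambda>i. z (h i))) $ i = (c \<cdot>\<^sub>v vec n (\<lambda>i. z (h i))) $ i"
        using z(3)[OF hU, of i] sum.reindex_bij_betw[OF h, of "\<lambda>f. N (h i) f * z f"]
        by (simp add: A_def scalar_prod_def)
    qed (simp add: A_def)
    ultimately have "eigenvalue A c"
      using A unfolding eigenvalue_def eigenvector_def by (metis carrier_matD(1) vec_carrier)
    then show ?thesis using eigenvalue_root_char_poly[OF A] by simp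
  qed
  ultimately show ?thesis by - (rule finite_subset[of _ "{c. poly (char_poly A) c = 0}"], auto)
qed

text \<open>The double annihilator of a subspace is the subspace. \<open>\<Phi>\<close> is described
  by closure under \<open>\<phi> + c * \<psi>\<close> and compared only on \<open>E\<close>;
  eliminating one coordinate at a time avoids bases and dimensions.\<close>

lemma double_perp:
  fixes \<Phi> :: "('u \<Rightarrow> 'a::field) set"
  assumes "finite E" "\<Phi> \<noteq> {}"
    and "\<And>\<phi> \<psi> c. \<phi> \<in> \<Phi> \<Longrightarrow> \<psi> \<in> \<Phi> \<Longrightarrow> (\<lambda>e. \<phi> e + c * \<psi> e) \<in> \<Phi>"
    and "\<And>x. (\<And>\<phi>. \<phi> \<in> \<Phi> \<Longrightarrow> (\<Sum>e\<in>E. \<phi> e * x e) = 0) \<Longrightarrow> (\<Sum>e\<in>E. f e * x e) = 0"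
  shows "\<exists>\<phi>\<in>\<Phi>. \<forall>e\<in>E. f e = \<phi> e"
  using assms
proof (induction E arbitrary: \<Phi> f rule: finite_induct)
  case empty
  then show ?case by auto
next
  case (insert d E)
  note lin = insert.prems(2) and perp = insert.prems(3)
  show ?case
  proof (cases "\<exists>\<phi>\<in>\<Phi>. \<phi> d \<noteq> 0")
    \<comment> \<open>No member of \<open>\<Phi>\<close> sees \<open>d\<close>: test vectors may be
      set to zero at \<open>d\<close>, and the unit vector at \<open>d\<close> shows
      \<open>f d = 0\<close>.\<close>
    case False
    have "(\<Sum>e\<in>E. f e * x e) = 0" if x: "\<And>\<phi>. \<phi> \<in> \<Phi> \<Longrightarrow> (\<Sum>e\<in>E. \<phi> e * x e) = 0" for x
    proof -
      have *: "(\<Sum>e\<in>insert d E. \<phi> e * (x(d := 0)) e) = (\<Sum>e\<in>E. \<phi> e * x e)" for \<phi>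
        using insert.hyps by (auto intro!: sum.cong)
      show ?thesis using perp[of "x(d := 0)"] x unfolding * by blast
    qed
    from insert.IH[OF insert.prems(1) lin this] obtain \<phi> where "\<phi> \<in> \<Phi>" "\<forall>e\<in>E. f e = \<phi> e"
      by blast
    moreover have "f d = 0"
    proof -
      have "(\<Sum>e\<in>insert d E. f e * (if e = d then 1 else 0)) = 0"
        using insert.hyps False by (intro perp) (auto intro!: sum.neutral)
      moreover have "(\<Sum>e\<in>E. f e * (if e = d then 1 else 0)) = 0"
        using insert.hyps by (intro sum.neutral) auto
      ultimately show ?thesis using insert.hyps by simp
    qed
    ultimately show ?thesis using False by auto
  next
    case True
    then obtain \<phi>0 where \<phi>0: "\<phi>0 \<in> \<Phi>" "\<phi>0 d \<noteq> 0" by blast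
    \<comment> \<open>Elimination of \<open>d\<close>: \<open>f - c * \<phi>0\<close> vanishes at
      \<open>d\<close> and is to be found among the members of \<open>\<Phi>\<close> that vanish
      there.\<close>
    define \<Phi>' where "\<Phi>' = {\<phi> \<in> \<Phi>. \<phi> d = 0}"
    define c where "c = f d / \<phi>0 d"
    have "\<exists>\<phi>\<in>\<Phi>'. \<forall>e\<in>E. f e - c * \<phi>0 e = \<phi> e"
    proof (rule insert.IH)
      have "(\<lambda>e. \<phi>0 e + (- 1) * \<phi>0 e) \<in> \<Phi>" using \<phi>0 lin by blast
      then show "\<Phi>' \<noteq> {}" unfolding \<Phi>'_def by auto
      show "(\<lambda>e. \<phi> e + c * \<psi> e) \<in> \<Phi>'" if "\<phi> \<in> \<Phi>'" "\<psi> \<in> \<Phi>'" for \<phi> \<psi> c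
        using that lin unfolding \<Phi>'_def by auto
      fix x assume x: "\<And>\<phi>. \<phi> \<in> \<Phi>' \<Longrightarrow> (\<Sum>e\<in>E. \<phi> e * x e) = 0"
      \<comment> \<open>The value at \<open>d\<close> for which \<open>\<phi>0\<close> annihilates
        the extended vector. Every member of \<open>\<Phi>\<close> then does, being a multiple of
        \<open>\<phi>0\<close> plus a member of \<open>\<Phi>'\<close>.\<close>
      define t where "t = - (\<Sum>e\<in>E. \<phi>0 e * x e) / \<phi>0 d"
      have ext: "(\<Sum>e\<in>insert d E. \<phi> e * (x(d := t)) e) = \<phi> d * t + (\<Sum>e\<in>E. \<phi> e * x e)" for \<phi>
        using insert.hyps by (auto intro!: sum.cong)
      have "(\<Sum>e\<in>insert d E. \<phi> e * (x(d := t)) e) = 0" if "\<phi> \<in> \<Phi>" for \<phi>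
      proof -
        have "(\<lambda>e. \<phi> e + (- \<phi> d / \<phi>0 d) * \<phi>0 e) \<in> \<Phi>'"
          using lin[OF that \<phi>0(1), of "- \<phi> d / \<phi>0 d"] \<phi>0 unfolding \<Phi>'_def by simp
        from x[OF this] have "(\<Sum>e\<in>E. \<phi> e * x e) = \<phi> d / \<phi>0 d * (\<Sum>e\<in>E. \<phi>0 e * x e)"
          by (simp add: distrib_right sum.distrib sum_distrib_left sum_negf mult.assoc
              sum_subtractf algebra_simps)
        then show ?thesis unfolding ext by (simp add: t_def)
      qed
      from perp[OF this] have "f d * t + (\<Sum>e\<in>E. f e * x e) = 0" unfolding ext .
      moreover have "(\<Sum>e\<in>E. (f e - c * \<phi>0 e) * x e)
          = (\<Sum>e\<in>E. f e * x e) - c * (\<Sum>e\<in>E. \<phi>0 e * x e)"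
        by (simp add: left_diff_distrib sum_subtractf sum_distrib_left mult.assoc)
      ultimately show "(\<Sum>e\<in>E. (f e - c * \<phi>0 e) * x e) = 0"
        using \<phi>0 by (simp add: t_def c_def)
    qed
    then obtain \<phi> where \<phi>: "\<phi> \<in> \<Phi>'" "\<forall>e\<in>E. f e - c * \<phi>0 e = \<phi> e" by blast
    have "(\<lambda>e. \<phi> e + c * \<phi>0 e) \<in> \<Phi>" using lin \<phi> \<phi>0 unfolding \<Phi>'_def by blast
    moreover have "\<forall>e\<in>insert d E. f e = \<phi> e + c * \<phi>0 e"
      using \<phi> \<phi>0 by (auto simp: \<Phi>'_def c_def algebra_simps)
    ultimately show ?thesis by (intro bexI)
  qed
qed

section \<open>Lagrangian subspaces in Darboux coordinates\<close>

text \<open>Taking \<open>c = 1\<close>, or \<open>x\<close> zero, recovers sums and multiples, so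
  that a single closure condition has to be checked for the subspaces below.\<close>

lemma subspace_module_vec_iff:
  "subspace class_ring L (module_vec TYPE('a::field) n) \<longleftrightarrow>
    L \<subseteq> carrier_vec n \<and> 0\<^sub>v n \<in> L \<and> (\<forall>x\<in>L. \<forall>y\<in>L. \<forall>c. x + c \<cdot>\<^sub>v y \<in> L)"
  (is "?S \<longleftrightarrow> ?R")
proof
  assume ?S
  then have sub: "submodule class_ring L (module_vec TYPE('a) n)" by (simp add: subspace_def)
  show ?R
    using submodule.subset[OF sub] submodule.zero_closed[OF sub] submodule.m_closed[OF sub]
      submodule.smult_closed[OF sub]
    by (simp add: module_vec_simps class_ring_simps)
next
  assume R: ?R
  have "x + y \<in> L" if "x \<in> L" "y \<in> L" for x y
    using R that by (metis one_smult_vec)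
  moreover have "c \<cdot>\<^sub>v x \<in> L" if x: "x \<in> L" for c x
  proof -
    have "c \<cdot>\<^sub>v x \<in> carrier_vec n" using R x by auto
    then show ?thesis using R x by (metis left_zero_vec)
  qed
  ultimately show ?S
    using R vec_module[where ?'a = 'a] vec_vs[where ?'a = 'a]
    by (auto simp: VectorSpace.subspace_def submodule_def module_vec_simps class_ring_simps)
qed

lemma bilin_add_left:
  assumes "\<Omega> \<in> carrier_mat N N" "x \<in> carrier_vec N" "x' \<in> carrier_vec N" "y \<in> carrier_vec N"
  shows "bilin \<Omega> (x + c \<cdot>\<^sub>v x') y = bilin \<Omega> x y + c * bilin \<Omega> x' y"
  using assms unfolding bilin_def
  by (subst add_scalar_prod_distrib[of _ N]) (auto simp: mult_mat_vec_carrier)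

lemma bilin_add_right:
  assumes "\<Omega> \<in> carrier_mat N N" "x \<in> carrier_vec N" "y \<in> carrier_vec N" "y' \<in> carrier_vec N"
  shows "bilin \<Omega> x (y + c \<cdot>\<^sub>v y') = bilin \<Omega> x y + c * bilin \<Omega> x y'"
  using assms unfolding bilin_def
  by (simp add: mult_add_distrib_mat_vec[of _ N N] mult_mat_vec[of _ N N]
      scalar_prod_add_distrib[of _ N])

text \<open>A vector orthogonal to \<open>L\<close> spans together with \<open>L\<close> an
  isotropic subspace, because the form is alternating; maximality puts the vector into
  \<open>L\<close>. Maximal isotropic thus means equal to its own orthogonal complement, and no
  dimensions are counted. \<open>alt\<close> stands beside \<open>skew\<close> because skew symmetry
  does not imply it in characteristic 2.\<close>

lemma LGr_iff:
  fixes \<Omega> :: "'a::field mat"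
  assumes \<Omega>: "\<Omega> \<in> carrier_mat N N"
    and alt: "\<And>x. x \<in> carrier_vec N \<Longrightarrow> bilin \<Omega> x x = 0"
    and skew: "\<And>x y. x \<in> carrier_vec N \<Longrightarrow> y \<in> carrier_vec N \<Longrightarrow> bilin \<Omega> x y = - bilin \<Omega> y x"
  shows "L \<in> LGr \<Omega> \<longleftrightarrow> subspace class_ring L (module_vec TYPE('a) N) \<and>
    L = {x \<in> carrier_vec N. \<forall>y\<in>L. bilin \<Omega> x y = 0}"
proof -
  have dim: "dim_row \<Omega> = N" using \<Omega> by auto
  show ?thesis
  proof
    assume L: "L \<in> LGr \<Omega>"
    then have sub: "subspace class_ring L (module_vec TYPE('a) N)"
      and iso: "\<And>x y. x \<in> L \<Longrightarrow> y \<in> L \<Longrightarrow> bilin \<Omega> x y = 0"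
      and max: "\<And>M. isotropic \<Omega> M \<Longrightarrow> L \<subseteq> M \<Longrightarrow> M = L"
      by (auto simp: LGr_def isotropic_def dim)
    note subL = sub[unfolded subspace_module_vec_iff]
    have "w \<in> L" if w: "w \<in> carrier_vec N" "\<And>y. y \<in> L \<Longrightarrow> bilin \<Omega> w y = 0" for w
    proof -
      define M where "M = {x + c \<cdot>\<^sub>v w | x c. x \<in> L}"
      have car: "x \<in> carrier_vec N" if "x \<in> L" for x using subL that by auto
      have inM: "x + c \<cdot>\<^sub>v w \<in> M" if "x \<in> L" for x c unfolding M_def using that by auto
      have LM: "L \<subseteq> M"
      proof
        fix x assume x: "x \<in> L"
        then have "x + 0 \<cdot>\<^sub>v w = x" using car[OF x] w(1) by (intro eq_vecI) auto
        then show "x \<in> M" using inM[OF x, of 0] by simp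
      qed
      have "x + c \<cdot>\<^sub>v w + d \<cdot>\<^sub>v (y + e \<cdot>\<^sub>v w) \<in> M" if "x \<in> L" "y \<in> L" for x y c d e
      proof -
        have "x + c \<cdot>\<^sub>v w + d \<cdot>\<^sub>v (y + e \<cdot>\<^sub>v w) = (x + d \<cdot>\<^sub>v y) + (c + d * e) \<cdot>\<^sub>v w"
          using car[OF that(1)] car[OF that(2)] w(1)
          by (intro eq_vecI) (auto simp: algebra_simps)
        then show ?thesis using inM subL that by simp
      qed
      then have "subspace class_ring M (module_vec TYPE('a) N)"
        unfolding subspace_module_vec_iff using LM subL w(1) car by (auto simp: M_def)
      moreover have "bilin \<Omega> a b = 0" if ab: "a \<in> M" "b \<in> M" for a b
      proof -
        obtain x y c d where ab: "a = x + c \<cdot>\<^sub>v w" "b = y + d \<cdot>\<^sub>v w" and L: "x \<in> L" "y \<in> L"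
          using ab unfolding M_def by blast
        have "bilin \<Omega> x w = 0" using skew[of x w] w(2)[OF L(1)] car[OF L(1)] w(1) by simp
        then show ?thesis
          using car[OF L(1)] car[OF L(2)] w iso[OF L] L alt
          by (simp add: ab bilin_add_left[OF \<Omega>] bilin_add_right[OF \<Omega>])
      qed
      ultimately have "M = L" using LM by (intro max) (auto simp: isotropic_def dim)
      moreover have "0\<^sub>v N + 1 \<cdot>\<^sub>v w \<in> M" using inM subL by blast
      ultimately show ?thesis using w(1) by simp
    qed
    then have "L = {x \<in> carrier_vec N. \<forall>y\<in>L. bilin \<Omega> x y = 0}"
      using subL iso by (intro equalityI subsetI) auto
    with sub show "subspace class_ring L (module_vec TYPE('a) N) \<and>
        L = {x \<in> carrier_vec N. \<forall>y\<in>L. bilin \<Omega> x y = 0}" by (rule conjI)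
  next
    assume L: "subspace class_ring L (module_vec TYPE('a) N) \<and>
        L = {x \<in> carrier_vec N. \<forall>y\<in>L. bilin \<Omega> x y = 0}"
    note sub = conjunct1[OF L]
    note mem = eqset_imp_iff[OF conjunct2[OF L], unfolded mem_Collect_eq]
    have "isotropic \<Omega> L" unfolding isotropic_def dim using sub mem by blast
    moreover have "M = L" if M: "isotropic \<Omega> M" "L \<subseteq> M" for M
    proof
      show "M \<subseteq> L"
      proof
        fix x assume x: "x \<in> M"
        moreover have "M \<subseteq> carrier_vec N"
          using M(1) by (simp add: isotropic_def dim subspace_module_vec_iff)
        moreover have "bilin \<Omega> x y = 0" if "y \<in> L" for y
          using M x that unfolding isotropic_def by blast
        ultimately show "x \<in> L" using mem[of x] by blast
      qed
    qed (rule M(2))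
    ultimately show "L \<in> LGr \<Omega>" unfolding LGr_def by simp
  qed
qed

text \<open>A common frame for \<H> and \<V> \<oplus> \<V>, whose Darboux coordinates sit at
  different positions and carry different signs. By \<open>surj\<close> the coordinates can be
  prescribed freely, which supplies test vectors.\<close>

locale darboux =
  fixes n :: nat and q p :: "nat \<Rightarrow> 'a::field vec \<Rightarrow> 'a" and \<Omega> :: "'a mat"
  assumes carrier: "\<Omega> \<in> carrier_mat (n + n) (n + n)"
    and bilin_eq: "x \<in> carrier_vec (n + n) \<Longrightarrow> y \<in> carrier_vec (n + n) \<Longrightarrow>
      bilin \<Omega> x y = (\<Sum>i<n. q i x * p i y - p i x * q i y)"
    and q_lin: "i < n \<Longrightarrow> x \<in> carrier_vec (n + n) \<Longrightarrow> y \<in> carrier_vec (n + n) \<Longrightarrow>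
      q i (x + c \<cdot>\<^sub>v y) = q i x + c * q i y"
    and p_lin: "i < n \<Longrightarrow> x \<in> carrier_vec (n + n) \<Longrightarrow> y \<in> carrier_vec (n + n) \<Longrightarrow>
      p i (x + c \<cdot>\<^sub>v y) = p i x + c * p i y"
    and zero: "i < n \<Longrightarrow> q i (0\<^sub>v (n + n)) = 0" "i < n \<Longrightarrow> p i (0\<^sub>v (n + n)) = 0"
    and surj: "\<exists>x\<in>carrier_vec (n + n). \<forall>i<n. q i x = f i \<and> p i x = g i"
begin

lemma bilin_skew:
  "x \<in> carrier_vec (n + n) \<Longrightarrow> y \<in> carrier_vec (n + n) \<Longrightarrow> bilin \<Omega> x y = - bilin \<Omega> y x"
  by (simp add: bilin_eq sum_subtractf mult.commute)

lemma LGr_iff_perp: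
  "L \<in> LGr \<Omega> \<longleftrightarrow> subspace class_ring L (module_vec TYPE('a) (n + n)) \<and>
    L = {x \<in> carrier_vec (n + n). \<forall>y\<in>L. bilin \<Omega> x y = 0}"
proof (rule LGr_iff[OF carrier])
  show "bilin \<Omega> x x = 0" if "x \<in> carrier_vec (n + n)" for x
    using that by (simp add: bilin_eq mult.commute)
qed (rule bilin_skew)

definition qt :: "nat set \<Rightarrow> nat \<Rightarrow> 'a vec \<Rightarrow> 'a"
  where "qt \<kappa> i x = (if i \<in> \<kappa> then p i x else q i x)"

definition pt :: "nat set \<Rightarrow> nat \<Rightarrow> 'a vec \<Rightarrow> 'a"
  where "pt \<kappa> i x = (if i \<in> \<kappa> then - q i x else p i x)"

text \<open>Replacing \<open>(q, p)\<close> by \<open>(p, - q)\<close> does not change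
  \<open>q p' - p q'\<close>.\<close>

lemma bilin_twisted:
  "x \<in> carrier_vec (n + n) \<Longrightarrow> y \<in> carrier_vec (n + n) \<Longrightarrow>
    bilin \<Omega> x y = (\<Sum>i<n. qt \<kappa> i x * pt \<kappa> i y - pt \<kappa> i x * qt \<kappa> i y)"
  unfolding bilin_eq qt_def pt_def by (intro sum.cong) auto

lemma lag_chart_twisted:
  "lag_chart n q p \<kappa> s = {x \<in> carrier_vec (n + n).
    \<forall>j<n. pt \<kappa> j x = (\<Sum>i<n. s (min i j, max i j) * qt \<kappa> i x)}"
  unfolding lag_chart_def pt_def qt_def by simp

lemma twisted_lin:
  assumes "i < n" "x \<in> carrier_vec (n + n)" "y \<in> carrier_vec (n + n)"
  shows "qt \<kappa> i (x + c \<cdot>\<^sub>v y) = qt \<kappa> i x + c * qt \<kappa> i y"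
    and "pt \<kappa> i (x + c \<cdot>\<^sub>v y) = pt \<kappa> i x + c * pt \<kappa> i y"
  using assms by (auto simp: qt_def pt_def q_lin p_lin)

lemma twisted_zero:
  "i < n \<Longrightarrow> qt \<kappa> i (0\<^sub>v (n + n)) = 0" "i < n \<Longrightarrow> pt \<kappa> i (0\<^sub>v (n + n)) = 0"
  by (auto simp: qt_def pt_def zero)

lemma surj_twisted: "\<exists>x\<in>carrier_vec (n + n). \<forall>i<n. qt \<kappa> i x = f i \<and> pt \<kappa> i x = g i"
  using surj[of "\<lambda>i. if i \<in> \<kappa> then - g i else f i" "\<lambda>i. if i \<in> \<kappa> then f i else g i"]
  by (auto simp: qt_def pt_def split: if_splits)

lemma subspace_lag_chart:
  "subspace class_ring (lag_chart n q p \<kappa> s) (module_vec TYPE('a) (n + n))"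
  unfolding subspace_module_vec_iff lag_chart_twisted
  by (auto simp: twisted_lin twisted_zero sum.distrib sum_distrib_left algebra_simps)

text \<open>Isotropy is the symmetry of the matrix, which the indices \<open>min\<close> and
  \<open>max\<close> enforce. Conversely, pairing \<open>y\<close> with the vector of the chart
  whose \<open>qt\<close> coordinates are the \<open>j\<close>-th unit vector gives exactly the
  \<open>j\<close>-th chart equation for \<open>y\<close>.\<close>

lemma lag_chart_in_LGr: "lag_chart n q p \<kappa> s \<in> LGr \<Omega>"
proof -
  let ?C = "lag_chart n q p \<kappa> s"
  let ?S = "\<lambda>i j. s (min i j, max i j)"
  have iso: "bilin \<Omega> x y = 0" if x: "x \<in> ?C" and y: "y \<in> ?C" for x y
  proof -
    have "bilin \<Omega> x y = (\<Sum>j<n. qt \<kappa> j x * pt \<kappa> j y) - (\<Sum>j<n. pt \<kappa> j x * qt \<kappa> j y)"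
      using x y by (subst bilin_twisted[of _ _ \<kappa>]) (auto simp: lag_chart_def sum_subtractf)
    also have "(\<Sum>j<n. qt \<kappa> j x * pt \<kappa> j y) = (\<Sum>j<n. \<Sum>i<n. qt \<kappa> j x * ?S i j * qt \<kappa> i y)"
      using y by (simp add: lag_chart_twisted sum_distrib_left mult.assoc)
    also have "\<dots> = (\<Sum>i<n. \<Sum>j<n. qt \<kappa> j x * ?S i j * qt \<kappa> i y)" by (rule sum.swap)
    also have "\<dots> = (\<Sum>j<n. pt \<kappa> j x * qt \<kappa> j y)"
      using x by (auto simp: lag_chart_twisted sum_distrib_right min.commute max.commute
          mult.commute sum_distrib_left mult.left_commute intro!: sum.cong)
    finally show ?thesis by simp
  qed
  have max: "y \<in> ?C" if y: "y \<in> carrier_vec (n + n)" "\<And>x. x \<in> ?C \<Longrightarrow> bilin \<Omega> y x = 0" for y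
  proof -
    have "pt \<kappa> j y = (\<Sum>i<n. ?S i j * qt \<kappa> i y)" if j: "j < n" for j
    proof -
      obtain x where x: "x \<in> carrier_vec (n + n)"
        "\<And>i. i < n \<Longrightarrow> qt \<kappa> i x = (if i = j then 1 else 0) \<and> pt \<kappa> i x = ?S i j"
        using surj_twisted[of \<kappa> "\<lambda>i. if i = j then 1 else 0" "\<lambda>i. ?S i j"] by blast
      have "(\<Sum>i<n. ?S i l * qt \<kappa> i x) = (\<Sum>i<n. if i = j then ?S i l else 0)" for l
        using x(2) by (intro sum.cong) auto
      then have "x \<in> ?C" using x j
        by (auto simp: lag_chart_twisted min.commute max.commute)
      then have "0 = bilin \<Omega> y x" using y by simp
      also have "\<dots> = (\<Sum>i<n. qt \<kappa> i y * ?S i j) - (\<Sum>i<n. if i = j then pt \<kappa> i y else 0)"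
        unfolding bilin_twisted[OF y(1) x(1), of \<kappa>] sum_subtractf using x(2)
        by (intro arg_cong2[of _ _ _ _ "(-)"] sum.cong) auto
      also have "\<dots> = (\<Sum>i<n. qt \<kappa> i y * ?S i j) - pt \<kappa> j y" using j by simp
      finally show ?thesis by (simp add: mult.commute)
    qed
    then show ?thesis using y by (auto simp: lag_chart_twisted)
  qed
  have "?C = {x \<in> carrier_vec (n + n). \<forall>y\<in>?C. bilin \<Omega> x y = 0}"
  proof (intro equalityI subsetI CollectI conjI ballI)
    show "x \<in> carrier_vec (n + n)" if "x \<in> ?C" for x using that by (simp add: lag_chart_def)
    show "bilin \<Omega> x y = 0" if "x \<in> ?C" "y \<in> ?C" for x y using that by (rule iso)
    show "x \<in> ?C" if "x \<in> {x \<in> carrier_vec (n + n). \<forall>y\<in>?C. bilin \<Omega> x y = 0}" for x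
      using that by (intro max) auto
  qed
  with subspace_lag_chart show ?thesis by (rule LGr_iff_perp[THEN iffD2, OF conjI])
qed

lemma LGr_isotropic:
  assumes "L \<in> LGr \<Omega>" "x \<in> L" "y \<in> L"
  shows "bilin \<Omega> x y = 0"
proof -
  from assms(1) have "isotropic \<Omega> L" unfolding LGr_def by simp
  with assms(2,3) show ?thesis unfolding isotropic_def by simp
qed

lemma LGr_subspace:
  assumes "L \<in> LGr \<Omega>"
  shows "subspace class_ring L (module_vec TYPE('a) (n + n))"
  using assms unfolding LGr_iff_perp by (rule conjunct1)

lemma LGr_carrier: "L \<in> LGr \<Omega> \<Longrightarrow> x \<in> L \<Longrightarrow> x \<in> carrier_vec (n + n)"
  using LGr_subspace[of L] unfolding subspace_module_vec_iff by blast

lemma LGr_eqI: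
  assumes "L \<in> LGr \<Omega>" "M \<in> LGr \<Omega>" "L \<subseteq> M"
  shows "L = M"
proof -
  from assms(2) have "isotropic \<Omega> M" unfolding LGr_def by simp
  moreover from assms(1) have "isotropic \<Omega> M \<longrightarrow> L \<subseteq> M \<longrightarrow> M = L" unfolding LGr_def by simp
  ultimately show ?thesis using assms(3) by simp
qed

lemma LGr_memI:
  assumes "L \<in> LGr \<Omega>" "x \<in> carrier_vec (n + n)" "\<And>y. y \<in> L \<Longrightarrow> bilin \<Omega> x y = 0"
  shows "x \<in> L"
proof -
  from assms(1) have "L = {x \<in> carrier_vec (n + n). \<forall>y\<in>L. bilin \<Omega> x y = 0}"
    unfolding LGr_iff_perp by (rule conjunct2)
  moreover have "x \<in> {x \<in> carrier_vec (n + n). \<forall>y\<in>L. bilin \<Omega> x y = 0}"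
    using assms(2,3) by simp
  ultimately show ?thesis by (rule ssubst)
qed

text \<open>Pairing with a basis of \<open>L\<close> dual to the coordinates \<open>qt\<close> expresses \<open>pt\<close> through \<open>qt\<close>;
  both sides being Lagrangian, one inclusion suffices.\<close>

lemma LGr_eq_lag_chart:
  assumes L: "L \<in> LGr \<Omega>" and x: "\<And>i. i < n \<Longrightarrow> x i \<in> L"
    and dual: "\<And>i l. i < n \<Longrightarrow> l < n \<Longrightarrow> qt \<kappa> l (x i) = (if l = i then 1 else 0)"
  shows "L = lag_chart n q p \<kappa> (\<lambda>(i, j). pt \<kappa> j (x i))"
proof -
  have pairing: "pt \<kappa> i y = (\<Sum>l<n. pt \<kappa> l (x i) * qt \<kappa> l y)" if "i < n" "y \<in> L" for i y
  proof -
    have "0 = bilin \<Omega> (x i) y" using LGr_isotropic[OF L x] that by simp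
    also have "\<dots> = (\<Sum>l<n. (if l = i then pt \<kappa> i y else 0)) - (\<Sum>l<n. pt \<kappa> l (x i) * qt \<kappa> l y)"
      using that x dual LGr_carrier[OF L]
      by (subst bilin_twisted[of _ _ \<kappa>])
        (auto simp: sum_subtractf if_distrib[of "\<lambda>a. a * _"] cong: if_cong)
    finally show ?thesis using that by simp
  qed
  \<comment> \<open>Pairing two dual vectors with each other shows that the matrix is symmetric, so
    that the entries with \<open>i \<le> j\<close>, the only ones \<open>lag_chart\<close> reads,
    determine the others correctly.\<close>
  have sym: "pt \<kappa> i (x j) = pt \<kappa> j (x i)" if "i < n" "j < n" for i j
    using pairing[OF that(1) x[OF that(2)]] dual that by (simp add: if_distrib cong: if_cong)
  have "pt \<kappa> (max i j) (x (min i j)) = pt \<kappa> i (x j)" if "i < n" "j < n" for i j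
    using sym that by (cases "i \<le> j") (auto simp: min_def max_def)
  then have "L \<subseteq> lag_chart n q p \<kappa> (\<lambda>(i, j). pt \<kappa> j (x i))"
    using LGr_carrier[OF L] pairing by (auto simp: lag_chart_twisted intro!: sum.cong)
  then show ?thesis by (rule LGr_eqI[OF L lag_chart_in_LGr])
qed

end

interpretation H: darboux k "q_H k" "p_H k" "J_mat k" for k
proof
  show "\<exists>x\<in>carrier_vec (k + k). \<forall>i<k. q_H k i x = f i \<and> p_H k i x = g i" for f g :: "nat \<Rightarrow> 'a"
    by (rule bexI[of _ "vec k f @\<^sub>v vec k g"]) (auto simp: q_H_def p_H_def)
qed (auto simp: bilin_J_mat q_H_def p_H_def)

lemma J_ominus_carrier: "J_ominus n \<in> carrier_mat ((n + n) + (n + n)) ((n + n) + (n + n))"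
  unfolding J_ominus_def by (intro four_block_carrier_mat) auto

section \<open>The characteristic function in coordinates\<close>

text \<open>A function on all indices carries the outer coordinates \<open>u\<close> or
  \<open>v\<close> (at \<open>Inl\<close>) and the inner ones \<open>x\<close> or \<open>y\<close>
  (at \<open>Inr\<close>); \<open>X\<close> is the argument of \<open>g\<close>, \<open>Y\<close>
  its value. \<open>outer\<close> keeps the outer part, \<open>fiber\<close> below one vector of
  \<H> from the inner part.\<close>

definition outer ::
    "nat \<Rightarrow> (index \<Rightarrow> 'a::field) \<Rightarrow> (index \<Rightarrow> 'a) \<Rightarrow> (index \<Rightarrow> 'a) \<Rightarrow> (index \<Rightarrow> 'a) \<Rightarrow> 'a vec"
  where "outer \<alpha> Xp Xm Yp Ym =
    (vec \<alpha> (\<lambda>a. Xp (Inl a)) @\<^sub>v vec \<alpha> (\<lambda>a. Xm (Inl a))) @\<^sub>v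
    (vec \<alpha> (\<lambda>a. Yp (Inl a)) @\<^sub>v vec \<alpha> (\<lambda>a. Ym (Inl a)))"

lemma outer_carrier [simp]: "outer \<alpha> Xp Xm Yp Ym \<in> carrier_vec (\<alpha> + \<alpha> + (\<alpha> + \<alpha>))"
  unfolding outer_def by (intro append_carrier_vec vec_carrier)

lemma q_VV_outer:
  assumes "i < \<alpha> + \<alpha>"
  shows "q_VV \<alpha> i (outer \<alpha> Xp Xm Yp Ym) = (if i < \<alpha> then Xp (Inl i) else Yp (Inl (i - \<alpha>)))"
proof (cases "i < \<alpha>")
  case False
  then obtain l where "i = \<alpha> + l" by (metis le_Suc_ex not_less)
  with assms show ?thesis by (simp add: q_VV_def outer_def)
qed (simp add: q_VV_def outer_def)

lemma p_VV_outer: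
  assumes "i < \<alpha> + \<alpha>"
  shows "p_VV \<alpha> i (outer \<alpha> Xp Xm Yp Ym) = (if i < \<alpha> then Xm (Inl i) else - Ym (Inl (i - \<alpha>)))"
proof (cases "i < \<alpha>")
  case False
  then obtain l where "i = \<alpha> + l" by (metis le_Suc_ex not_less)
  with assms show ?thesis by (simp add: p_VV_def outer_def mult_2)
qed (simp add: p_VV_def outer_def)

interpretation VV: darboux "\<alpha> + \<alpha>" "q_VV \<alpha>" "p_VV \<alpha>" "J_ominus \<alpha>" for \<alpha>
proof
  fix f g :: "nat \<Rightarrow> 'a"
  let ?f = "\<lambda>h. case_sum h (\<lambda>_. 0 :: 'a)"
  \<comment> \<open>The sign undoes the one in \<open>p_VV\<close>, whose second half is
    \<open>- v\<^sup>-\<close>.\<close>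
  let ?x = "outer \<alpha> (?f f) (?f g) (?f (\<lambda>i. f (\<alpha> + i))) (?f (\<lambda>i. - g (\<alpha> + i)))"
  show "\<exists>x\<in>carrier_vec (\<alpha> + \<alpha> + (\<alpha> + \<alpha>)). \<forall>i<\<alpha> + \<alpha>. q_VV \<alpha> i x = f i \<and> p_VV \<alpha> i x = g i"
    by (intro bexI[of _ ?x]) (auto simp: q_VV_outer p_VV_outer)
qed (auto simp: bilin_J_ominus q_VV_def p_VV_def J_ominus_carrier)

definition mat_app :: "'i set \<Rightarrow> ('i, 'a::field) imat \<Rightarrow> ('i \<Rightarrow> 'a) \<Rightarrow> 'i \<Rightarrow> 'a"
  where "mat_app I \<gamma> X r = (\<Sum>s\<in>I. \<gamma> r s * X s)"

definition fiber :: "nat \<Rightarrow> nat \<Rightarrow> (index \<Rightarrow> 'a::field) \<Rightarrow> (index \<Rightarrow> 'a) \<Rightarrow> 'a vec"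
  where "fiber k i Xp Xm = vec k (\<lambda>j. Xp (Inr (j, i))) @\<^sub>v vec k (\<lambda>j. Xm (Inr (j, i)))"

text \<open>Parametrising by \<open>x\<^sup>+\<close> and \<open>y\<^sup>-\<close> turns the inverse transpose into a transpose.\<close>

definition chi_coord ::
    "nat \<Rightarrow> nat \<Rightarrow> nat \<Rightarrow> (index, 'a::field) imat \<Rightarrow> 'a vec set \<Rightarrow> 'a vec set \<Rightarrow> 'a vec set"
  where "chi_coord \<alpha> k m \<gamma> Q T =
    {outer \<alpha> Xp Xm Yp Ym | Xp Xm Yp Ym.
       Xm = mat_app (level_indices \<alpha> k m) (\<lambda>r s. \<gamma> s r) Ym \<and>
       Yp = mat_app (level_indices \<alpha> k m) \<gamma> Xp \<and>
       (\<forall>i<m. fiber k i Xp Xm \<in> Q \<and> fiber k i Yp Ym \<in> T)}"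

lemma chi_coordI:
  assumes "\<And>i. i < m \<Longrightarrow> fiber k i Xp (mat_app (level_indices \<alpha> k m) (\<lambda>r s. \<gamma> s r) Ym) \<in> Q"
    and "\<And>i. i < m \<Longrightarrow> fiber k i (mat_app (level_indices \<alpha> k m) \<gamma> Xp) Ym \<in> T"
  shows "outer \<alpha> Xp (mat_app (level_indices \<alpha> k m) (\<lambda>r s. \<gamma> s r) Ym)
    (mat_app (level_indices \<alpha> k m) \<gamma> Xp) Ym \<in> chi_coord \<alpha> k m \<gamma> Q T"
  unfolding chi_coord_def using assms by blast

lemma chi_coordE:
  assumes "x \<in> chi_coord \<alpha> k m \<gamma> Q T"
  obtains Xp Ym where
    "x = outer \<alpha> Xp (mat_app (level_indices \<alpha> k m) (\<lambda>r s. \<gamma> s r) Ym)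
      (mat_app (level_indices \<alpha> k m) \<gamma> Xp) Ym"
    and "\<forall>i<m. fiber k i Xp (mat_app (level_indices \<alpha> k m) (\<lambda>r s. \<gamma> s r) Ym) \<in> Q"
    and "\<forall>i<m. fiber k i (mat_app (level_indices \<alpha> k m) \<gamma> Xp) Ym \<in> T"
  using assms unfolding chi_coord_def by auto

lemma finite_level_indices [simp]: "finite (level_indices \<alpha> k m)"
  by (simp add: level_indices_def)

lemma level_indices_simps [simp]:
  "Inl a \<in> level_indices \<alpha> k m \<longleftrightarrow> a < \<alpha>"
  "Inr (j, i) \<in> level_indices \<alpha> k m \<longleftrightarrow> j < k \<and> i < m"
  by (auto simp: level_indices_def)

text \<open>The inner coordinates are grouped by \<open>i\<close>, so that each inner sum can be
  read as the form of \<H> on one fiber.\<close>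

lemma sum_level_indices:
  "(\<Sum>r\<in>level_indices \<alpha> k m. f r) =
    (\<Sum>a<\<alpha>. f (Inl a)) + (\<Sum>i<m. \<Sum>j<k. f (Inr (j, i)) :: 'a::field)"
proof -
  have "(\<Sum>r\<in>level_indices \<alpha> k m. f r) =
      (\<Sum>a<\<alpha>. f (Inl a)) + (\<Sum>x\<in>{..<k} \<times> {..<m}. f (Inr x))"
    unfolding level_indices_def by (simp add: sum.Plus)
  also have "(\<Sum>x\<in>{..<k} \<times> {..<m}. f (Inr x)) = (\<Sum>j<k. \<Sum>i<m. f (Inr (j, i)))"
    by (simp add: sum.cartesian_product)
  also have "\<dots> = (\<Sum>i<m. \<Sum>j<k. f (Inr (j, i)))" by (rule sum.swap)
  finally show ?thesis .
qed

lemma fiber_carrier [simp]: "fiber k i Xp Xm \<in> carrier_vec (k + k)"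
  by (auto simp: fiber_def)

lemma outer_surj:
  assumes "x \<in> carrier_vec (\<alpha> + \<alpha> + (\<alpha> + \<alpha>))"
  obtains Xp Xm Yp Ym where "x = outer \<alpha> Xp Xm Yp Ym"
    and "\<And>r. Xp (Inr r) = 0" "\<And>r. Xm (Inr r) = 0" "\<And>r. Yp (Inr r) = 0" "\<And>r. Ym (Inr r) = 0"
proof
  let ?f = "\<lambda>d r. case r of Inl a \<Rightarrow> x $ (d + a) | Inr _ \<Rightarrow> 0"
  show "x = outer \<alpha> (?f 0) (?f \<alpha>) (?f (\<alpha> + \<alpha>)) (?f (\<alpha> + \<alpha> + \<alpha>))"
    using assms by (intro eq_vecI) (auto simp: outer_def)
qed auto

lemma bilin_fiber:
  "bilin (J_mat k) (fiber k i Xp Xm) (fiber k i Xp' Xm') =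
    (\<Sum>j<k. Xp (Inr (j, i)) * Xm' (Inr (j, i)) - Xm (Inr (j, i)) * Xp' (Inr (j, i)))"
  by (subst bilin_J_mat) (auto simp: fiber_def q_H_def p_H_def intro!: sum.cong)

lemma bilin_outer:
  "bilin (J_ominus \<alpha>) (outer \<alpha> Xp Xm Yp Ym) (outer \<alpha> Xp' Xm' Yp' Ym') =
    (\<Sum>a<\<alpha>. Xp (Inl a) * Xm' (Inl a) - Xm (Inl a) * Xp' (Inl a)) -
    (\<Sum>a<\<alpha>. Yp (Inl a) * Ym' (Inl a) - Ym (Inl a) * Yp' (Inl a))"
  by (subst bilin_J_ominus)
    (auto simp: sum_lessThan_add q_VV_outer p_VV_outer sum_subtractf sum_negf)

lemma outer_lin:
  "outer \<alpha> Xp Xm Yp Ym + c \<cdot>\<^sub>v outer \<alpha> Xp' Xm' Yp' Ym' =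
    outer \<alpha> (\<lambda>r. Xp r + c * Xp' r) (\<lambda>r. Xm r + c * Xm' r)
      (\<lambda>r. Yp r + c * Yp' r) (\<lambda>r. Ym r + c * Ym' r)"
  by (intro eq_vecI) (auto simp: outer_def)

lemma fiber_lin:
  "fiber k i Xp Xm + c \<cdot>\<^sub>v fiber k i Xp' Xm' =
    fiber k i (\<lambda>r. Xp r + c * Xp' r) (\<lambda>r. Xm r + c * Xm' r)"
  by (intro eq_vecI) (auto simp: fiber_def)

lemma mat_app_lin: "mat_app I \<gamma> (\<lambda>r. X r + c * Y r) = (\<lambda>r. mat_app I \<gamma> X r + c * mat_app I \<gamma> Y r)"
  by (auto simp: mat_app_def fun_eq_iff sum.distrib sum_distrib_left algebra_simps)

lemma mat_app_zero: "mat_app I \<gamma> (\<lambda>_. 0) = (\<lambda>_. 0)"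
  by (simp add: mat_app_def fun_eq_iff)

text \<open>The maps \<open>x\<^sup>+ \<mapsto> g x\<^sup>+\<close> and \<open>y\<^sup>- \<mapsto> g\<^sup>t y\<^sup>-\<close> define a Lagrangian relation; the right-hand side is
  the functional given by the failure of \<open>(X', Y')\<close> to belong to it.\<close>

lemma symplectic_defect:
  assumes "finite I" and "Xm = mat_app I (\<lambda>r s. \<gamma> s r) Ym" and "Yp = mat_app I \<gamma> Xp"
  shows "(\<Sum>r\<in>I. Xp' r * Xm r - Xm' r * Xp r) - (\<Sum>r\<in>I. Yp' r * Ym r - Ym' r * Yp r) =
    (\<Sum>r\<in>I. (mat_app I (\<lambda>r s. \<gamma> s r) Ym' r - Xm' r) * Xp r) +
    (\<Sum>r\<in>I. (mat_app I \<gamma> Xp' r - Yp' r) * Ym r)"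
proof -
  have "(\<Sum>r\<in>I. Xp' r * Xm r) = (\<Sum>r\<in>I. mat_app I \<gamma> Xp' r * Ym r)"
    unfolding assms(2) mat_app_def sum_distrib_left sum_distrib_right
    by (subst sum.swap) (simp add: algebra_simps)
  moreover have "(\<Sum>r\<in>I. Ym' r * Yp r) = (\<Sum>r\<in>I. mat_app I (\<lambda>r s. \<gamma> s r) Ym' r * Xp r)"
    unfolding assms(3) mat_app_def sum_distrib_left sum_distrib_right
    by (subst sum.swap) (simp add: algebra_simps)
  ultimately show ?thesis by (simp add: sum_subtractf left_diff_distrib)
qed

text \<open>Maximality by duality. Let \<open>x\<close> be orthogonal to \<open>?L\<close> and
  extend it by zero inner coordinates. Its defect is a functional of \<open>(Xp, Ym)\<close> that
  vanishes on all solutions. Solutions include the whole annihilator of \<open>\<Phi>\<close>, the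
  set of defects of vectors with zero outer coordinates and fibers in \<open>Q\<close> and
  \<open>T\<close>. By \<open>double_perp\<close> the defect of \<open>x\<close> is therefore one of
  these, and subtracting the corresponding inner vector yields a solution with the outer coordinates
  of \<open>x\<close>.\<close>

lemma chi_coord_in_LGr:
  fixes Q T :: "'a::field vec set"
  assumes Q: "Q \<in> LGr (J_mat k)" and T: "T \<in> LGr (J_mat k)"
  shows "chi_coord \<alpha> k m \<gamma> Q T \<in> LGr (J_ominus \<alpha>)"
proof -
  let ?I = "level_indices \<alpha> k m"
  let ?L = "chi_coord \<alpha> k m \<gamma> Q T"
  let ?ap = "mat_app ?I \<gamma>" and ?tr = "mat_app ?I (\<lambda>r s. \<gamma> s r)"
  note Q' = H.LGr_subspace[OF Q, unfolded subspace_module_vec_iff]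
  note T' = H.LGr_subspace[OF T, unfolded subspace_module_vec_iff]
  have Q_lin: "x + c \<cdot>\<^sub>v y \<in> Q" if "x \<in> Q" "y \<in> Q" for x y c using Q' that by blast
  have T_lin: "x + c \<cdot>\<^sub>v y \<in> T" if "x \<in> T" "y \<in> T" for x y c using T' that by blast
  have fiber0: "fiber k i (\<lambda>_. 0) (\<lambda>_. 0) = (0\<^sub>v (k + k) :: 'a vec)" for i
    by (intro eq_vecI) (auto simp: fiber_def)
  have outer0: "outer \<alpha> (\<lambda>_. 0) (\<lambda>_. 0) (\<lambda>_. 0) (\<lambda>_. 0) = (0\<^sub>v (\<alpha> + \<alpha> + (\<alpha> + \<alpha>)) :: 'a vec)"
    by (intro eq_vecI) (auto simp: outer_def)
  have Q0: "0\<^sub>v (k + k) \<in> Q" and T0: "0\<^sub>v (k + k) \<in> T" using Q' T' by blast+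
  have split: "(\<Sum>r\<in>?I. Xp' r * Xm r - Xm' r * Xp r) =
      (\<Sum>a<\<alpha>. Xp' (Inl a) * Xm (Inl a) - Xm' (Inl a) * Xp (Inl a)) +
      (\<Sum>i<m. bilin (J_mat k) (fiber k i Xp' Xm') (fiber k i Xp Xm))"
    for Xp Xm Xp' Xm' :: "index \<Rightarrow> 'a"
    unfolding sum_level_indices bilin_fiber ..
  \<comment> \<open>Between a vector of the relation and an arbitrary primed one, the outer form
    equals the defect corrected by the forms of the fibers. If the primed vector is in the relation
    too, the right-hand side is zero.\<close>
  have pairing: "bilin (J_ominus \<alpha>) (outer \<alpha> Xp' Xm' Yp' Ym') (outer \<alpha> Xp Xm Yp Ym) +
      (\<Sum>i<m. bilin (J_mat k) (fiber k i Xp' Xm') (fiber k i Xp Xm)) -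
      (\<Sum>i<m. bilin (J_mat k) (fiber k i Yp' Ym') (fiber k i Yp Ym)) =
      (\<Sum>r\<in>?I. (?tr Ym' r - Xm' r) * Xp r) + (\<Sum>r\<in>?I. (?ap Xp' r - Yp' r) * Ym r)"
    if "Xm = ?tr Ym" "Yp = ?ap Xp" for Xp Xm Yp Ym Xp' Xm' Yp' Ym' :: "index \<Rightarrow> 'a"
    using symplectic_defect[OF _ that, of Xp' Xm' Yp' Ym']
    unfolding split bilin_outer by (simp add: algebra_simps)
  have "0\<^sub>v (\<alpha> + \<alpha> + (\<alpha> + \<alpha>)) \<in> ?L"
    using chi_coordI[of m k "\<lambda>_. 0" \<alpha> \<gamma> "\<lambda>_. 0" Q T] fiber0 Q0 T0 outer0
    by (simp add: mat_app_zero)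
  moreover have "x + c \<cdot>\<^sub>v y \<in> ?L" if x: "x \<in> ?L" and y: "y \<in> ?L" for x y c
  proof -
    obtain Xp Ym where x: "x = outer \<alpha> Xp (?tr Ym) (?ap Xp) Ym"
      "\<forall>i<m. fiber k i Xp (?tr Ym) \<in> Q" "\<forall>i<m. fiber k i (?ap Xp) Ym \<in> T"
      using x by (rule chi_coordE)
    obtain Xp' Ym' where y: "y = outer \<alpha> Xp' (?tr Ym') (?ap Xp') Ym'"
      "\<forall>i<m. fiber k i Xp' (?tr Ym') \<in> Q" "\<forall>i<m. fiber k i (?ap Xp') Ym' \<in> T"
      using y by (rule chi_coordE)
    show ?thesis
      unfolding x(1) y(1) outer_lin mat_app_lin[symmetric]
      using Q_lin[OF x(2)[rule_format] y(2)[rule_format], of i i c for i]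
        T_lin[OF x(3)[rule_format] y(3)[rule_format], of i i c for i]
      by (intro chi_coordI) (simp_all add: fiber_lin mat_app_lin)
  qed
  ultimately have sub: "subspace class_ring ?L (module_vec TYPE('a) (\<alpha> + \<alpha> + (\<alpha> + \<alpha>)))"
    unfolding subspace_module_vec_iff by (auto simp: chi_coord_def)
  have iso: "bilin (J_ominus \<alpha>) x y = 0" if x: "x \<in> ?L" and y: "y \<in> ?L" for x y
  proof -
    obtain Xp Ym where x: "x = outer \<alpha> Xp (?tr Ym) (?ap Xp) Ym"
      "\<forall>i<m. fiber k i Xp (?tr Ym) \<in> Q" "\<forall>i<m. fiber k i (?ap Xp) Ym \<in> T"
      using x by (rule chi_coordE)
    obtain Xp' Ym' where y: "y = outer \<alpha> Xp' (?tr Ym') (?ap Xp') Ym'"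
      "\<forall>i<m. fiber k i Xp' (?tr Ym') \<in> Q" "\<forall>i<m. fiber k i (?ap Xp') Ym' \<in> T"
      using y by (rule chi_coordE)
    show ?thesis
      unfolding x(1) y(1)
      using pairing[OF refl refl, of Xp "?tr Ym" "?ap Xp" Ym Xp' Ym']
        H.LGr_isotropic[OF Q x(2)[rule_format] y(2)[rule_format]] H.LGr_isotropic[OF T x(3)[rule_format] y(3)[rule_format]] by simp
  qed
  have max: "x \<in> ?L"
    if x: "x \<in> carrier_vec (\<alpha> + \<alpha> + (\<alpha> + \<alpha>))" "\<And>y. y \<in> ?L \<Longrightarrow> bilin (J_ominus \<alpha>) x y = 0" for x
  proof -
    obtain Up Um Vp Vm where xo: "x = outer \<alpha> Up Um Vp Vm"
      and zero: "\<And>r. Up (Inr r) = 0" "\<And>r. Um (Inr r) = 0" "\<And>r. Vp (Inr r) = 0" "\<And>r. Vm (Inr r) = 0"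
      using outer_surj[OF x(1)] by blast
    \<comment> \<open>The quadruples have independent plus and minus halves here: they need not
      satisfy the relation, only lie over \<open>Q\<close> and \<open>T\<close>.\<close>
    define \<Phi> :: "(index + index \<Rightarrow> 'a) set" where
      "\<Phi> = {case_sum (\<lambda>r. ?tr Ym r - Xm r) (\<lambda>r. ?ap Xp r - Yp r) | Xp Xm Yp Ym.
        (\<forall>a. Xp (Inl a) = 0 \<and> Xm (Inl a) = 0 \<and> Yp (Inl a) = 0 \<and> Ym (Inl a) = 0) \<and>
        (\<forall>i. fiber k i Xp Xm \<in> Q \<and> fiber k i Yp Ym \<in> T)}"
    define f :: "index + index \<Rightarrow> 'a" where
      "f = case_sum (\<lambda>r. ?tr Vm r - Um r) (\<lambda>r. ?ap Up r - Vp r)"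
    have in\<Phi>: "case_sum (\<lambda>r. ?tr Ym r - Xm r) (\<lambda>r. ?ap Xp r - Yp r) \<in> \<Phi>"
      if "\<And>a. Xp (Inl a) = 0" "\<And>a. Xm (Inl a) = 0" "\<And>a. Yp (Inl a) = 0" "\<And>a. Ym (Inl a) = 0"
        "\<And>i. fiber k i Xp Xm \<in> Q" "\<And>i. fiber k i Yp Ym \<in> T" for Xp Xm Yp Ym
      unfolding \<Phi>_def using that by blast
    have "\<exists>\<phi>\<in>\<Phi>. \<forall>e\<in>Sum_Type.Plus ?I ?I. f e = \<phi> e"
    proof (rule double_perp)
      show "finite (Sum_Type.Plus ?I ?I)" by simp
      show "\<Phi> \<noteq> {}"
        using in\<Phi>[of "\<lambda>_. 0" "\<lambda>_. 0" "\<lambda>_. 0" "\<lambda>_. 0"] by (auto simp: fiber0 Q0 T0)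
      show "(\<lambda>e. \<phi> e + c * \<psi> e) \<in> \<Phi>" if \<phi>: "\<phi> \<in> \<Phi>" and \<psi>: "\<psi> \<in> \<Phi>" for \<phi> \<psi> c
      proof -
        from \<phi> obtain Xp Xm Yp Ym where
          \<phi>: "\<phi> = case_sum (\<lambda>r. ?tr Ym r - Xm r) (\<lambda>r. ?ap Xp r - Yp r)"
          and Z: "\<forall>a. Xp (Inl a) = 0 \<and> Xm (Inl a) = 0 \<and> Yp (Inl a) = 0 \<and> Ym (Inl a) = 0"
          and F: "\<And>i. fiber k i Xp Xm \<in> Q" "\<And>i. fiber k i Yp Ym \<in> T"
          unfolding \<Phi>_def by blast
        from \<psi> obtain Xp' Xm' Yp' Ym' where
          \<psi>: "\<psi> = case_sum (\<lambda>r. ?tr Ym' r - Xm' r) (\<lambda>r. ?ap Xp' r - Yp' r)"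
          and Z': "\<forall>a. Xp' (Inl a) = 0 \<and> Xm' (Inl a) = 0 \<and> Yp' (Inl a) = 0 \<and> Ym' (Inl a) = 0"
          and F': "\<And>i. fiber k i Xp' Xm' \<in> Q" "\<And>i. fiber k i Yp' Ym' \<in> T"
          unfolding \<Phi>_def by blast
        have "(\<lambda>e. \<phi> e + c * \<psi> e) = case_sum
            (\<lambda>r. ?tr (\<lambda>r. Ym r + c * Ym' r) r - (Xm r + c * Xm' r))
            (\<lambda>r. ?ap (\<lambda>r. Xp r + c * Xp' r) r - (Yp r + c * Yp' r))"
          unfolding \<phi> \<psi> mat_app_lin by (auto simp: fun_eq_iff algebra_simps split: sum.split)
        also have "\<dots> \<in> \<Phi>"
          using Z Z' Q_lin[OF F(1) F'(1), of i c i for i] T_lin[OF F(2) F'(2), of i c i for i]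
          by (intro in\<Phi>) (simp_all add: fiber_lin)
        finally show ?thesis .
      qed
      fix z assume z: "\<And>\<phi>. \<phi> \<in> \<Phi> \<Longrightarrow> (\<Sum>e\<in>Sum_Type.Plus ?I ?I. \<phi> e * z e) = 0"
      define Xp Ym where "Xp r = z (Inl r)" and "Ym r = z (Inr r)" for r
      have sum_z: "(\<Sum>e\<in>Sum_Type.Plus ?I ?I. case_sum A B e * z e) = (\<Sum>r\<in>?I. A r * Xp r) + (\<Sum>r\<in>?I. B r * Ym r)"
        for A B by (simp add: sum.Plus Xp_def Ym_def)
      \<comment> \<open>An annihilator of \<open>\<Phi>\<close>, read as a pair
        \<open>(Xp, Ym)\<close>, pairs to zero with all inner vectors over \<open>Q\<close> and
        \<open>T\<close>. As \<open>Q\<close> and \<open>T\<close> are their own orthogonal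
        complements, it is a solution.\<close>
      have perp: "(\<Sum>i<m. bilin (J_mat k) (fiber k i Xp' Xm') (fiber k i Xp (?tr Ym))) =
          (\<Sum>i<m. bilin (J_mat k) (fiber k i Yp' Ym') (fiber k i (?ap Xp) Ym))"
        if "\<And>a. Xp' (Inl a) = 0" "\<And>a. Xm' (Inl a) = 0" "\<And>a. Yp' (Inl a) = 0" "\<And>a. Ym' (Inl a) = 0"
          "\<And>i. fiber k i Xp' Xm' \<in> Q" "\<And>i. fiber k i Yp' Ym' \<in> T" for Xp' Xm' Yp' Ym'
        using z[OF in\<Phi>[OF that]] pairing[OF refl refl, of Xp' Xm' Yp' Ym' Xp Ym] that(1-4)
        by (simp add: sum_z bilin_outer)
      \<comment> \<open>Placing a vector in the single fiber \<open>i\<close> isolates that fiber in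
        the sum over all of them.\<close>
      define put :: "nat \<Rightarrow> (nat \<Rightarrow> 'a) \<Rightarrow> index \<Rightarrow> 'a" where
        "put i g = case_sum (\<lambda>_. 0) (\<lambda>(j, i'). if i' = i then g j else 0)" for i g
      have fiber_put: "fiber k i' (put i ((\<lambda>j. y $ j))) (put i ((\<lambda>j. y $ (k + j)))) =
          (if i' = i then y else 0\<^sub>v (k + k))" if "y \<in> carrier_vec (k + k)" for i i' y
        using that by (intro eq_vecI) (auto simp: fiber_def put_def)
      have bilin0: "bilin (J_mat k) (0\<^sub>v (k + k)) (fiber k i Xp' Xm') = 0" for i and Xp' Xm' :: "index \<Rightarrow> 'a"
        unfolding fiber0[symmetric, of i] bilin_fiber by simp
      have XQ: "fiber k i Xp (?tr Ym) \<in> Q" if i: "i < m" for i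
      proof -
        have "bilin (J_mat k) (fiber k i Xp (?tr Ym)) y = 0" if y: "y \<in> Q" for y
        proof -
          have yc: "y \<in> carrier_vec (k + k)" using y Q H.LGr_carrier by blast
          have "(\<Sum>i'<m. bilin (J_mat k) (if i' = i then y else 0\<^sub>v (k + k)) (fiber k i' Xp (?tr Ym))) = 0"
            using perp[of "put i (\<lambda>j. y $ j)" "put i (\<lambda>j. y $ (k + j))" "\<lambda>_. 0" "\<lambda>_. 0"] y Q0 T0
            by (simp add: fiber_put[OF yc] fiber0 bilin0) (simp add: put_def)
          then have "bilin (J_mat k) y (fiber k i Xp (?tr Ym)) = 0"
            using i by (simp add: if_distrib[of "\<lambda>y. bilin _ y _"] bilin0 cong: if_cong)
          then show ?thesis
            using H.bilin_skew[OF yc fiber_carrier] by simp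
        qed
        then show ?thesis by (intro H.LGr_memI[OF Q] fiber_carrier)
      qed
      have YT: "fiber k i (?ap Xp) Ym \<in> T" if i: "i < m" for i
      proof -
        have "bilin (J_mat k) (fiber k i (?ap Xp) Ym) y = 0" if y: "y \<in> T" for y
        proof -
          have yc: "y \<in> carrier_vec (k + k)" using y T H.LGr_carrier by blast
          have "(\<Sum>i'<m. bilin (J_mat k) (if i' = i then y else 0\<^sub>v (k + k)) (fiber k i' (?ap Xp) Ym)) = 0"
            using perp[of "\<lambda>_. 0" "\<lambda>_. 0" "put i (\<lambda>j. y $ j)" "put i (\<lambda>j. y $ (k + j))"] y Q0 T0
            by (simp add: fiber_put[OF yc] fiber0 bilin0) (simp add: put_def)
          then have "bilin (J_mat k) y (fiber k i (?ap Xp) Ym) = 0"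
            using i by (simp add: if_distrib[of "\<lambda>y. bilin _ y _"] bilin0 cong: if_cong)
          then show ?thesis
            using H.bilin_skew[OF yc fiber_carrier] by simp
        qed
        then show ?thesis by (intro H.LGr_memI[OF T] fiber_carrier)
      qed
      have "outer \<alpha> Xp (?tr Ym) (?ap Xp) Ym \<in> ?L"
        using XQ YT by (rule chi_coordI)
      then have "bilin (J_ominus \<alpha>) x (outer \<alpha> Xp (?tr Ym) (?ap Xp) Ym) = 0" by (rule x(2))
      then show "(\<Sum>e\<in>Sum_Type.Plus ?I ?I. f e * z e) = 0"
        using pairing[OF refl refl, of Up Um Vp Vm Xp Ym] zero
        by (simp add: sum_z f_def bilin_fiber xo)
    qed
    then obtain Xp Xm Yp Ym where
      f: "\<And>e. e \<in> Sum_Type.Plus ?I ?I \<Longrightarrow> f e = case_sum (\<lambda>r. ?tr Ym r - Xm r) (\<lambda>r. ?ap Xp r - Yp r) e"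
      and Z: "\<And>a. Xp (Inl a) = 0 \<and> Xm (Inl a) = 0 \<and> Yp (Inl a) = 0 \<and> Ym (Inl a) = 0"
      and F: "\<And>i. fiber k i Xp Xm \<in> Q" "\<And>i. fiber k i Yp Ym \<in> T"
      unfolding \<Phi>_def by blast
    \<comment> \<open>The correction has no outer coordinates, so \<open>x\<close> keeps its outer
      part while the defect cancels; the fibers become negatives of elements of \<open>Q\<close> and
      \<open>T\<close>.\<close>
    define Ap where "Ap r = Up r + (- 1) * Xp r" for r
    define Bm where "Bm r = Vm r + (- 1) * Ym r" for r
    have tr: "?tr Bm r = Um r - Xm r" if "r \<in> ?I" for r
      using f[OF InlI[OF that]] unfolding f_def Bm_def mat_app_lin by (simp add: algebra_simps)
    have ap: "?ap Ap r = Vp r - Yp r" if "r \<in> ?I" for r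
      using f[OF InrI[OF that]] unfolding f_def Ap_def mat_app_lin by (simp add: algebra_simps)
    have "x = outer \<alpha> Ap (?tr Bm) (?ap Ap) Bm"
      using Z by (auto simp: xo outer_def tr ap Ap_def Bm_def intro!: arg_cong2[of _ _ _ _ "(@\<^sub>v)"])
    moreover have "fiber k i Ap (?tr Bm) \<in> Q" if "i < m" for i
    proof -
      have "fiber k i Ap (?tr Bm) = 0\<^sub>v (k + k) + (- 1) \<cdot>\<^sub>v fiber k i Xp Xm"
        using that zero by (intro eq_vecI) (auto simp: fiber_def tr Ap_def)
      then show ?thesis using Q_lin[OF Q0 F(1)] by simp
    qed
    moreover have "fiber k i (?ap Ap) Bm \<in> T" if "i < m" for i
    proof -
      have "fiber k i (?ap Ap) Bm = 0\<^sub>v (k + k) + (- 1) \<cdot>\<^sub>v fiber k i Yp Ym"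
        using that zero by (intro eq_vecI) (auto simp: fiber_def ap Bm_def)
      then show ?thesis using T_lin[OF T0 F(2)] by simp
    qed
    ultimately show ?thesis using chi_coordI[of m k Ap \<alpha> \<gamma> Bm Q T] by simp
  qed
  have "?L = {x \<in> carrier_vec (\<alpha> + \<alpha> + (\<alpha> + \<alpha>)). \<forall>y\<in>?L. bilin (J_ominus \<alpha>) x y = 0}"
  proof (intro equalityI subsetI CollectI conjI ballI)
    show "x \<in> carrier_vec (\<alpha> + \<alpha> + (\<alpha> + \<alpha>))" if "x \<in> ?L" for x
      using that sub unfolding subspace_module_vec_iff by blast
    show "bilin (J_ominus \<alpha>) x y = 0" if "x \<in> ?L" "y \<in> ?L" for x y using that by (rule iso)
    show "x \<in> ?L"
      if "x \<in> {x \<in> carrier_vec (\<alpha> + \<alpha> + (\<alpha> + \<alpha>)). \<forall>y\<in>?L. bilin (J_ominus \<alpha>) x y = 0}" for x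
      using that by (intro max) auto
  qed
  with sub show ?thesis by (rule VV.LGr_iff_perp[THEN iffD2, OF conjI])
qed

section \<open>The characteristic function in charts\<close>

text \<open>The unknowns are packed into one function: \<open>z\<close> at \<open>Inl\<close> is
  \<open>(u\<^sup>+, x\<^sup>+)\<close>, at \<open>Inr\<close> it is
  \<open>(v\<^sup>-, y\<^sup>-)\<close>. The other two halves are computed from these by
  \<open>g\<close> and its transpose.\<close>

definition is_sol ::
    "nat \<Rightarrow> nat \<Rightarrow> nat \<Rightarrow> (index, 'a::field) imat \<Rightarrow> 'a vec set \<Rightarrow> 'a vec set \<Rightarrow> (index + index \<Rightarrow> 'a) \<Rightarrow> bool"
  where "is_sol \<alpha> k m \<gamma> Q T z \<longleftrightarrow> (\<forall>i<m.
    fiber k i (\<lambda>r. z (Inl r)) (mat_app (level_indices \<alpha> k m) (\<lambda>r s. \<gamma> s r) (\<lambda>r. z (Inr r))) \<in> Q \<and>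
    fiber k i (mat_app (level_indices \<alpha> k m) \<gamma> (\<lambda>r. z (Inl r))) (\<lambda>r. z (Inr r)) \<in> T)"

definition sol_outer ::
    "nat \<Rightarrow> nat \<Rightarrow> nat \<Rightarrow> (index, 'a::field) imat \<Rightarrow> (index + index \<Rightarrow> 'a) \<Rightarrow> 'a vec"
  where "sol_outer \<alpha> k m \<gamma> z =
    outer \<alpha> (\<lambda>r. z (Inl r)) (mat_app (level_indices \<alpha> k m) (\<lambda>r s. \<gamma> s r) (\<lambda>r. z (Inr r)))
      (mat_app (level_indices \<alpha> k m) \<gamma> (\<lambda>r. z (Inl r))) (\<lambda>r. z (Inr r))"

lemma sol_outer_in_chi_coord:
  "is_sol \<alpha> k m \<gamma> Q T z \<Longrightarrow> sol_outer \<alpha> k m \<gamma> z \<in> chi_coord \<alpha> k m \<gamma> Q T"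
  unfolding is_sol_def sol_outer_def by (intro chi_coordI) auto

lemma chi_coord_solE:
  assumes "x \<in> chi_coord \<alpha> k m \<gamma> Q T"
  obtains z where "x = sol_outer \<alpha> k m \<gamma> z" "is_sol \<alpha> k m \<gamma> Q T z"
proof -
  obtain Xp Ym where "x = outer \<alpha> Xp (mat_app (level_indices \<alpha> k m) (\<lambda>r s. \<gamma> s r) Ym)
      (mat_app (level_indices \<alpha> k m) \<gamma> Xp) Ym"
    and "\<forall>i<m. fiber k i Xp (mat_app (level_indices \<alpha> k m) (\<lambda>r s. \<gamma> s r) Ym) \<in> Q"
    and "\<forall>i<m. fiber k i (mat_app (level_indices \<alpha> k m) \<gamma> Xp) Ym \<in> T"
    using assms by (rule chi_coordE)
  then show thesis by (intro that[of "case_sum Xp Ym"]) (simp_all add: sol_outer_def is_sol_def)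
qed

abbreviation sol_indices :: "nat \<Rightarrow> nat \<Rightarrow> nat \<Rightarrow> (index + index) set"
  where "sol_indices \<alpha> k m \<equiv> Sum_Type.Plus (level_indices \<alpha> k m) (level_indices \<alpha> k m)"

text \<open>A pair \<open>(Q, T)\<close> is degenerate if no \<open>\<alpha> + \<alpha>\<close> of the coordinates \<open>\<rho>\<close> determine
  the solutions; the number of equations equals the number of unknowns.\<close>

definition degenerate ::
    "nat \<Rightarrow> nat \<Rightarrow> nat \<Rightarrow> (nat \<Rightarrow> (index + index \<Rightarrow> 'a) \<Rightarrow> 'a) \<Rightarrow> (index, 'a::field) imat \<Rightarrow>
      'a vec set \<Rightarrow> 'a vec set \<Rightarrow> bool"
  where "degenerate \<alpha> k m \<rho> \<gamma> Q T \<longleftrightarrow>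
    (\<exists>z. (\<exists>f\<in>sol_indices \<alpha> k m. z f \<noteq> 0) \<and> is_sol \<alpha> k m \<gamma> Q T z \<and> (\<forall>l<\<alpha> + \<alpha>. \<rho> l z = 0))"

definition chart_eq ::
    "nat \<Rightarrow> nat set \<Rightarrow> (nat \<times> nat \<Rightarrow> 'a::field) \<Rightarrow> nat \<times> nat \<Rightarrow> (index \<Rightarrow> 'a) \<Rightarrow> (index \<Rightarrow> 'a) \<Rightarrow> 'a"
  where "chart_eq k \<epsilon> s ji Xp Xm =
    (if fst ji \<in> \<epsilon> then - Xp (Inr ji) else Xm (Inr ji)) -
    (\<Sum>l<k. s (min l (fst ji), max l (fst ji)) *
      (if l \<in> \<epsilon> then Xm (Inr (l, snd ji)) else Xp (Inr (l, snd ji))))"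

lemma fiber_in_chart_H:
  "fiber k i Xp Xm \<in> chart_H k \<epsilon> s \<longleftrightarrow> (\<forall>j<k. chart_eq k \<epsilon> s (j, i) Xp Xm = 0)"
proof -
  have q: "q_H k l (fiber k i Xp Xm) = Xp (Inr (l, i))" if "l < k" for l
    using that by (simp add: q_H_def fiber_def)
  have p: "p_H k l (fiber k i Xp Xm) = Xm (Inr (l, i))" if "l < k" for l
    using that by (simp add: p_H_def fiber_def)
  have "(\<Sum>l<k. s (min l j, max l j) *
        (if l \<in> \<epsilon> then p_H k l (fiber k i Xp Xm) else q_H k l (fiber k i Xp Xm))) =
      (\<Sum>l<k. s (min l j, max l j) * (if l \<in> \<epsilon> then Xm (Inr (l, i)) else Xp (Inr (l, i))))" for j
    using q p by (intro sum.cong) simp_all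
  then show ?thesis
    unfolding chart_H_def lag_chart_def chart_eq_def fst_conv snd_conv by (simp add: q p)
qed

lemma lin_forms_mat_app:
  assumes "finite I" "\<And>r s. r \<in> I \<Longrightarrow> s \<in> I \<Longrightarrow> (\<lambda>w. \<gamma> w r s) \<in> poly_fun V"
    and "\<And>s. s \<in> I \<Longrightarrow> (\<lambda>w z. X z s) \<in> lin_forms V U" and "r \<in> I"
  shows "(\<lambda>w z. mat_app I (\<gamma> w) (X z) r) \<in> lin_forms V U"
  unfolding mat_app_def using assms by (intro lin_forms_sum lin_forms_scale) auto

text \<open>Each unknown is assigned one equation: an inner index gets a chart equation for
  \<open>Q\<close> or for \<open>T\<close>, an outer index the prescription of one coordinate
  \<open>\<rho> l\<close>. \<open>Z l\<close> is the solution, with denominators cleared, for which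
  \<open>\<rho> l\<close> is \<open>D\<close> and the other \<open>\<rho>\<close> vanish.\<close>

lemma chart_system:
  fixes \<gamma> :: "('v \<Rightarrow> 'a::field) \<Rightarrow> (index, 'a) imat"
  assumes \<gamma>: "\<And>r s. r \<in> level_indices \<alpha> k m \<Longrightarrow> s \<in> level_indices \<alpha> k m \<Longrightarrow>
      (\<lambda>w. \<gamma> w r s) \<in> poly_fun V"
    and s: "\<And>e. e \<in> sym_coords k \<Longrightarrow> (\<lambda>w. s w e) \<in> poly_fun V"
    and t: "\<And>e. e \<in> sym_coords k \<Longrightarrow> (\<lambda>w. t w e) \<in> poly_fun V"
    and \<rho>: "\<And>l. l < \<alpha> + \<alpha> \<Longrightarrow> \<rho> l \<in> lin_forms V (sol_indices \<alpha> k m)"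
  shows "\<exists>D Z. D \<in> poly_fun V \<and>
    (\<forall>l<\<alpha> + \<alpha>. \<forall>f\<in>sol_indices \<alpha> k m. (\<lambda>w. Z l w f) \<in> poly_fun V) \<and>
    (\<forall>w. D w = 0 \<longleftrightarrow>
      degenerate \<alpha> k m (\<lambda>l. \<rho> l w) (\<gamma> w) (chart_H k \<epsilon> (s w)) (chart_H k \<delta> (t w))) \<and>
    (\<forall>w. \<forall>l<\<alpha> + \<alpha>. \<forall>c.
      is_sol \<alpha> k m (\<gamma> w) (chart_H k \<epsilon> (s w)) (chart_H k \<delta> (t w)) (\<lambda>f. c * Z l w f)) \<and>
    (\<forall>w. \<forall>l<\<alpha> + \<alpha>. \<forall>l'<\<alpha> + \<alpha>. \<rho> l' w (Z l w) = (if l' = l then D w else 0))"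
proof -
  let ?I = "level_indices \<alpha> k m" and ?U = "sol_indices \<alpha> k m"
  let ?Xp = "\<lambda>w z r. z (Inl r)" and ?Ym = "\<lambda>w z r. z (Inr r)"
  let ?Xm = "\<lambda>w z. mat_app ?I (\<lambda>r s. \<gamma> w s r) (\<lambda>r. z (Inr r))"
  let ?Yp = "\<lambda>w z. mat_app ?I (\<gamma> w) (\<lambda>r. z (Inl r))"
  define L where "L e = (case e of
      Inl (Inl a) \<Rightarrow> \<rho> a
    | Inr (Inl a) \<Rightarrow> \<rho> (\<alpha> + a)
    | Inl (Inr ji) \<Rightarrow> (\<lambda>w z. chart_eq k \<epsilon> (s w) ji (?Xp w z) (?Xm w z))
    | Inr (Inr ji) \<Rightarrow> (\<lambda>w z. chart_eq k \<delta> (t w) ji (?Yp w z) (?Ym w z)))" for e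
  have Xp: "(\<lambda>w z. ?Xp w z r) \<in> lin_forms V ?U" if "r \<in> ?I" for r
    using that by (intro lin_forms_var) auto
  have Ym: "(\<lambda>w z. ?Ym w z r) \<in> lin_forms V ?U" if "r \<in> ?I" for r
    using that by (intro lin_forms_var) auto
  have Xm: "(\<lambda>w z. ?Xm w z r) \<in> lin_forms V ?U" if "r \<in> ?I" for r
    using that \<gamma> Ym by (intro lin_forms_mat_app) auto
  have Yp: "(\<lambda>w z. ?Yp w z r) \<in> lin_forms V ?U" if "r \<in> ?I" for r
    using that \<gamma> Xp by (intro lin_forms_mat_app) auto
  have chart: "(\<lambda>w z. chart_eq k \<epsilon> (s w) ji (X w z) (Y w z)) \<in> lin_forms V ?U"
    if ji: "Inr ji \<in> ?I"
      and s: "\<And>e. e \<in> sym_coords k \<Longrightarrow> (\<lambda>w. s w e) \<in> poly_fun V"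
      and X: "\<And>r. r \<in> ?I \<Longrightarrow> (\<lambda>w z. X w z r) \<in> lin_forms V ?U"
      and Y: "\<And>r. r \<in> ?I \<Longrightarrow> (\<lambda>w z. Y w z r) \<in> lin_forms V ?U"
    for \<epsilon> s ji and X Y :: "('v \<Rightarrow> 'a) \<Rightarrow> (index + index \<Rightarrow> 'a) \<Rightarrow> index \<Rightarrow> 'a"
  proof -
    obtain j i where j: "ji = (j, i)" "j < k" "i < m" using ji by (cases ji) auto
    have "(\<lambda>w z. if j \<in> \<epsilon> then - X w z (Inr (j, i)) else Y w z (Inr (j, i))) \<in> lin_forms V ?U"
      using X Y j by (cases "j \<in> \<epsilon>") (auto intro!: lin_forms_uminus)
    moreover have "(\<lambda>w z. if l \<in> \<epsilon> then Y w z (Inr (l, i)) else X w z (Inr (l, i))) \<in> lin_forms V ?U"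
      if "l < k" for l
      using X Y j that by (cases "l \<in> \<epsilon>") auto
    ultimately show ?thesis
      unfolding chart_eq_def j(1) fst_conv snd_conv using j(2)
      by (intro lin_forms_diff lin_forms_sum lin_forms_scale s) (auto simp: sym_coords_def)
  qed
  have L: "L e \<in> lin_forms V ?U" if "e \<in> ?U" for e
    using that \<rho> chart[OF _ s Xp Xm] chart[OF _ t Yp Ym]
    by (auto simp: L_def split: sum.split)
  have "finite ?U" by simp
  then have "\<exists>D P. D \<in> poly_fun V \<and> (\<forall>e\<in>?U. \<forall>f\<in>?U. (\<lambda>w. P e w f) \<in> poly_fun V) \<and>
      (\<forall>w. D w = 0 \<longleftrightarrow> (\<exists>z. (\<exists>f\<in>?U. z f \<noteq> 0) \<and> (\<forall>e\<in>?U. L e w z = 0))) \<and>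
      (\<forall>w. \<forall>e\<in>?U. \<forall>g\<in>?U. L e w (P g w) = (if e = g then D w else 0))"
    using L by (rule square_system)
  then obtain D P where D: "D \<in> poly_fun V"
    and P: "\<forall>e\<in>?U. \<forall>f\<in>?U. (\<lambda>w. P e w f) \<in> poly_fun V"
    and D0: "\<forall>w. D w = 0 \<longleftrightarrow> (\<exists>z. (\<exists>f\<in>?U. z f \<noteq> 0) \<and> (\<forall>e\<in>?U. L e w z = 0))"
    and LP: "\<forall>w. \<forall>e\<in>?U. \<forall>g\<in>?U. L e w (P g w) = (if e = g then D w else 0)"
    by (elim exE conjE) (rule that)
  \<comment> \<open>Linearity over the one-point index set \<open>{()}\<close> is
    homogeneity.\<close>
  have L_lin: "L e w (\<lambda>f. c * z f) = c * L e w z" if "e \<in> ?U" for e w c z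
    using lin_forms_linear[OF L[OF that], of w "\<lambda>_. c" "\<lambda>_. z" "{()}"]
    by simp
  have sol_iff: "is_sol \<alpha> k m (\<gamma> w) (chart_H k \<epsilon> (s w)) (chart_H k \<delta> (t w)) z \<longleftrightarrow>
      (\<forall>ji\<in>{..<k} \<times> {..<m}. L (Inl (Inr ji)) w z = 0 \<and> L (Inr (Inr ji)) w z = 0)" for w z
    by (auto simp: is_sol_def fiber_in_chart_H L_def)
  have split_nat: "(\<forall>l<\<alpha> + \<alpha>. Q l) \<longleftrightarrow> (\<forall>a<\<alpha>. Q a \<and> Q (\<alpha> + a))" for Q
  proof (intro iffI allI impI)
    fix l assume "\<forall>a<\<alpha>. Q a \<and> Q (\<alpha> + a)" "l < \<alpha> + \<alpha>"
    then show "Q l" by (cases "l < \<alpha>") (auto simp: not_less dest!: le_Suc_ex)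
  qed auto
  have U_iff: "(\<forall>e\<in>?U. R e) \<longleftrightarrow> (\<forall>a<\<alpha>. R (Inl (Inl a)) \<and> R (Inr (Inl a))) \<and>
      (\<forall>ji\<in>{..<k} \<times> {..<m}. R (Inl (Inr ji)) \<and> R (Inr (Inr ji)))" for R
    unfolding level_indices_def by auto
  define ix :: "nat \<Rightarrow> index + index" where "ix l = (if l < \<alpha> then Inl (Inl l) else Inr (Inl (l - \<alpha>)))" for l
  have ix: "ix l \<in> ?U" if "l < \<alpha> + \<alpha>" for l using that by (auto simp: ix_def)
  have L_ix: "L (ix l) = \<rho> l" for l by (auto simp: ix_def L_def)
  have ix_inj: "ix l = ix l' \<longleftrightarrow> l = l'" for l l' by (auto simp: ix_def)
  show ?thesis
  proof (intro exI[of _ D] exI[of _ "\<lambda>l. P (ix l)"] conjI ballI allI impI)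
    show "D \<in> poly_fun V" by (rule D)
    show "(\<lambda>w. P (ix l) w f) \<in> poly_fun V" if "l < \<alpha> + \<alpha>" "f \<in> ?U" for l f
      using that ix by (intro P[rule_format]) auto
    show "D w = 0 \<longleftrightarrow>
        degenerate \<alpha> k m (\<lambda>l. \<rho> l w) (\<gamma> w) (chart_H k \<epsilon> (s w)) (chart_H k \<delta> (t w))" for w
    proof -
      have "(\<forall>e\<in>?U. L e w z = 0) \<longleftrightarrow>
          is_sol \<alpha> k m (\<gamma> w) (chart_H k \<epsilon> (s w)) (chart_H k \<delta> (t w)) z \<and> (\<forall>l<\<alpha> + \<alpha>. \<rho> l w z = 0)" for z
        unfolding U_iff sol_iff split_nat by (auto simp: L_def)
      then show ?thesis unfolding D0[rule_format] degenerate_def by simp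
    qed
    show "is_sol \<alpha> k m (\<gamma> w) (chart_H k \<epsilon> (s w)) (chart_H k \<delta> (t w)) (\<lambda>f. c * P (ix l) w f)"
      if "l < \<alpha> + \<alpha>" for w l c
    proof -
      have "L (Inl (Inr ji)) w (\<lambda>f. c * P (ix l) w f) = 0 \<and> L (Inr (Inr ji)) w (\<lambda>f. c * P (ix l) w f) = 0"
        if ji: "ji \<in> {..<k} \<times> {..<m}" for ji
      proof -
        have mem: "Inl (Inr ji) \<in> ?U" "Inr (Inr ji) \<in> ?U" using ji by auto
        have "L e w (P (ix l) w) = 0" if "e \<in> ?U" "e \<noteq> ix l" for e
          using LP[rule_format, OF that(1) ix[OF \<open>l < \<alpha> + \<alpha>\<close>]] that(2) by simp
        from this[OF mem(1)] this[OF mem(2)] show ?thesis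
          unfolding L_lin[OF mem(1)] L_lin[OF mem(2)] by (simp add: ix_def)
      qed
      then show ?thesis unfolding sol_iff by blast
    qed
    show "\<rho> l' w (P (ix l) w) = (if l' = l then D w else 0)" if "l < \<alpha> + \<alpha>" "l' < \<alpha> + \<alpha>" for w l l'
      using LP[rule_format, OF ix[OF that(2)] ix[OF that(1)], of w] by (simp add: L_ix ix_inj)
  qed
qed

lemma degeneracy_polynomial:
  fixes \<gamma> :: "('v \<Rightarrow> 'a::field) \<Rightarrow> (index, 'a) imat"
  assumes "\<And>r s. r \<in> level_indices \<alpha> k m \<Longrightarrow> s \<in> level_indices \<alpha> k m \<Longrightarrow> (\<lambda>w. \<gamma> w r s) \<in> poly_fun V"
    and "\<And>e. e \<in> sym_coords k \<Longrightarrow> (\<lambda>w. s w e) \<in> poly_fun V"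
    and "\<And>e. e \<in> sym_coords k \<Longrightarrow> (\<lambda>w. t w e) \<in> poly_fun V"
    and "\<And>l. l < \<alpha> + \<alpha> \<Longrightarrow> \<rho> l \<in> lin_forms V (sol_indices \<alpha> k m)"
  shows "\<exists>D\<in>poly_fun V. \<forall>w. D w = 0 \<longleftrightarrow>
    degenerate \<alpha> k m (\<lambda>l. \<rho> l w) (\<gamma> w) (chart_H k \<epsilon> (s w)) (chart_H k \<delta> (t w))"
proof -
  have "\<exists>D Z. D \<in> poly_fun V \<and>
    (\<forall>l<\<alpha> + \<alpha>. \<forall>f\<in>sol_indices \<alpha> k m. (\<lambda>w. Z l w f) \<in> poly_fun V) \<and>
    (\<forall>w. D w = 0 \<longleftrightarrow>
      degenerate \<alpha> k m (\<lambda>l. \<rho> l w) (\<gamma> w) (chart_H k \<epsilon> (s w)) (chart_H k \<delta> (t w))) \<and>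
    (\<forall>w. \<forall>l<\<alpha> + \<alpha>. \<forall>c.
      is_sol \<alpha> k m (\<gamma> w) (chart_H k \<epsilon> (s w)) (chart_H k \<delta> (t w)) (\<lambda>f. c * Z l w f)) \<and>
    (\<forall>w. \<forall>l<\<alpha> + \<alpha>. \<forall>l'<\<alpha> + \<alpha>. \<rho> l' w (Z l w) = (if l' = l then D w else 0))"
    using assms by (rule chart_system)
  then show ?thesis by (elim exE conjE) (rule bexI)
qed

text \<open>\<open>mixed_coord\<close> lists the coordinates \<open>u\<^sup>+\<close> and \<open>- v\<^sup>-\<close>, \<open>source_coord\<close> the coordinates
  \<open>u\<^sup>+\<close> and \<open>u\<^sup>-\<close>.\<close>

definition mixed_coord :: "nat \<Rightarrow> nat \<Rightarrow> (index + index \<Rightarrow> 'a::field) \<Rightarrow> 'a"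
  where "mixed_coord \<alpha> l z = (if l < \<alpha> then z (Inl (Inl l)) else - z (Inr (Inl (l - \<alpha>))))"

definition source_coord ::
    "nat \<Rightarrow> nat \<Rightarrow> nat \<Rightarrow> (index, 'a::field) imat \<Rightarrow> nat \<Rightarrow> (index + index \<Rightarrow> 'a) \<Rightarrow> 'a"
  where "source_coord \<alpha> k m \<gamma> l z = sol_outer \<alpha> k m \<gamma> z $ l"

lemma mixed_coord_lin_forms:
  "l < \<alpha> + \<alpha> \<Longrightarrow> (\<lambda>w. mixed_coord \<alpha> l) \<in> lin_forms V (sol_indices \<alpha> k m)"
  unfolding mixed_coord_def
  by (cases "l < \<alpha>") (auto intro!: lin_forms_var lin_forms_uminus)

lemma lin_forms_sol_outer:
  assumes \<gamma>: "\<And>r s. r \<in> level_indices \<alpha> k m \<Longrightarrow> s \<in> level_indices \<alpha> k m \<Longrightarrow>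
      (\<lambda>w. \<gamma> w r s) \<in> poly_fun V"
    and l: "l < \<alpha> + \<alpha> + (\<alpha> + \<alpha>)"
  shows "(\<lambda>w z. sol_outer \<alpha> k m (\<gamma> w) z $ l) \<in> lin_forms V (sol_indices \<alpha> k m)"
proof -
  let ?I = "level_indices \<alpha> k m" and ?U = "sol_indices \<alpha> k m"
  have Xp: "(\<lambda>w z. z (Inl r)) \<in> lin_forms V ?U" if "r \<in> ?I" for r
    using that by (intro lin_forms_var) auto
  have Ym: "(\<lambda>w z. z (Inr r)) \<in> lin_forms V ?U" if "r \<in> ?I" for r
    using that by (intro lin_forms_var) auto
  have Xm: "(\<lambda>w z. mat_app ?I (\<lambda>r s. \<gamma> w s r) (\<lambda>r. z (Inr r)) r) \<in> lin_forms V ?U" if "r \<in> ?I" for r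
    using that \<gamma> Ym by (intro lin_forms_mat_app) auto
  have Yp: "(\<lambda>w z. mat_app ?I (\<gamma> w) (\<lambda>r. z (Inl r)) r) \<in> lin_forms V ?U" if "r \<in> ?I" for r
    using that \<gamma> Xp by (intro lin_forms_mat_app) auto
  consider "l < \<alpha>" | a where "l = \<alpha> + a" "a < \<alpha>" | a where "l = \<alpha> + \<alpha> + a" "a < \<alpha>"
    | a where "l = \<alpha> + \<alpha> + \<alpha> + a" "a < \<alpha>"
    using l by (metis add.assoc add_less_cancel_left le_Suc_ex not_less)
  then show ?thesis
    by cases (simp_all add: sol_outer_def outer_def Xp Ym Xm Yp)
qed

text \<open>The set \<open>{\<alpha>..<\<alpha> + \<alpha>}\<close> exchanges exactly the pairs
  coming from \<open>v\<close>, so the new position coordinates are \<open>u\<^sup>+\<close> and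
  \<open>- v\<^sup>-\<close>. Up to sign they are unknowns of the system, which singles out this
  chart of LGr(\<V> \<oplus> \<V>).\<close>

lemma qt_VV_sol_outer:
  assumes "l < \<alpha> + \<alpha>"
  shows "VV.qt \<alpha> {\<alpha>..<\<alpha> + \<alpha>} l (sol_outer \<alpha> k m \<gamma> z) = mixed_coord \<alpha> l z"
  using assms by (auto simp: VV.qt_def mixed_coord_def sol_outer_def q_VV_outer p_VV_outer)

lemma lag_chart_cong:
  assumes "\<And>i j. i \<le> j \<Longrightarrow> j < n \<Longrightarrow> s (i, j) = s' (i, j)"
  shows "lag_chart n q p \<kappa> s = lag_chart n q p \<kappa> s'"
proof -
  have "s (min i j, max i j) = s' (min i j, max i j)" if "i < n" "j < n" for i j
    using that by (intro assms) auto
  then show ?thesis unfolding lag_chart_def by (auto intro!: Collect_cong sum.cong)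
qed

lemma pair_chart_polys:
  "e \<in> sym_coords k \<Longrightarrow> (\<lambda>w. w (Inl e)) \<in> poly_fun (pair_coords k)"
  "e \<in> sym_coords k \<Longrightarrow> (\<lambda>w. w (Inr e)) \<in> poly_fun (pair_coords k)"
  by (auto simp: pair_coords_def intro!: poly_fun.var)

text \<open>Exchanging \<open>(q, p)\<close> for \<open>(p, - q)\<close> turns the slope
  \<open>c\<close> into \<open>- 1 / c\<close>. For nonzero \<open>c\<close> the subspace therefore
  lies in every chart, with diagonal coordinate matrix.\<close>

lemma chart_H_diagonal:
  assumes "c \<noteq> 0"
  shows "chart_H k \<epsilon> (\<lambda>(i, j). if i = j then if i \<in> \<epsilon> then - 1 / c else c else 0) =
    {x \<in> carrier_vec (k + k). \<forall>j<k. x $ (k + j) = c * x $ j}"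
proof -
  have "(if j \<in> \<epsilon> then - q_H k j x else p_H k j x) =
      (\<Sum>i<k. (case (min i j, max i j) of (i, j) \<Rightarrow>
        if i = j then if i \<in> \<epsilon> then - 1 / c else c else 0) * (if i \<in> \<epsilon> then p_H k i x else q_H k i x))
      \<longleftrightarrow> x $ (k + j) = c * x $ j" if j: "j < k" for j and x :: "'a vec"
  proof -
    have "(\<Sum>i<k. (case (min i j, max i j) of (i, j) \<Rightarrow>
        if i = j then if i \<in> \<epsilon> then - 1 / c else c else 0) * (if i \<in> \<epsilon> then p_H k i x else q_H k i x))
      = (\<Sum>i<k. if i = j then if j \<in> \<epsilon> then - 1 / c * p_H k j x else c * q_H k j x else 0)"
      by (intro sum.cong) (auto simp: min_def max_def)
    then show ?thesis using j assms by (auto simp: q_H_def p_H_def field_simps)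
  qed
  then show ?thesis unfolding chart_H_def lag_chart_def by auto
qed

text \<open>Let \<open>C\<close> be the inner block of \<open>\<gamma>\<close>. For \<open>Q\<close>
  of slope \<open>c\<close>, \<open>T\<close> of slope 1 and vanishing \<open>u\<^sup>+\<close>,
  \<open>v\<^sup>-\<close>, a solution satisfies \<open>y\<^sup>- = C x\<^sup>+\<close> and
  \<open>C\<^sup>T y\<^sup>- = c x\<^sup>+\<close>, so \<open>x\<^sup>+\<close> would be an
  eigenvector of \<open>N = C\<^sup>T C\<close>. It suffices to take \<open>c\<close> outside the
  spectrum of \<open>N\<close>; \<open>c \<noteq> 0\<close> is required by the charts.\<close>

lemma nondegenerate_pair:
  fixes \<gamma> :: "(index, 'a::field) imat"
  assumes inf: "infinite (UNIV :: 'a set)"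
  obtains w where "\<not> degenerate \<alpha> k m (mixed_coord \<alpha>) \<gamma> (fst (pair_chart k \<epsilon> \<delta> w)) (snd (pair_chart k \<epsilon> \<delta> w))"
proof -
  let ?I = "level_indices \<alpha> k m" and ?J = "{..<k} \<times> {..<m} :: (nat \<times> nat) set"
  define N where "N e f = (\<Sum>h\<in>?J. \<gamma> (Inr h) (Inr e) * \<gamma> (Inr h) (Inr f))" for e f
  have "finite ({0} \<union> {c. \<exists>z. (\<exists>f\<in>?J. z f \<noteq> 0) \<and> (\<forall>e\<in>?J. (\<Sum>f\<in>?J. N e f * z f) = c * z e)})"
    by (intro finite_UnI finite_eigenvalues) auto
  from ex_new_if_finite[OF inf this] obtain c where c: "c \<noteq> 0"
    "\<And>z. (\<forall>e\<in>?J. (\<Sum>f\<in>?J. N e f * z f) = c * z e) \<Longrightarrow> (\<forall>f\<in>?J. z f = 0)" by blast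
  define w :: "nat \<times> nat + nat \<times> nat \<Rightarrow> 'a" where
    "w = case_sum (\<lambda>(i, j). if i = j then if i \<in> \<epsilon> then - 1 / c else c else 0)
      (\<lambda>(i, j). if i = j then if i \<in> \<delta> then - 1 / 1 else 1 else 0)"
  have Q: "fst (pair_chart k \<epsilon> \<delta> w) = {x \<in> carrier_vec (k + k). \<forall>j<k. x $ (k + j) = c * x $ j}"
    unfolding pair_chart_def w_def fst_conv sum.case using c(1) by (rule chart_H_diagonal)
  have T: "snd (pair_chart k \<epsilon> \<delta> w) = {x \<in> carrier_vec (k + k). \<forall>j<k. x $ (k + j) = 1 * x $ j}"
    unfolding pair_chart_def w_def snd_conv sum.case by (rule chart_H_diagonal) simp
  have "z f = 0" if sol: "is_sol \<alpha> k m \<gamma> (fst (pair_chart k \<epsilon> \<delta> w)) (snd (pair_chart k \<epsilon> \<delta> w)) z"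
    and coord: "\<forall>l<\<alpha> + \<alpha>. mixed_coord \<alpha> l z = 0" and f: "f \<in> sol_indices \<alpha> k m" for z f
  proof -
    have u: "z (Inl (Inl a)) = 0" if "a < \<alpha>" for a
      using coord[rule_format, of a] that by (simp add: mixed_coord_def)
    have v: "z (Inr (Inl a)) = 0" if "a < \<alpha>" for a
      using coord[rule_format, of "\<alpha> + a"] that by (simp add: mixed_coord_def)
    have I: "(\<Sum>r\<in>?I. F r) = (\<Sum>a<\<alpha>. F (Inl a)) + (\<Sum>x\<in>?J. F (Inr x))" for F :: "index \<Rightarrow> 'a"
      unfolding level_indices_def by (simp add: sum.Plus)
    have y: "z (Inr (Inr h)) = (\<Sum>f\<in>?J. \<gamma> (Inr h) (Inr f) * z (Inl (Inr f)))" if "h \<in> ?J" for h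
      using sol that unfolding is_sol_def Q T by (auto simp: fiber_def mat_app_def I u)
    have x: "(\<Sum>h\<in>?J. \<gamma> (Inr h) (Inr e) * z (Inr (Inr h))) = c * z (Inl (Inr e))" if "e \<in> ?J" for e
      using sol that unfolding is_sol_def Q T by (auto simp: fiber_def mat_app_def I v)
    have "(\<Sum>f\<in>?J. N e f * z (Inl (Inr f))) = c * z (Inl (Inr e))" if e: "e \<in> ?J" for e
    proof -
      have "(\<Sum>f\<in>?J. N e f * z (Inl (Inr f)))
          = (\<Sum>h\<in>?J. \<gamma> (Inr h) (Inr e) * (\<Sum>f\<in>?J. \<gamma> (Inr h) (Inr f) * z (Inl (Inr f))))"
        unfolding N_def sum_distrib_left sum_distrib_right
        by (subst sum.swap) (simp add: mult.assoc)
      also have "\<dots> = (\<Sum>h\<in>?J. \<gamma> (Inr h) (Inr e) * z (Inr (Inr h)))"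
        by (intro sum.cong refl) (simp add: y)
      finally show ?thesis using x[OF e] by simp
    qed
    then have zx: "\<forall>f\<in>?J. z (Inl (Inr f)) = 0" using c(2)[of "\<lambda>f. z (Inl (Inr f))"] by blast
    then have zy: "z (Inr (Inr h)) = 0" if "h \<in> ?J" for h
      unfolding y[OF that] using zx by (intro sum.neutral) auto
    from f show ?thesis
      using u v zx zy unfolding level_indices_def by auto
  qed
  then show thesis using that[of w] unfolding degenerate_def by blast
qed

lemma pair_chart_in_LGr:
  "fst (pair_chart k \<epsilon> \<delta> w) \<in> LGr (J_mat k)" "snd (pair_chart k \<epsilon> \<delta> w) \<in> LGr (J_mat k)"
  by (simp_all add: pair_chart_def chart_H_def H.lag_chart_in_LGr)

text \<open>The exceptional variety \<open>W\<close> consists of the pairs for which the mixed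
  coordinates do not determine the solution; in each chart it is the zero set of one determinant.
  Off \<open>W\<close> the basic solutions divided by \<open>D\<close> are dual to the mixed
  coordinates, so \<open>VV.LGr_eq_lag_chart\<close> yields the chart coordinates.\<close>

lemma rational_chi_coord:
  fixes \<gamma> :: "(index, 'a::field) imat"
  assumes inf: "infinite (UNIV :: 'a set)"
  shows "rational_LGr2 \<alpha> k (chi_coord \<alpha> k m \<gamma>)"
proof -
  let ?deg = "degenerate \<alpha> k m (mixed_coord \<alpha>) \<gamma>" and ?V = "pair_coords k"
  let ?\<kappa> = "{\<alpha>..<\<alpha> + \<alpha>}" and ?U = "sol_indices \<alpha> k m"
  define W where "W = {(Q, T). Q \<in> LGr (J_mat k) \<and> T \<in> LGr (J_mat k) \<and> ?deg Q T}"
  have W_iff: "pair_chart k \<epsilon> \<delta> w \<in> W \<longleftrightarrow> ?deg (chart_H k \<epsilon> (\<lambda>e. w (Inl e))) (chart_H k \<delta> (\<lambda>e. w (Inr e)))"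
    for \<epsilon> \<delta> w
    using pair_chart_in_LGr[of k \<epsilon> \<delta> w] by (simp add: W_def pair_chart_def)
  have sys: "\<exists>D Z. D \<in> poly_fun ?V \<and> (\<forall>l<\<alpha> + \<alpha>. \<forall>f\<in>?U. (\<lambda>w. Z l w f) \<in> poly_fun ?V) \<and>
      (\<forall>w. D w = 0 \<longleftrightarrow> pair_chart k \<epsilon> \<delta> w \<in> W) \<and>
      (\<forall>w. \<forall>l<\<alpha> + \<alpha>. \<forall>c. is_sol \<alpha> k m \<gamma> (chart_H k \<epsilon> (\<lambda>e. w (Inl e))) (chart_H k \<delta> (\<lambda>e. w (Inr e)))
        (\<lambda>f. c * Z l w f)) \<and>
      (\<forall>w. \<forall>l<\<alpha> + \<alpha>. \<forall>l'<\<alpha> + \<alpha>. mixed_coord \<alpha> l' (Z l w) = (if l' = l then D w else 0))" for \<epsilon> \<delta>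
  proof -
    show ?thesis
      unfolding W_iff
      by (rule chart_system[where \<gamma> = "\<lambda>_. \<gamma>" and s = "\<lambda>w e. w (Inl e)"
            and t = "\<lambda>w e. w (Inr e)" and \<rho> = "\<lambda>l w. mixed_coord \<alpha> l"],
          rule poly_fun.const, erule pair_chart_polys, erule pair_chart_polys,
          erule mixed_coord_lin_forms)
  qed
  have "subvariety_LGr2 k W"
    unfolding subvariety_LGr2_def
  proof (intro conjI allI impI)
    show "W \<subseteq> LGr (J_mat k) \<times> LGr (J_mat k)" by (auto simp: W_def)
    fix \<epsilon> \<delta> assume "\<epsilon> \<subseteq> {..<k}" "\<delta> \<subseteq> {..<k}"
    from sys[of \<epsilon> \<delta>] obtain D where "D \<in> poly_fun ?V" "\<forall>w. D w = 0 \<longleftrightarrow> pair_chart k \<epsilon> \<delta> w \<in> W"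
      by (elim exE conjE) (rule that)
    then show "\<exists>F\<subseteq>poly_fun ?V. \<forall>w. pair_chart k \<epsilon> \<delta> w \<in> W \<longleftrightarrow> (\<forall>f\<in>F. f w = 0)"
      by (intro exI[of _ "{D}"]) auto
  qed
  moreover have "W \<noteq> LGr (J_mat k) \<times> LGr (J_mat k)"
  proof -
    obtain w where w: "\<not> ?deg (fst (pair_chart k {} {} w)) (snd (pair_chart k {} {} w))"
      using inf by (rule nondegenerate_pair)
    then have "pair_chart k {} {} w \<notin> W" by (auto simp: W_def)
    moreover have "pair_chart k {} {} w \<in> LGr (J_mat k) \<times> LGr (J_mat k)"
      using pair_chart_in_LGr[of k "{}" "{}" w] by (simp add: mem_Times_iff)
    ultimately show ?thesis by metis
  qed
  moreover have "\<exists>\<kappa>\<subseteq>{..<\<alpha> + \<alpha>}. \<exists>P D.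
        (\<forall>e \<in> sym_coords (\<alpha> + \<alpha>). P e \<in> poly_fun ?V \<and> D e \<in> poly_fun ?V) \<and>
        (\<forall>w. pair_chart k \<epsilon> \<delta> w \<notin> W \<longrightarrow>
          (\<forall>e \<in> sym_coords (\<alpha> + \<alpha>). D e w \<noteq> 0) \<and>
          case_prod (chi_coord \<alpha> k m \<gamma>) (pair_chart k \<epsilon> \<delta> w) = chart_VV \<alpha> \<kappa> (\<lambda>e. P e w / D e w))"
    for \<epsilon> \<delta>
  proof -
    from sys[of \<epsilon> \<delta>] obtain D Z where D: "D \<in> poly_fun ?V"
      and Z: "\<forall>l<\<alpha> + \<alpha>. \<forall>f\<in>?U. (\<lambda>w. Z l w f) \<in> poly_fun ?V"
      and D0: "\<forall>w. D w = 0 \<longleftrightarrow> pair_chart k \<epsilon> \<delta> w \<in> W"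
      and sol: "\<forall>w. \<forall>l<\<alpha> + \<alpha>. \<forall>c. is_sol \<alpha> k m \<gamma> (chart_H k \<epsilon> (\<lambda>e. w (Inl e)))
        (chart_H k \<delta> (\<lambda>e. w (Inr e))) (\<lambda>f. c * Z l w f)"
      and \<rho>: "\<forall>w. \<forall>l<\<alpha> + \<alpha>. \<forall>l'<\<alpha> + \<alpha>. mixed_coord \<alpha> l' (Z l w) = (if l' = l then D w else 0)"
      by (elim exE conjE) (rule that)
    let ?p = "\<lambda>j z. VV.pt \<alpha> ?\<kappa> j (sol_outer \<alpha> k m \<gamma> z)"
    have p_lin: "(\<lambda>w. ?p j) \<in> lin_forms ?V ?U" if j: "j < \<alpha> + \<alpha>" for j
    proof -
      have *: "(\<lambda>w z. sol_outer \<alpha> k m \<gamma> z $ l) \<in> lin_forms ?V ?U" if "l < \<alpha> + \<alpha> + (\<alpha> + \<alpha>)" for l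
        by (rule lin_forms_sol_outer[where \<gamma> = "\<lambda>_. \<gamma>"]) (use that in \<open>auto intro: poly_fun.const\<close>)
      show ?thesis
        using j by (cases "j < \<alpha>") (auto simp: VV.pt_def q_VV_def p_VV_def intro!: * lin_forms_uminus)
    qed
    \<comment> \<open>Numerators are the conjugate coordinates of the basic solutions before
      division; the determinant is the common denominator.\<close>
    define P where "P = (\<lambda>(i, j) w. ?p j (Z i w))"
    have "P e \<in> poly_fun ?V" if e: "e \<in> sym_coords (\<alpha> + \<alpha>)" for e
    proof -
      obtain i j where ij: "e = (i, j)" "i \<le> j" "j < \<alpha> + \<alpha>" using e by (auto simp: sym_coords_def)
      have "(\<lambda>w. ?p j (Z i w)) \<in> poly_fun ?V"
        using p_lin[OF ij(3)] Z ij by (intro poly_fun_lin_forms[where L = "\<lambda>w. ?p j" and U = ?U]) auto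
      then show ?thesis by (simp add: P_def ij)
    qed
    moreover have "case_prod (chi_coord \<alpha> k m \<gamma>) (pair_chart k \<epsilon> \<delta> w) = chart_VV \<alpha> ?\<kappa> (\<lambda>e. P e w / D w)"
      if "D w \<noteq> 0" for w
    proof -
      define L where "L = case_prod (chi_coord \<alpha> k m \<gamma>) (pair_chart k \<epsilon> \<delta> w)"
      define x where "x i = sol_outer \<alpha> k m \<gamma> (\<lambda>f. 1 / D w * Z i w f)" for i
      have "L \<in> LGr (J_ominus \<alpha>)"
        unfolding L_def using pair_chart_in_LGr[of k \<epsilon> \<delta> w]
        by (auto simp: case_prod_beta intro: chi_coord_in_LGr)
      moreover have "x i \<in> L" if "i < \<alpha> + \<alpha>" for i
        using sol_outer_in_chi_coord[OF sol[rule_format, OF that, of w "1 / D w"]]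
        by (simp add: x_def L_def pair_chart_def)
      moreover have "VV.qt \<alpha> ?\<kappa> l (x i) = (if l = i then 1 else 0)" if "i < \<alpha> + \<alpha>" "l < \<alpha> + \<alpha>" for i l
      proof -
        have "VV.qt \<alpha> ?\<kappa> l (x i) = 1 / D w * mixed_coord \<alpha> l (Z i w)"
          using that by (simp add: x_def qt_VV_sol_outer) (simp add: mixed_coord_def)
        then show ?thesis using \<rho> that \<open>D w \<noteq> 0\<close> by simp
      qed
      ultimately have "L = lag_chart (\<alpha> + \<alpha>) (q_VV \<alpha>) (p_VV \<alpha>) ?\<kappa> (\<lambda>(i, j). VV.pt \<alpha> ?\<kappa> j (x i))"
        by (rule VV.LGr_eq_lag_chart)
      also have "\<dots> = lag_chart (\<alpha> + \<alpha>) (q_VV \<alpha>) (p_VV \<alpha>) ?\<kappa> (\<lambda>e. P e w / D w)"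
      proof (rule lag_chart_cong)
        fix i j assume j: "i \<le> j" "j < \<alpha> + \<alpha>"
        show "(case (i, j) of (i, j) \<Rightarrow> VV.pt \<alpha> ?\<kappa> j (x i)) = P (i, j) w / D w"
          using lin_forms_linear[OF p_lin[OF j(2)], of "\<lambda>_. 1 / D w" "\<lambda>_. Z i w" "{()}"]
          by (simp add: x_def P_def)
      qed
      finally show ?thesis by (simp add: L_def chart_VV_def)
    qed
    ultimately show ?thesis
      using D D0 by (intro exI[of _ ?\<kappa>] conjI exI[of _ P] exI[of _ "\<lambda>_. D"]) auto
  qed
  ultimately show ?thesis unfolding rational_LGr2_def by (intro exI[of _ W]) auto
qed

section \<open>Lagrangian subspaces that are graphs of symplectic operators\<close>

lemma bilin_J_ominus_append:
  fixes a a' b b' :: "'a::field vec"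
  assumes "a \<in> carrier_vec (\<alpha> + \<alpha>)" "b \<in> carrier_vec (\<alpha> + \<alpha>)"
    "a' \<in> carrier_vec (\<alpha> + \<alpha>)" "b' \<in> carrier_vec (\<alpha> + \<alpha>)"
  shows "bilin (J_ominus \<alpha>) (a @\<^sub>v b) (a' @\<^sub>v b') = bilin (J_mat \<alpha>) a a' - bilin (J_mat \<alpha>) b b'"
proof -
  have *: "a @\<^sub>v b \<in> carrier_vec (\<alpha> + \<alpha> + (\<alpha> + \<alpha>))" "a' @\<^sub>v b' \<in> carrier_vec (\<alpha> + \<alpha> + (\<alpha> + \<alpha>))"
    using assms by (auto intro: append_carrier_vec)
  show ?thesis
    unfolding bilin_J_ominus[OF *] bilin_J_mat[OF assms(1,3)] bilin_J_mat[OF assms(2,4)]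
    using assms by (simp add: sum_lessThan_add q_H_def p_H_def q_VV_def p_VV_def
        sum_subtractf sum_negf mult_2 add.assoc)
qed

lemma (in darboux) LGr_lincomb:
  fixes x :: "nat \<Rightarrow> 'a vec"
  assumes L: "L \<in> LGr \<Omega>" and x: "\<And>i. i < N \<Longrightarrow> x i \<in> L"
  shows "vec (n + n) (\<lambda>r. \<Sum>i<N. c i * x i $ r) \<in> L"
  using x
proof (induction N)
  case 0
  have "vec (n + n) (\<lambda>r. 0 :: 'a) = 0\<^sub>v (n + n)" by auto
  then show ?case using LGr_subspace[OF L] unfolding subspace_module_vec_iff by simp
next
  case (Suc N)
  have "vec (n + n) (\<lambda>r. \<Sum>i<Suc N. c i * x i $ r)
      = vec (n + n) (\<lambda>r. \<Sum>i<N. c i * x i $ r) + c N \<cdot>\<^sub>v x N"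
    using LGr_carrier[OF L Suc.prems[of N]] by (intro eq_vecI) auto
  then show ?case
    using Suc LGr_subspace[OF L] unfolding subspace_module_vec_iff by simp
qed

text \<open>The vectors \<open>x i\<close> lie over the unit vectors of the source, so their second
  halves are the columns of the operator; by \<open>inj\<close> nothing else of \<open>L\<close>
  lies over the same points. Isotropy of \<open>x i\<close> and \<open>x j\<close> for
  \<open>J_ominus\<close> says that both halves have the same value of the form of \<V>, which is
  the symplectic condition entry by entry.\<close>

lemma LGr_is_graph:
  fixes L :: "'a::field vec set"
  assumes L: "L \<in> LGr (J_ominus \<alpha>)" and x: "\<And>i. i < \<alpha> + \<alpha> \<Longrightarrow> x i \<in> L"
    and dual: "\<And>i l. i < \<alpha> + \<alpha> \<Longrightarrow> l < \<alpha> + \<alpha> \<Longrightarrow> x i $ l = (if l = i then 1 else 0)"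
    and inj: "\<And>y. y \<in> L \<Longrightarrow> (\<And>l. l < \<alpha> + \<alpha> \<Longrightarrow> y $ l = 0) \<Longrightarrow> y = 0\<^sub>v (\<alpha> + \<alpha> + (\<alpha> + \<alpha>))"
  shows "\<exists>A\<in>Sp \<alpha>. L = graph_of (\<alpha> + \<alpha>) A"
proof -
  define n where "n = \<alpha> + \<alpha>"
  note L = L and x = x[folded n_def] and dual = dual[folded n_def] and inj = inj[folded n_def]
  define A where "A = mat n n (\<lambda>(r, i). x i $ (n + r))"
  have A: "A \<in> carrier_mat n n" by (simp add: A_def)
  have xc: "x i \<in> carrier_vec (n + n)" if "i < n" for i
    using VV.LGr_carrier[OF L x[OF that]] by (simp add: n_def)
  have graph: "a @\<^sub>v (A *\<^sub>v a) \<in> L" if a: "a \<in> carrier_vec n" for a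
  proof -
    have "a @\<^sub>v (A *\<^sub>v a) = vec (n + n) (\<lambda>r. \<Sum>i<n. a $ i * x i $ r)"
    proof (rule eq_vecI)
      fix r assume r: "r < dim_vec (vec (n + n) (\<lambda>r. \<Sum>i<n. a $ i * x i $ r))"
      show "(a @\<^sub>v (A *\<^sub>v a)) $ r = vec (n + n) (\<lambda>r. \<Sum>i<n. a $ i * x i $ r) $ r"
      proof (cases "r < n")
        case True
        have "(\<Sum>i<n. a $ i * x i $ r) = (\<Sum>i<n. if i = r then a $ i else 0)"
          using dual True by (intro sum.cong) auto
        then show ?thesis using True a by simp
      next
        case False
        then obtain r' where r': "r = n + r'" "r' < n" using r by (auto simp: not_less dest!: le_Suc_ex)
        then show ?thesis
          using a by (simp add: A_def scalar_prod_def atLeast0LessThan mult.commute)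
      qed
    qed (use a A in auto)
    then show ?thesis using VV.LGr_lincomb[OF L, of n x "\<lambda>i. a $ i"] x by (simp add: n_def)
  qed
  have sub: "subspace class_ring L (module_vec TYPE('a) (n + n))"
    using VV.LGr_subspace[OF L] by (simp add: n_def)
  have "L = graph_of n A"
  proof (intro equalityI subsetI)
    fix y assume y: "y \<in> L"
    have yc: "y \<in> carrier_vec (n + n)" using VV.LGr_carrier[OF L y] by (simp add: n_def)
    define a where "a = vec n (\<lambda>l. y $ l)"
    have a: "a \<in> carrier_vec n" by (simp add: a_def)
    have ac: "a @\<^sub>v (A *\<^sub>v a) \<in> carrier_vec (n + n)" using a A by (intro append_carrier_vec) auto
    have "y + (- 1) \<cdot>\<^sub>v (a @\<^sub>v (A *\<^sub>v a)) \<in> L"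
      using sub y graph[OF a] unfolding subspace_module_vec_iff by blast
    moreover have "(y + (- 1) \<cdot>\<^sub>v (a @\<^sub>v (A *\<^sub>v a))) $ l = 0" if "l < n" for l
      using that yc ac by (simp add: a_def)
    ultimately have *: "y + (- 1) \<cdot>\<^sub>v (a @\<^sub>v (A *\<^sub>v a)) = 0\<^sub>v (n + n)" by (rule inj)
    have "y = a @\<^sub>v (A *\<^sub>v a)"
    proof (rule eq_vecI)
      fix r assume "r < dim_vec (a @\<^sub>v (A *\<^sub>v a))"
      then have r: "r < n + n" using carrier_vecD[OF ac] by metis
      then have "(y + (- 1) \<cdot>\<^sub>v (a @\<^sub>v (A *\<^sub>v a))) $ r = 0" unfolding * by simp
      then show "y $ r = (a @\<^sub>v (A *\<^sub>v a)) $ r" using r carrier_vecD[OF yc] carrier_vecD[OF ac] by simp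
    qed (simp add: carrier_vecD[OF yc] carrier_vecD[OF ac] del: index_append_vec)
    then show "y \<in> graph_of n A" using a unfolding graph_of_def by blast
  next
    fix y assume "y \<in> graph_of n A"
    then show "y \<in> L" using graph unfolding graph_of_def by blast
  qed
  moreover have "A \<in> Sp \<alpha>"
  proof -
    have J: "J_mat \<alpha> \<in> carrier_mat n n" by (simp add: n_def)
    have "A\<^sup>T * J_mat \<alpha> * A = J_mat \<alpha>"
    proof (rule eq_matI)
      fix i j assume ij: "i < dim_row (J_mat \<alpha> :: 'a mat)" "j < dim_col (J_mat \<alpha> :: 'a mat)"
      then have ij: "i < n" "j < n" using J by auto
      have xi: "x i = unit_vec n i @\<^sub>v col A i" if "i < n" for i
      proof (rule eq_vecI)
        fix r assume r: "r < dim_vec (unit_vec n i @\<^sub>v col A i)"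
        show "x i $ r = (unit_vec n i @\<^sub>v col A i) $ r"
        proof (cases "r < n")
          case True
          then show ?thesis using dual[OF that True] by (auto simp: unit_vec_def)
        next
          case False
          then obtain r' where "r = n + r'" "r' < n"
            using r A by (auto simp: not_less dest!: le_Suc_ex)
          then show ?thesis using that by (simp add: A_def)
        qed
      qed (use xc[OF that] A in auto)
      have "bilin (J_ominus \<alpha>) (x i) (x j) = 0" using VV.LGr_isotropic[OF L x[OF ij(1)] x[OF ij(2)]] .
      then have "bilin (J_mat \<alpha>) (col A i) (col A j) = bilin (J_mat \<alpha>) (unit_vec n i) (unit_vec n j)"
        unfolding xi[OF ij(1)] xi[OF ij(2)]
        by (subst (asm) bilin_J_ominus_append) (use A ij in \<open>auto simp: n_def\<close>)
      moreover have "bilin (J_mat \<alpha>) (unit_vec n i) (unit_vec n j) = J_mat \<alpha> $$ (i, j)"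
        unfolding bilin_def using ij J mult_mat_vec_carrier[OF J, of "unit_vec n j"]
        by (subst scalar_prod_left_unit[of _ n]) (simp_all add: carrier_matD[OF J])
      moreover have "(A\<^sup>T * J_mat \<alpha> * A) $$ (i, j) = bilin (J_mat \<alpha>) (col A i) (col A j)"
      proof -
        have "(A\<^sup>T * J_mat \<alpha> * A) $$ (i, j) = (A\<^sup>T * (J_mat \<alpha> * A)) $$ (i, j)"
          using A J by (subst assoc_mult_mat[of _ n n _ n _ n]) auto
        also have "\<dots> = row A\<^sup>T i \<bullet> col (J_mat \<alpha> * A) j" using ij A J by simp
        also have "col (J_mat \<alpha> * A) j = J_mat \<alpha> *\<^sub>v col A j" by (rule col_mult2[OF J A ij(2)])
        finally show ?thesis using ij A by (simp add: bilin_def)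
      qed
      ultimately show "(A\<^sup>T * J_mat \<alpha> * A) $$ (i, j) = J_mat \<alpha> $$ (i, j)" by simp
    qed (use A J in auto)
    then show ?thesis using A by (simp add: Sp_def n_def)
  qed
  ultimately show ?thesis by (auto simp: n_def)
qed

lemma sol_outer_zero:
  assumes "\<And>f. f \<in> sol_indices \<alpha> k m \<Longrightarrow> z f = 0"
  shows "sol_outer \<alpha> k m \<gamma> z = 0\<^sub>v (\<alpha> + \<alpha> + (\<alpha> + \<alpha>))"
proof -
  have z: "z (Inl r) = 0" "z (Inr r) = 0" if "r \<in> level_indices \<alpha> k m" for r
    using assms that by auto
  then have "mat_app (level_indices \<alpha> k m) \<gamma>' (\<lambda>r. z (Inl r)) = (\<lambda>_. 0)"
    "mat_app (level_indices \<alpha> k m) \<gamma>' (\<lambda>r. z (Inr r)) = (\<lambda>_. 0)" for \<gamma>'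
    by (auto simp: mat_app_def fun_eq_iff intro!: sum.neutral)
  then show ?thesis using z by (intro eq_vecI) (auto simp: sol_outer_def outer_def)
qed

lemma source_coord_lin_forms:
  assumes "\<And>r s. r \<in> level_indices \<alpha> k m \<Longrightarrow> s \<in> level_indices \<alpha> k m \<Longrightarrow>
      (\<lambda>w. \<gamma> w r s) \<in> poly_fun V" and "l < \<alpha> + \<alpha>"
  shows "(\<lambda>w. source_coord \<alpha> k m (\<gamma> w) l) \<in> lin_forms V (sol_indices \<alpha> k m)"
  unfolding source_coord_def using assms by (intro lin_forms_sol_outer) auto

text \<open>Dividing by the determinant makes the basic solutions lie over the unit vectors of the
  source, and nondegeneracy leaves only zero over the zero vector.\<close>

lemma nondegenerate_imp_graph:
  fixes \<gamma> :: "(index, 'a::field) imat"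
  assumes nd: "\<not> degenerate \<alpha> k m (source_coord \<alpha> k m \<gamma>) \<gamma> (fst (pair_chart k \<epsilon> \<delta> w)) (snd (pair_chart k \<epsilon> \<delta> w))"
  shows "\<exists>A\<in>Sp \<alpha>. case_prod (chi_coord \<alpha> k m \<gamma>) (pair_chart k \<epsilon> \<delta> w) = graph_of (\<alpha> + \<alpha>) A"
proof -
  let ?Q = "fst (pair_chart k \<epsilon> \<delta> w)" and ?T = "snd (pair_chart k \<epsilon> \<delta> w)"
  \<comment> \<open>The pair is fixed, so the system has no parameters: polynomials in an empty set
    of variables, evaluated at an arbitrary point \<open>v\<close>.\<close>
  let ?V = "{} :: unit set" and ?U = "sol_indices \<alpha> k m" and ?\<rho> = "source_coord \<alpha> k m \<gamma>"
  have "\<exists>D Z. D \<in> poly_fun ?V \<and> (\<forall>l<\<alpha> + \<alpha>. \<forall>f\<in>?U. (\<lambda>w. Z l w f) \<in> poly_fun ?V) \<and>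
      (\<forall>v. D v = 0 \<longleftrightarrow> degenerate \<alpha> k m ?\<rho> \<gamma> ?Q ?T) \<and>
      (\<forall>v. \<forall>l<\<alpha> + \<alpha>. \<forall>c. is_sol \<alpha> k m \<gamma> ?Q ?T (\<lambda>f. c * Z l v f)) \<and>
      (\<forall>v. \<forall>l<\<alpha> + \<alpha>. \<forall>l'<\<alpha> + \<alpha>. ?\<rho> l' (Z l v) = (if l' = l then D v else (0::'a)))"
    unfolding pair_chart_def fst_conv snd_conv
    by (rule chart_system[where \<gamma> = "\<lambda>_. \<gamma>" and s = "\<lambda>_ e. w (Inl e)"
          and t = "\<lambda>_ e. w (Inr e)" and \<rho> = "\<lambda>l _. ?\<rho> l"],
        rule poly_fun.const, rule poly_fun.const, rule poly_fun.const,
        erule source_coord_lin_forms[rotated], rule poly_fun.const)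
  then obtain D Z where "D \<in> poly_fun ?V"
    and "\<forall>l<\<alpha> + \<alpha>. \<forall>f\<in>?U. (\<lambda>w. Z l w f) \<in> poly_fun ?V"
    and D: "\<forall>v. D v = 0 \<longleftrightarrow> degenerate \<alpha> k m ?\<rho> \<gamma> ?Q ?T"
    and sol: "\<forall>v. \<forall>l<\<alpha> + \<alpha>. \<forall>c. is_sol \<alpha> k m \<gamma> ?Q ?T (\<lambda>f. c * Z l v f)"
    and \<rho>: "\<forall>v. \<forall>l<\<alpha> + \<alpha>. \<forall>l'<\<alpha> + \<alpha>. ?\<rho> l' (Z l v) = (if l' = l then D v else (0::'a))"
    by (elim exE conjE) (rule that)
  define v :: "unit \<Rightarrow> 'a" where "v = (\<lambda>_. 0)"
  have Dv: "D v \<noteq> 0" using D nd by simp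
  let ?L = "chi_coord \<alpha> k m \<gamma> ?Q ?T"
  define x where "x i = sol_outer \<alpha> k m \<gamma> (\<lambda>f. 1 / D v * Z i v f)" for i
  have lin: "(\<lambda>_ :: unit \<Rightarrow> 'a. ?\<rho> l) \<in> lin_forms ?V ?U" if "l < \<alpha> + \<alpha>" for l
    using that by (intro source_coord_lin_forms poly_fun.const)
  have "\<exists>A\<in>Sp \<alpha>. ?L = graph_of (\<alpha> + \<alpha>) A"
  proof (rule LGr_is_graph)
    show "?L \<in> LGr (J_ominus \<alpha>)" using pair_chart_in_LGr by (rule chi_coord_in_LGr)
    show "x i \<in> ?L" if "i < \<alpha> + \<alpha>" for i
      unfolding x_def using sol[rule_format, OF that] by (rule sol_outer_in_chi_coord)
    show "x i $ l = (if l = i then 1 else 0)" if "i < \<alpha> + \<alpha>" "l < \<alpha> + \<alpha>" for i l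
    proof -
      have "x i $ l = ?\<rho> l (\<lambda>f. 1 / D v * Z i v f)" by (simp add: x_def source_coord_def)
      also have "\<dots> = 1 / D v * ?\<rho> l (Z i v)"
        using lin_forms_linear[OF lin[OF that(2)], of "\<lambda>_. 1 / D v" "\<lambda>_. Z i v" "{()}"] by simp
      finally show ?thesis using \<rho> that Dv by simp
    qed
    fix y assume "y \<in> ?L" and zero: "\<And>l. l < \<alpha> + \<alpha> \<Longrightarrow> y $ l = 0"
    from \<open>y \<in> ?L\<close> obtain z where z: "y = sol_outer \<alpha> k m \<gamma> z" "is_sol \<alpha> k m \<gamma> ?Q ?T z"
      by (rule chi_coord_solE)
    have "\<forall>l<\<alpha> + \<alpha>. ?\<rho> l z = 0" using zero by (simp add: source_coord_def z)
    then have "\<And>f. f \<in> ?U \<Longrightarrow> z f = 0" using nd z(2) unfolding degenerate_def by blast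
    then show "y = 0\<^sub>v (\<alpha> + \<alpha> + (\<alpha> + \<alpha>))" unfolding z(1) by (rule sol_outer_zero)
  qed
  then show ?thesis by (simp add: case_prod_beta)
qed

text \<open>Over zero a graph contains only zero, so a solution with vanishing \<open>u\<close> has
  vanishing outer part and in particular vanishing mixed coordinates. It is \<open>nd\<close> that
  then makes the solution itself zero: a solution without outer part leaves no trace in
  \<open>chi_coord\<close>.\<close>

lemma graph_imp_nondegenerate:
  assumes g: "chi_coord \<alpha> k m \<gamma> Q T = graph_of (\<alpha> + \<alpha>) A" and A: "A \<in> carrier_mat (\<alpha> + \<alpha>) (\<alpha> + \<alpha>)"
    and nd: "\<not> degenerate \<alpha> k m (mixed_coord \<alpha>) \<gamma> Q T"
  shows "\<not> degenerate \<alpha> k m (source_coord \<alpha> k m \<gamma>) \<gamma> Q T"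
proof
  assume "degenerate \<alpha> k m (source_coord \<alpha> k m \<gamma>) \<gamma> Q T"
  then obtain z where z: "\<exists>f\<in>sol_indices \<alpha> k m. z f \<noteq> 0" "is_sol \<alpha> k m \<gamma> Q T z"
    "\<forall>l<\<alpha> + \<alpha>. source_coord \<alpha> k m \<gamma> l z = 0"
    unfolding degenerate_def by blast
  let ?y = "sol_outer \<alpha> k m \<gamma> z"
  have "?y \<in> graph_of (\<alpha> + \<alpha>) A" using sol_outer_in_chi_coord[OF z(2)] g by simp
  then obtain u where u: "u \<in> carrier_vec (\<alpha> + \<alpha>)" "?y = u @\<^sub>v (A *\<^sub>v u)" unfolding graph_of_def by blast
  have "u $ l = 0" if "l < \<alpha> + \<alpha>" for l
    using z(3) that u unfolding source_coord_def u(2) by simp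
  then have "u = 0\<^sub>v (\<alpha> + \<alpha>)" using u(1) by auto
  moreover have "A *\<^sub>v 0\<^sub>v (\<alpha> + \<alpha>) = 0\<^sub>v (\<alpha> + \<alpha>)"
    using A by (intro eq_vecI) (auto simp: scalar_prod_def)
  ultimately have "?y = 0\<^sub>v (\<alpha> + \<alpha>) @\<^sub>v 0\<^sub>v (\<alpha> + \<alpha>)" using u by simp
  then have y: "?y = 0\<^sub>v (\<alpha> + \<alpha> + (\<alpha> + \<alpha>))" by auto
  have "mixed_coord \<alpha> l z = 0" if "l < \<alpha> + \<alpha>" for l
    unfolding qt_VV_sol_outer[OF that, of k m \<gamma> z, symmetric] y using that by (rule VV.twisted_zero)
  with z nd show False unfolding degenerate_def by blast
qed

lemma degenerate_polynomial:
  fixes \<gamma> :: "(index, 'a::field) imat"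
  assumes \<rho>: "\<And>l. l < \<alpha> + \<alpha> \<Longrightarrow> (\<lambda>w. \<rho> l) \<in> lin_forms (pair_coords k) (sol_indices \<alpha> k m)"
  shows "\<exists>D\<in>poly_fun (pair_coords k). \<forall>w. D w = 0 \<longleftrightarrow>
    degenerate \<alpha> k m \<rho> \<gamma> (fst (pair_chart k \<epsilon> \<delta> w)) (snd (pair_chart k \<epsilon> \<delta> w))"
  unfolding pair_chart_def fst_conv snd_conv
  by (rule degeneracy_polynomial[where \<gamma> = "\<lambda>_. \<gamma>" and s = "\<lambda>w e. w (Inl e)"
        and t = "\<lambda>w e. w (Inr e)" and \<rho> = "\<lambda>l _. \<rho> l"],
      rule poly_fun.const, erule pair_chart_polys, erule pair_chart_polys, erule \<rho>)

text \<open>Here the pair is fixed and the entries of the matrix are the variables. Since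
  \<open>u\<^sup>-\<close> is computed from the unknowns by the transpose, the prescribed
  coordinates depend polynomially on these entries as well.\<close>

lemma degenerate_polynomial_matrix:
  fixes \<gamma> :: "('v \<Rightarrow> 'a::field) \<Rightarrow> (index, 'a) imat"
  assumes \<gamma>: "\<And>r s. r \<in> level_indices \<alpha> k m \<Longrightarrow> s \<in> level_indices \<alpha> k m \<Longrightarrow>
      (\<lambda>w. \<gamma> w r s) \<in> poly_fun V"
  shows "\<exists>D\<in>poly_fun V. \<forall>v. D v = 0 \<longleftrightarrow> degenerate \<alpha> k m (source_coord \<alpha> k m (\<gamma> v)) (\<gamma> v)
    (fst (pair_chart k \<epsilon> \<delta> w)) (snd (pair_chart k \<epsilon> \<delta> w))"
  unfolding pair_chart_def fst_conv snd_conv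
  by (rule degeneracy_polynomial[where \<gamma> = \<gamma> and s = "\<lambda>_ e. w (Inl e)"
        and t = "\<lambda>_ e. w (Inr e)" and \<rho> = "\<lambda>l v. source_coord \<alpha> k m (\<gamma> v) l"],
      erule (1) \<gamma>, rule poly_fun.const, rule poly_fun.const,
      erule source_coord_lin_forms[rotated], erule (1) \<gamma>)

text \<open>For the identity the inner vectors agree, \<open>y = x\<close>. Slope \<open>c\<close>
  for \<open>Q\<close> and slope 1 for \<open>T\<close> make the two subspaces transversal when
  \<open>c \<noteq> 1\<close>, and \<open>c \<noteq> 0\<close> keeps \<open>Q\<close> in all
  charts.\<close>

lemma identity_nondegenerate:
  fixes \<gamma> :: "(index, 'a::field) imat"
  assumes inf: "infinite (UNIV :: 'a set)"
    and \<gamma>: "\<And>r s. r \<in> level_indices \<alpha> k m \<Longrightarrow> s \<in> level_indices \<alpha> k m \<Longrightarrow> \<gamma> r s = (if r = s then 1 else 0)"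
  obtains w where "\<not> degenerate \<alpha> k m (source_coord \<alpha> k m \<gamma>) \<gamma>
    (fst (pair_chart k \<epsilon> \<delta> w)) (snd (pair_chart k \<epsilon> \<delta> w))"
proof -
  let ?I = "level_indices \<alpha> k m"
  have "finite {0 :: 'a, 1}" by simp
  from ex_new_if_finite[OF inf this] obtain c :: 'a where c: "c \<noteq> 0" "c \<noteq> 1" by auto
  define w :: "nat \<times> nat + nat \<times> nat \<Rightarrow> 'a" where
    "w = case_sum (\<lambda>(i, j). if i = j then if i \<in> \<epsilon> then - 1 / c else c else 0)
      (\<lambda>(i, j). if i = j then if i \<in> \<delta> then - 1 / 1 else 1 else 0)"
  have Q: "fst (pair_chart k \<epsilon> \<delta> w) = {x \<in> carrier_vec (k + k). \<forall>j<k. x $ (k + j) = c * x $ j}"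
    unfolding pair_chart_def w_def fst_conv sum.case using c(1) by (rule chart_H_diagonal)
  have T: "snd (pair_chart k \<epsilon> \<delta> w) = {x \<in> carrier_vec (k + k). \<forall>j<k. x $ (k + j) = 1 * x $ j}"
    unfolding pair_chart_def w_def snd_conv sum.case by (rule chart_H_diagonal) simp
  have app: "mat_app ?I \<gamma> X r = X r" "mat_app ?I (\<lambda>r s. \<gamma> s r) X r = X r" if "r \<in> ?I" for X r
  proof -
    have "mat_app ?I \<gamma> X r = (\<Sum>s\<in>?I. if r = s then X s else 0)"
      "mat_app ?I (\<lambda>r s. \<gamma> s r) X r = (\<Sum>s\<in>?I. if r = s then X s else 0)"
      unfolding mat_app_def by (intro sum.cong refl; simp add: \<gamma> that)+
    then show "mat_app ?I \<gamma> X r = X r" "mat_app ?I (\<lambda>r s. \<gamma> s r) X r = X r" using that by simp_all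
  qed
  have "z f = 0" if sol: "is_sol \<alpha> k m \<gamma> (fst (pair_chart k \<epsilon> \<delta> w)) (snd (pair_chart k \<epsilon> \<delta> w)) z"
    and coord: "\<forall>l<\<alpha> + \<alpha>. source_coord \<alpha> k m \<gamma> l z = 0" and f: "f \<in> sol_indices \<alpha> k m" for z f
  proof -
    have u: "z (Inl (Inl a)) = 0" if "a < \<alpha>" for a
      using coord[rule_format, of a] that by (simp add: source_coord_def sol_outer_def outer_def)
    have v: "z (Inr (Inl a)) = 0" if "a < \<alpha>" for a
      using coord[rule_format, of "\<alpha> + a"] that by (simp add: source_coord_def sol_outer_def outer_def app)
    have xy: "z (Inl (Inr (j, i))) = 0 \<and> z (Inr (Inr (j, i))) = 0" if ji: "j < k" "i < m" for j i
    proof -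
      have "z (Inr (Inr (j, i))) = c * z (Inl (Inr (j, i)))" "z (Inr (Inr (j, i))) = z (Inl (Inr (j, i)))"
        using sol ji unfolding is_sol_def Q T by (auto simp: fiber_def app)
      then have "(c - 1) * z (Inl (Inr (j, i))) = 0" by (simp add: algebra_simps)
      then show ?thesis using c(2) \<open>z (Inr (Inr (j, i))) = z (Inl (Inr (j, i)))\<close> by simp
    qed
    from f show ?thesis
      using u v xy unfolding level_indices_def by auto
  qed
  then show thesis using that[of w] unfolding degenerate_def by blast
qed

section \<open>The characteristic function of a double coset\<close>

lemma bij_betw_position: "bij_betw (position \<alpha> m) (level_indices \<alpha> k m) {..<\<alpha> + k * m}"
proof (rule bij_betwI[where g = "\<lambda>n. if n < \<alpha> then Inl n else Inr ((n - \<alpha>) div m, (n - \<alpha>) mod m)"])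
  show "position \<alpha> m \<in> level_indices \<alpha> k m \<rightarrow> {..<\<alpha> + k * m}"
  proof
    fix r assume r: "r \<in> level_indices \<alpha> k m"
    show "position \<alpha> m r \<in> {..<\<alpha> + k * m}"
    proof (cases r)
      case (Inr ji)
      obtain j i where ji: "ji = (j, i)" by (cases ji)
      have "Suc j \<le> k" "i < m" using r by (simp_all add: Inr ji)
      then have "j * m + i < Suc j * m" "Suc j * m \<le> k * m" by (simp_all only: mult_le_mono1) simp
      then show ?thesis by (simp add: Inr ji position_def)
    qed (use r in \<open>simp add: position_def\<close>)
  qed
  show "(\<lambda>n. if n < \<alpha> then Inl n else Inr ((n - \<alpha>) div m, (n - \<alpha>) mod m))
      \<in> {..<\<alpha> + k * m} \<rightarrow> level_indices \<alpha> k m"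
  proof
    fix n assume n: "n \<in> {..<\<alpha> + k * m}"
    show "(if n < \<alpha> then Inl n else Inr ((n - \<alpha>) div m, (n - \<alpha>) mod m)) \<in> level_indices \<alpha> k m"
    proof (cases "n < \<alpha>")
      case False
      then have "n - \<alpha> < k * m" using n by simp
      \<comment> \<open>For \<open>m = 0\<close> no position lies beyond \<alpha>, so there is no
        division by zero.\<close>
      then have "m > 0" "(n - \<alpha>) div m < k" by (auto simp: less_mult_imp_div_less intro!: Nat.gr0I)
      then show ?thesis using False by simp
    qed simp
  qed
qed (auto simp: position_def split: sum.splits)

lemma sum_position: "(\<Sum>r\<in>level_indices \<alpha> k m. F (position \<alpha> m r)) = (\<Sum>n<\<alpha> + k * m. F n)"
  by (rule sum.reindex_bij_betw[OF bij_betw_position])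

lemma position_less: "r \<in> level_indices \<alpha> k m \<Longrightarrow> position \<alpha> m r < \<alpha> + k * m"
  using bij_betwE[OF bij_betw_position] by blast

lemma position_eq_iff:
  "r \<in> level_indices \<alpha> k m \<Longrightarrow> s \<in> level_indices \<alpha> k m \<Longrightarrow> position \<alpha> m r = position \<alpha> m s \<longleftrightarrow> r = s"
  using bij_betw_position[of \<alpha> m k] by (auto simp: bij_betw_def inj_on_def)

lemma position_surj:
  assumes "n < \<alpha> + k * m"
  obtains r where "r \<in> level_indices \<alpha> k m" "position \<alpha> m r = n"
proof -
  have "n \<in> position \<alpha> m ` level_indices \<alpha> k m"
    using bij_betw_imp_surj_on[OF bij_betw_position[of \<alpha> m k]] assms by simp
  then show thesis using that by blast
qed

text \<open>Agrees with \<open>level_embed\<close> on \<open>level_indices\<close> and is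
  meaningless elsewhere. Free of case distinctions, it shows directly that its entries are entries
  of \<open>g\<close>.\<close>

definition coord_mat :: "nat \<Rightarrow> nat \<Rightarrow> 'a mat \<Rightarrow> (index, 'a) imat"
  where "coord_mat \<alpha> m g r s = g $$ (position \<alpha> m r, position \<alpha> m s)"

definition coord_vec :: "nat \<Rightarrow> nat \<Rightarrow> nat \<Rightarrow> (index \<Rightarrow> 'a) \<Rightarrow> 'a vec"
  where "coord_vec \<alpha> k m X =
    vec \<alpha> (\<lambda>a. X (Inl a)) @\<^sub>v vec (k * m) (\<lambda>d. X (Inr (d div m, d mod m)))"

lemma coord_vec_carrier: "coord_vec \<alpha> k m X \<in> carrier_vec (\<alpha> + k * m)"
  by (simp add: coord_vec_def)

lemma coord_vec_position:
  assumes "r \<in> level_indices \<alpha> k m"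
  shows "coord_vec \<alpha> k m X $ position \<alpha> m r = X r"
  using assms position_less[OF assms]
  by (cases r) (auto simp: coord_vec_def position_def)

lemma coord_vec_cong:
  assumes "\<And>r. r \<in> level_indices \<alpha> k m \<Longrightarrow> X r = Y r"
  shows "coord_vec \<alpha> k m X = coord_vec \<alpha> k m Y"
proof (rule eq_vecI)
  fix n assume "n < dim_vec (coord_vec \<alpha> k m Y)"
  then have "n < \<alpha> + k * m" by (simp add: coord_vec_def)
  then obtain r where r: "r \<in> level_indices \<alpha> k m" "position \<alpha> m r = n" by (rule position_surj)
  then show "coord_vec \<alpha> k m X $ n = coord_vec \<alpha> k m Y $ n"
    using assms[OF r(1)] coord_vec_position[OF r(1)] by metis
qed (simp add: coord_vec_def)

lemma mult_coord_vec:
  fixes g :: "'a::field mat"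
  assumes g: "g \<in> carrier_mat (\<alpha> + k * m) (\<alpha> + k * m)"
  shows "g *\<^sub>v coord_vec \<alpha> k m X = coord_vec \<alpha> k m (mat_app (level_indices \<alpha> k m) (coord_mat \<alpha> m g) X)"
proof (rule eq_vecI)
  fix n assume "n < dim_vec (coord_vec \<alpha> k m (mat_app (level_indices \<alpha> k m) (coord_mat \<alpha> m g) X))"
  then have n: "n < \<alpha> + k * m" by (simp add: coord_vec_def)
  then obtain r where r: "r \<in> level_indices \<alpha> k m" "position \<alpha> m r = n" by (rule position_surj)
  have "(g *\<^sub>v coord_vec \<alpha> k m X) $ n = (\<Sum>l<\<alpha> + k * m. g $$ (n, l) * coord_vec \<alpha> k m X $ l)"
    using g n carrier_vecD[OF coord_vec_carrier, of \<alpha> k m X]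
    by (simp add: scalar_prod_def atLeast0LessThan)
  also have "\<dots> = (\<Sum>s\<in>level_indices \<alpha> k m. g $$ (n, position \<alpha> m s) * coord_vec \<alpha> k m X $ position \<alpha> m s)"
    by (rule sum_position[symmetric])
  also have "\<dots> = mat_app (level_indices \<alpha> k m) (coord_mat \<alpha> m g) X r"
    unfolding mat_app_def coord_mat_def r(2)
    by (intro sum.cong refl) (simp add: coord_vec_position)
  finally show "(g *\<^sub>v coord_vec \<alpha> k m X) $ n
      = coord_vec \<alpha> k m (mat_app (level_indices \<alpha> k m) (coord_mat \<alpha> m g) X) $ n"
    using coord_vec_position[OF r(1)] r(2) by metis
qed (use g in \<open>simp add: coord_vec_def\<close>)

lemma append_eq_coord_vec:
  fixes u x :: "'a vec"
  assumes "u \<in> carrier_vec \<alpha>" "x \<in> carrier_vec (k * m)"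
  obtains X where "u @\<^sub>v x = coord_vec \<alpha> k m X" "u = vec \<alpha> (\<lambda>a. X (Inl a))"
    "\<forall>j<k. \<forall>i<m. x $ (j * m + i) = X (Inr (j, i))"
proof -
  define X where "X = case_sum (\<lambda>a. u $ a) (\<lambda>(j, i). x $ (j * m + i))"
  have x: "x = vec (k * m) (\<lambda>d. X (Inr (d div m, d mod m)))" and u: "u = vec \<alpha> (\<lambda>a. X (Inl a))"
    using assms by (auto simp: X_def)
  show thesis
  proof (rule that[of X])
    show "u @\<^sub>v x = coord_vec \<alpha> k m X"
      unfolding coord_vec_def by (rule arg_cong2[where f = "(@\<^sub>v)", OF u x])
    show "u = vec \<alpha> (\<lambda>a. X (Inl a))" by (rule u)
  qed (simp add: X_def)
qed

lemma mat_app_cong: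
  assumes "\<And>r s. r \<in> I \<Longrightarrow> s \<in> I \<Longrightarrow> \<gamma> r s = \<gamma>' r s" "\<And>r. r \<in> I \<Longrightarrow> X r = Y r" "r \<in> I"
  shows "mat_app I \<gamma> X r = mat_app I \<gamma>' Y r"
  unfolding mat_app_def using assms by (intro sum.cong) auto

lemma fiber_cong:
  assumes "\<And>r. r \<in> level_indices \<alpha> k m \<Longrightarrow> Xp r = Yp r" "\<And>r. r \<in> level_indices \<alpha> k m \<Longrightarrow> Xm r = Ym r" "i < m"
  shows "fiber k i Xp Xm = fiber k i Yp Ym"
  unfolding fiber_def using assms by (intro arg_cong2[of _ _ _ _ "(@\<^sub>v)"] eq_vecI) auto

lemma outer_cong:
  assumes "\<And>r. r \<in> level_indices \<alpha> k m \<Longrightarrow> Xp r = Xp' r" "\<And>r. r \<in> level_indices \<alpha> k m \<Longrightarrow> Xm r = Xm' r"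
    "\<And>r. r \<in> level_indices \<alpha> k m \<Longrightarrow> Yp r = Yp' r" "\<And>r. r \<in> level_indices \<alpha> k m \<Longrightarrow> Ym r = Ym' r"
  shows "outer \<alpha> Xp Xm Yp Ym = outer \<alpha> Xp' Xm' Yp' Ym'"
  unfolding outer_def using assms by (intro arg_cong2[of _ _ _ _ "(@\<^sub>v)"] eq_vecI) auto

lemma coord_vec_eqD:
  assumes "coord_vec \<alpha> k m X = coord_vec \<alpha> k m Y" "r \<in> level_indices \<alpha> k m"
  shows "X r = Y r"
  using coord_vec_position[OF assms(2)] assms(1) by metis

lemma tensor_coord:
  assumes "xp \<in> carrier_vec (k * m)" "xm \<in> carrier_vec (k * m)"
    "\<forall>j<k. \<forall>i<m. xp $ (j * m + i) = Xp (Inr (j, i))" "\<forall>j<k. \<forall>i<m. xm $ (j * m + i) = Xm (Inr (j, i))"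
  shows "(xp, xm) \<in> tensor k m Q \<longleftrightarrow> (\<forall>i<m. fiber k i Xp Xm \<in> Q)"
proof -
  have "vec k (\<lambda>j. xp $ (j * m + i)) @\<^sub>v vec k (\<lambda>j. xm $ (j * m + i)) = fiber k i Xp Xm" if "i < m" for i
    unfolding fiber_def using assms(3,4) that by (intro arg_cong2[of _ _ _ _ "(@\<^sub>v)"] eq_vecI) auto
  then show ?thesis using assms(1,2) by (simp add: tensor_def)
qed

lemma GL_inverse:
  fixes g :: "'a::field mat"
  assumes "g \<in> GL n"
  obtains h where "h \<in> carrier_mat n n" "g * h = 1\<^sub>m n" "h * g = 1\<^sub>m n"
proof -
  have g: "g \<in> carrier_mat n n" "invertible_mat g" using assms by (auto simp: GL_def)
  then obtain b where b: "inverts_mat g b" "inverts_mat b g" unfolding invertible_mat_def by blast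
  have gb: "g * b = 1\<^sub>m n" using b(1) g unfolding inverts_mat_def by simp
  then have "dim_col b = n" by (metis index_mult_mat(3) index_one_mat(3))
  moreover have "dim_row b = n"
    using b(2) g unfolding inverts_mat_def by (metis carrier_matD(2) index_mult_mat(3) index_one_mat(3))
  ultimately have bc: "b \<in> carrier_mat n n" by auto
  then have "b * g = 1\<^sub>m n" using b(2) unfolding inverts_mat_def by simp
  with bc gb show thesis by (rule that)
qed

text \<open>\<open>mat_inverse\<close> yields \<open>None\<close> only for non-units, and the
  transpose of the inverse of \<open>g\<close> shows that \<open>g\<^sup>T\<close> is a
  unit.\<close>

lemma mat_inverse_transpose:
  fixes g :: "'a::field mat"
  assumes "g \<in> GL n"
  defines "h \<equiv> the (mat_inverse g\<^sup>T)"
  shows "h \<in> carrier_mat n n" "g\<^sup>T * h = 1\<^sub>m n" "h * g\<^sup>T = 1\<^sub>m n"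
proof -
  have g: "g \<in> carrier_mat n n" using assms(1) by (simp add: GL_def)
  obtain b where bc: "b \<in> carrier_mat n n" and gb: "g * b = 1\<^sub>m n" and bg: "b * g = 1\<^sub>m n"
    using assms(1) by (rule GL_inverse)
  have gT: "g\<^sup>T \<in> carrier_mat n n" and bT: "b\<^sup>T \<in> carrier_mat n n" using g bc by auto
  have "g\<^sup>T * b\<^sup>T = 1\<^sub>m n" unfolding transpose_mult[OF bc g, symmetric] bg by simp
  moreover have "b\<^sup>T * g\<^sup>T = 1\<^sub>m n" unfolding transpose_mult[OF g bc, symmetric] gb by simp
  ultimately have "g\<^sup>T \<in> Units (ring_mat TYPE('a) n ())"
    using gT bT unfolding Units_def ring_mat_def by auto
  then have "mat_inverse g\<^sup>T = Some h"
    using mat_inverse(1)[OF gT, where b = "()"] unfolding h_def by (cases "mat_inverse g\<^sup>T") auto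
  from mat_inverse(2)[OF gT this] show "h \<in> carrier_mat n n" "g\<^sup>T * h = 1\<^sub>m n" "h * g\<^sup>T = 1\<^sub>m n" by auto
qed

lemma chi_matrixI:
  fixes up um vp vm :: "'a::field vec"
  assumes "(xp, xm) \<in> tensor k m Q" "(yp, ym) \<in> tensor k m T"
    and "vp @\<^sub>v yp = g *\<^sub>v (up @\<^sub>v xp)" "vm @\<^sub>v ym = the (mat_inverse g\<^sup>T) *\<^sub>v (um @\<^sub>v xm)"
    and "up \<in> carrier_vec \<alpha>" "um \<in> carrier_vec \<alpha>" "vp \<in> carrier_vec \<alpha>" "vm \<in> carrier_vec \<alpha>"
  shows "(up @\<^sub>v um) @\<^sub>v (vp @\<^sub>v vm) \<in> chi_matrix \<alpha> k m g Q T"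
  unfolding chi_matrix_def using assms by blast

text \<open>The inverse transpose is moved to the other side of its equation:
  \<open>(v\<^sup>-, y\<^sup>-)\<close> is computed from \<open>(u\<^sup>-, x\<^sup>-)\<close> by it
  exactly when \<open>(u\<^sup>-, x\<^sup>-)\<close> is computed from
  \<open>(v\<^sup>-, y\<^sup>-)\<close> by the transpose. The rest is translation between
  concatenated vectors and functions of indices.\<close>

lemma chi_matrix_eq_chi_coord:
  fixes g :: "'a::field mat"
  assumes GL: "g \<in> GL (\<alpha> + k * m)"
  shows "chi_matrix \<alpha> k m g Q T = chi_coord \<alpha> k m (coord_mat \<alpha> m g) Q T"
proof -
  let ?n = "\<alpha> + k * m" and ?I = "level_indices \<alpha> k m" and ?\<gamma> = "coord_mat \<alpha> m g"
  let ?h = "the (mat_inverse g\<^sup>T)"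
  have g: "g \<in> carrier_mat ?n ?n" using GL by (simp add: GL_def)
  note h = mat_inverse_transpose[OF GL]
  have gT: "g\<^sup>T \<in> carrier_mat ?n ?n" using g by simp
  have inv: "y = ?h *\<^sub>v x \<longleftrightarrow> x = g\<^sup>T *\<^sub>v y" if "x \<in> carrier_vec ?n" "y \<in> carrier_vec ?n" for x y
  proof
    assume "y = ?h *\<^sub>v x"
    then have "g\<^sup>T *\<^sub>v y = (g\<^sup>T * ?h) *\<^sub>v x" using assoc_mult_mat_vec[OF gT h(1) that(1)] by simp
    then show "x = g\<^sup>T *\<^sub>v y" using h(2) that by simp
  next
    assume "x = g\<^sup>T *\<^sub>v y"
    then have "?h *\<^sub>v x = (?h * g\<^sup>T) *\<^sub>v y" using assoc_mult_mat_vec[OF h(1) gT that(2)] by simp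
    then show "y = ?h *\<^sub>v x" using h(3) that by simp
  qed
  have tr: "mat_app ?I (coord_mat \<alpha> m g\<^sup>T) Y r = mat_app ?I (\<lambda>r s. ?\<gamma> s r) Y r" if "r \<in> ?I" for Y r
    using that g by (intro mat_app_cong) (auto simp: coord_mat_def position_less)
  have app: "g *\<^sub>v coord_vec \<alpha> k m X = coord_vec \<alpha> k m (mat_app ?I ?\<gamma> X)" for X
    using g by (rule mult_coord_vec)
  have app_tr: "g\<^sup>T *\<^sub>v coord_vec \<alpha> k m Y = coord_vec \<alpha> k m (mat_app ?I (\<lambda>r s. ?\<gamma> s r) Y)" for Y
    unfolding mult_coord_vec[OF gT] using tr by (rule coord_vec_cong)
  show ?thesis
  proof (intro equalityI subsetI)
    fix w assume "w \<in> chi_matrix \<alpha> k m g Q T"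
    then obtain up um vp vm xp xm yp ym where w: "w = (up @\<^sub>v um) @\<^sub>v (vp @\<^sub>v vm)"
      and c: "up \<in> carrier_vec \<alpha>" "um \<in> carrier_vec \<alpha>" "vp \<in> carrier_vec \<alpha>" "vm \<in> carrier_vec \<alpha>"
      and t: "(xp, xm) \<in> tensor k m Q" "(yp, ym) \<in> tensor k m T"
      and eq: "vp @\<^sub>v yp = g *\<^sub>v (up @\<^sub>v xp)" "vm @\<^sub>v ym = ?h *\<^sub>v (um @\<^sub>v xm)"
      unfolding chi_matrix_def by blast
    have c': "xp \<in> carrier_vec (k * m)" "xm \<in> carrier_vec (k * m)"
      "yp \<in> carrier_vec (k * m)" "ym \<in> carrier_vec (k * m)"
      using t by (auto simp: tensor_def)
    obtain Xp where Xp: "up @\<^sub>v xp = coord_vec \<alpha> k m Xp" "up = vec \<alpha> (\<lambda>a. Xp (Inl a))"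
      "\<forall>j<k. \<forall>i<m. xp $ (j * m + i) = Xp (Inr (j, i))" using c(1) c'(1) by (rule append_eq_coord_vec)
    obtain Xm where Xm: "um @\<^sub>v xm = coord_vec \<alpha> k m Xm" "um = vec \<alpha> (\<lambda>a. Xm (Inl a))"
      "\<forall>j<k. \<forall>i<m. xm $ (j * m + i) = Xm (Inr (j, i))" using c(2) c'(2) by (rule append_eq_coord_vec)
    obtain Yp where Yp: "vp @\<^sub>v yp = coord_vec \<alpha> k m Yp" "vp = vec \<alpha> (\<lambda>a. Yp (Inl a))"
      "\<forall>j<k. \<forall>i<m. yp $ (j * m + i) = Yp (Inr (j, i))" using c(3) c'(3) by (rule append_eq_coord_vec)
    obtain Ym where Ym: "vm @\<^sub>v ym = coord_vec \<alpha> k m Ym" "vm = vec \<alpha> (\<lambda>a. Ym (Inl a))"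
      "\<forall>j<k. \<forall>i<m. ym $ (j * m + i) = Ym (Inr (j, i))" using c(4) c'(4) by (rule append_eq_coord_vec)
    have "coord_vec \<alpha> k m Yp = coord_vec \<alpha> k m (mat_app ?I ?\<gamma> Xp)"
      using eq(1) unfolding Xp(1) Yp(1) app .
    then have Yp': "Yp r = mat_app ?I ?\<gamma> Xp r" if "r \<in> ?I" for r using that by (rule coord_vec_eqD)
    have "coord_vec \<alpha> k m Xm = coord_vec \<alpha> k m (mat_app ?I (\<lambda>r s. ?\<gamma> s r) Ym)"
      using eq(2) unfolding Xm(1) Ym(1) inv[OF coord_vec_carrier coord_vec_carrier] app_tr .
    then have Xm': "Xm r = mat_app ?I (\<lambda>r s. ?\<gamma> s r) Ym r" if "r \<in> ?I" for r
      using that by (rule coord_vec_eqD)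
    have "w = outer \<alpha> Xp Xm Yp Ym" unfolding w Xp(2) Xm(2) Yp(2) Ym(2) outer_def by simp
    also have "\<dots> = outer \<alpha> Xp (mat_app ?I (\<lambda>r s. ?\<gamma> s r) Ym) (mat_app ?I ?\<gamma> Xp) Ym"
      by (rule outer_cong[where k = k and m = m]) (simp_all add: Yp' Xm')
    also have "\<dots> \<in> chi_coord \<alpha> k m ?\<gamma> Q T"
    proof (rule chi_coordI)
      fix i assume i: "i < m"
      have "fiber k i Xp Xm \<in> Q" using t(1) i tensor_coord[OF c'(1,2) Xp(3) Xm(3)] by blast
      then show "fiber k i Xp (mat_app ?I (\<lambda>r s. ?\<gamma> s r) Ym) \<in> Q"
        using fiber_cong[where Xp = Xp and Yp = Xp, OF refl Xm' i] by simp
      have "fiber k i Yp Ym \<in> T" using t(2) i tensor_coord[OF c'(3,4) Yp(3) Ym(3)] by blast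
      then show "fiber k i (mat_app ?I ?\<gamma> Xp) Ym \<in> T"
        using fiber_cong[where Xm = Ym and Ym = Ym, OF Yp' refl i] by simp
    qed
    finally show "w \<in> chi_coord \<alpha> k m ?\<gamma> Q T" .
  next
    fix w assume "w \<in> chi_coord \<alpha> k m ?\<gamma> Q T"
    then obtain Xp Ym where w: "w = outer \<alpha> Xp (mat_app ?I (\<lambda>r s. ?\<gamma> s r) Ym) (mat_app ?I ?\<gamma> Xp) Ym"
      and fQ: "\<forall>i<m. fiber k i Xp (mat_app ?I (\<lambda>r s. ?\<gamma> s r) Ym) \<in> Q"
      and fT: "\<forall>i<m. fiber k i (mat_app ?I ?\<gamma> Xp) Ym \<in> T"
      by (rule chi_coordE)
    define Xm where "Xm = mat_app ?I (\<lambda>r s. ?\<gamma> s r) Ym"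
    define Yp where "Yp = mat_app ?I ?\<gamma> Xp"
    let ?u = "\<lambda>X. vec \<alpha> (\<lambda>a. X (Inl a) :: 'a)"
    let ?x = "\<lambda>X. vec (k * m) (\<lambda>d. X (Inr (d div m, d mod m)) :: 'a)"
    have ux: "?u X @\<^sub>v ?x X = coord_vec \<alpha> k m X" for X by (simp add: coord_vec_def)
    have xX: "\<forall>j<k. \<forall>i<m. ?x X $ (j * m + i) = X (Inr (j, i))" for X
    proof (intro allI impI)
      fix j i assume ji: "j < k" "i < m"
      then have "Inr (j, i) \<in> ?I" by simp
      from position_less[OF this] have "j * m + i < k * m" by (simp add: position_def)
      then show "?x X $ (j * m + i) = X (Inr (j, i))" using ji by simp
    qed
    have "(?x Xp, ?x Xm) \<in> tensor k m Q"
      using fQ tensor_coord[OF _ _ xX[of Xp] xX[of Xm], of Q] by (simp add: Xm_def)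
    moreover have "(?x Yp, ?x Ym) \<in> tensor k m T"
      using fT tensor_coord[OF _ _ xX[of Yp] xX[of Ym], of T] by (simp add: Yp_def)
    moreover have "?u Yp @\<^sub>v ?x Yp = g *\<^sub>v (?u Xp @\<^sub>v ?x Xp)"
      unfolding ux app by (simp add: Yp_def)
    moreover have "?u Ym @\<^sub>v ?x Ym = ?h *\<^sub>v (?u Xm @\<^sub>v ?x Xm)"
      unfolding ux inv[OF coord_vec_carrier coord_vec_carrier] app_tr by (simp add: Xm_def)
    ultimately show "w \<in> chi_matrix \<alpha> k m g Q T"
      unfolding w outer_def Xm_def[symmetric] Yp_def[symmetric]
      by (intro chi_matrixI vec_carrier)
  qed
qed

section \<open>Finitary matrices acting on finitely supported vectors\<close>

definition fin_supp :: "'i set \<Rightarrow> ('i, 'a::field) imat \<Rightarrow> bool"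
  where "fin_supp S g \<longleftrightarrow> finite S \<and> (\<forall>r s. r \<notin> S \<or> s \<notin> S \<longrightarrow> g r s = imat_one r s)"

lemma fin_supp_mono: "fin_supp S g \<Longrightarrow> S \<subseteq> S' \<Longrightarrow> finite S' \<Longrightarrow> fin_supp S' g"
  unfolding fin_supp_def by blast

text \<open>\<open>S\<close> collects the rows and columns of the exceptional entries. Unlike a set
  of entries, such an index set survives products and transposition and can be enlarged at
  will.\<close>

lemma finitary_iff: "finitary I g \<longleftrightarrow> (\<exists>S\<subseteq>I. fin_supp S g)"
proof
  assume g: "finitary I g"
  let ?D = "{(r, s). g r s \<noteq> imat_one r s}"
  have "fin_supp (fst ` ?D \<union> snd ` ?D) g"
    using g unfolding fin_supp_def finitary_def by force
  moreover have "r \<in> I \<and> s \<in> I" if "(r, s) \<in> ?D" for r s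
    using g that unfolding finitary_def by blast
  then have "fst ` ?D \<union> snd ` ?D \<subseteq> I" by auto
  ultimately show "\<exists>S\<subseteq>I. fin_supp S g" by blast
next
  assume "\<exists>S\<subseteq>I. fin_supp S g"
  then obtain S where S: "S \<subseteq> I" "fin_supp S g" by blast
  have "{(r, s). g r s \<noteq> imat_one r s} \<subseteq> S \<times> S" using S(2) unfolding fin_supp_def by blast
  then have "finite {(r, s). g r s \<noteq> imat_one r s}"
    by (rule finite_subset) (use S(2) in \<open>simp add: fin_supp_def\<close>)
  then show "finitary I g" using S unfolding finitary_def fin_supp_def by blast
qed

lemma fin_supp_zero: "fin_supp S g \<Longrightarrow> r \<notin> S \<or> s \<notin> S \<Longrightarrow> r \<noteq> s \<Longrightarrow> g r s = 0"
  by (auto simp: fin_supp_def imat_one_def)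

lemma Sum_any_eq_sum:
  assumes "finite B" "\<And>s. s \<notin> B \<Longrightarrow> F s = 0"
  shows "Sum_any F = sum F B"
  using assms by (intro Sum_any.expand_superset) auto

lemma imat_mult_eq_sum:
  assumes "fin_supp S g" "fin_supp S h" "S \<subseteq> B" "finite B" "t \<in> B"
  shows "imat_mult g h r t = (\<Sum>s\<in>B. g r s * h s t)"
  unfolding imat_mult_def
proof (rule Sum_any_eq_sum)
  show "g r s * h s t = 0" if "s \<notin> B" for s
  proof -
    \<comment> \<open>As \<open>t\<close> lies in \<open>B\<close> and \<open>s\<close> does not,
      the entry is off the diagonal and outside \<open>S\<close>.\<close>
    have "h s t = 0" using assms that by (intro fin_supp_zero[OF assms(2)]) auto
    then show ?thesis by simp
  qed
qed (rule assms)

lemma imat_mult_outside: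
  assumes g: "fin_supp S g" and h: "fin_supp S h" and "r \<notin> S \<or> t \<notin> S"
  shows "imat_mult g h r t = imat_one r t"
proof -
  let ?B = "insert r (insert t S)"
  have B: "finite ?B" using g by (simp add: fin_supp_def)
  have "imat_mult g h r t = (\<Sum>s\<in>?B. g r s * h s t)"
    using B by (intro imat_mult_eq_sum[OF g h]) auto
  also have "\<dots> = imat_one r t"
  proof (cases "r \<in> S")
    case False
    then have "g r s = imat_one r s" for s using g by (auto simp: fin_supp_def)
    then have "(\<Sum>s\<in>?B. g r s * h s t) = (\<Sum>s\<in>?B. if s = r then h s t else 0)"
      by (intro sum.cong) (auto simp: imat_one_def)
    also have "\<dots> = h r t" using B by simp
    finally show ?thesis using h False by (simp add: fin_supp_def)
  next
    case True
    then have t: "t \<notin> S" using assms(3) by blast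
    then have "h s t = imat_one s t" for s using h by (auto simp: fin_supp_def)
    then have "(\<Sum>s\<in>?B. g r s * h s t) = (\<Sum>s\<in>?B. if s = t then g r s else 0)"
      by (intro sum.cong) (auto simp: imat_one_def)
    also have "\<dots> = g r t" using B by simp
    finally show ?thesis using g t by (simp add: fin_supp_def)
  qed
  finally show ?thesis .
qed

lemma fin_supp_imat_mult: "fin_supp S g \<Longrightarrow> fin_supp S h \<Longrightarrow> fin_supp S (imat_mult g h)"
  using imat_mult_outside[of S g h] by (simp add: fin_supp_def)

abbreviation (input) imat_transpose :: "('i, 'a) imat \<Rightarrow> ('i, 'a) imat"
  where "imat_transpose g \<equiv> (\<lambda>r s. g s r)"

lemma imat_one_commute: "imat_one r s = imat_one s r"
  unfolding imat_one_def by (cases "r = s") simp_all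

lemma fin_supp_transpose:
  assumes "fin_supp S g"
  shows "fin_supp S (imat_transpose g)"
  unfolding fin_supp_def
proof (intro conjI allI impI)
  show "finite S" using assms by (simp add: fin_supp_def)
  fix r s assume "r \<notin> S \<or> s \<notin> S"
  then have "g s r = imat_one s r" using assms unfolding fin_supp_def by blast
  also have "\<dots> = imat_one r s" by (rule imat_one_commute)
  finally show "g s r = imat_one r s" .
qed

lemma imat_mult_transpose:
  "imat_transpose (imat_mult g h) = imat_mult (imat_transpose h) (imat_transpose g)"
  by (intro ext) (simp add: imat_mult_def mult.commute)

definition imat_app :: "('i, 'a::field) imat \<Rightarrow> ('i \<Rightarrow> 'a) \<Rightarrow> 'i \<Rightarrow> 'a"
  where "imat_app g X r = Sum_any (\<lambda>s. g r s * X s)"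

definition supported :: "'i set \<Rightarrow> ('i \<Rightarrow> 'a::field) \<Rightarrow> bool"
  where "supported B X \<longleftrightarrow> finite B \<and> (\<forall>r. r \<notin> B \<longrightarrow> X r = 0)"

lemma imat_app_eq_sum:
  assumes "supported B X"
  shows "imat_app g X r = (\<Sum>s\<in>B. g r s * X s)"
  unfolding imat_app_def using assms by (intro Sum_any_eq_sum) (auto simp: supported_def)

lemma imat_app_outside:
  assumes g: "fin_supp S g" and X: "supported B X" and r: "r \<notin> S"
  shows "imat_app g X r = X r"
proof -
  have "supported (insert r B) X" using X by (auto simp: supported_def)
  then have "imat_app g X r = (\<Sum>s\<in>insert r B. g r s * X s)" by (rule imat_app_eq_sum)
  also have "\<dots> = (\<Sum>s\<in>insert r B. if s = r then X s else 0)"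
    using g r by (intro sum.cong) (auto simp: fin_supp_def imat_one_def)
  also have "\<dots> = X r" using X by (simp add: supported_def)
  finally show ?thesis .
qed

lemma supported_imat_app:
  assumes "fin_supp S g" "supported B X" "S \<subseteq> B"
  shows "supported B (imat_app g X)"
  unfolding supported_def
proof (intro conjI allI impI)
  show "finite B" using assms(2) by (simp add: supported_def)
  fix r assume "r \<notin> B"
  then have "imat_app g X r = X r" using assms(3) by (intro imat_app_outside[OF assms(1,2)]) auto
  then show "imat_app g X r = 0" using \<open>r \<notin> B\<close> assms(2) by (simp add: supported_def)
qed

lemma imat_app_mult:
  assumes g: "fin_supp S g" and h: "fin_supp S h" and X: "supported B X" and SB: "S \<subseteq> B"
  shows "imat_app (imat_mult g h) X = imat_app g (imat_app h X)"
proof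
  fix r
  have B: "finite B" using X by (simp add: supported_def)
  have "imat_app (imat_mult g h) X r = (\<Sum>t\<in>B. \<Sum>s\<in>B. g r s * h s t * X t)"
    unfolding imat_app_eq_sum[OF X] using B
    by (intro sum.cong) (simp_all add: imat_mult_eq_sum[OF g h SB] sum_distrib_right)
  also have "\<dots> = (\<Sum>s\<in>B. \<Sum>t\<in>B. g r s * h s t * X t)" by (rule sum.swap)
  also have "\<dots> = imat_app g (imat_app h X) r"
    unfolding imat_app_eq_sum[OF supported_imat_app[OF h X SB]] imat_app_eq_sum[OF X]
    by (simp add: sum_distrib_left mult.assoc)
  finally show "imat_app (imat_mult g h) X r = imat_app g (imat_app h X) r" .
qed

lemma imat_app_one: "imat_app imat_one X = X"
proof
  fix r
  have "imat_app imat_one X r = Sum_any (\<lambda>s. if s = r then X s else 0)"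
    unfolding imat_app_def by (intro arg_cong[of _ _ Sum_any]) (auto simp: imat_one_def)
  also have "\<dots> = X r" by (subst Sum_any_eq_sum[of "{r}"]) auto
  finally show "imat_app imat_one X r = X r" .
qed

lemma imat_mult_one: "imat_mult imat_one g = g" "imat_mult g imat_one = g"
proof -
  have "imat_mult imat_one g r t = g r t" for r t
    unfolding imat_mult_def
    by (subst Sum_any_eq_sum[of "{r}"]) (auto simp: imat_one_def)
  moreover have "imat_mult g imat_one r t = g r t" for r t
    unfolding imat_mult_def
    by (subst Sum_any_eq_sum[of "{t}"]) (auto simp: imat_one_def)
  ultimately show "imat_mult imat_one g = g" "imat_mult g imat_one = g" by blast+
qed

text \<open>The relation without a level: vectors have finite support instead of fixed length, and
  the fiber condition ranges over all \<open>i\<close>. On this form elements of K act no matter how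
  many coordinates they involve.\<close>

definition chi_inf ::
    "nat \<Rightarrow> nat \<Rightarrow> (index, 'a::field) imat \<Rightarrow> 'a vec set \<Rightarrow> 'a vec set \<Rightarrow> 'a vec set"
  where "chi_inf \<alpha> k g Q T =
    {outer \<alpha> Xp Xm Yp Ym | Xp Xm Yp Ym.
       (\<exists>B. supported B Xp) \<and> (\<exists>B. supported B Ym) \<and>
       Xm = imat_app (imat_transpose g) Ym \<and> Yp = imat_app g Xp \<and>
       (\<forall>i. fiber k i Xp Xm \<in> Q \<and> fiber k i Yp Ym \<in> T)}"

lemma chi_infI:
  assumes "supported B Xp" "supported B' Ym"
    and "\<And>i. fiber k i Xp (imat_app (imat_transpose g) Ym) \<in> Q"
    and "\<And>i. fiber k i (imat_app g Xp) Ym \<in> T"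
  shows "outer \<alpha> Xp (imat_app (imat_transpose g) Ym) (imat_app g Xp) Ym \<in> chi_inf \<alpha> k g Q T"
  unfolding chi_inf_def using assms by blast

lemma chi_infE:
  assumes "x \<in> chi_inf \<alpha> k g Q T"
  obtains B Xp Ym where "supported B Xp" "supported B Ym"
    "x = outer \<alpha> Xp (imat_app (imat_transpose g) Ym) (imat_app g Xp) Ym"
    "\<forall>i. fiber k i Xp (imat_app (imat_transpose g) Ym) \<in> Q"
    "\<forall>i. fiber k i (imat_app g Xp) Ym \<in> T"
proof -
  obtain Xp Ym B B' where B: "supported B Xp" "supported B' Ym"
    and x: "x = outer \<alpha> Xp (imat_app (imat_transpose g) Ym) (imat_app g Xp) Ym"
    "\<forall>i. fiber k i Xp (imat_app (imat_transpose g) Ym) \<in> Q"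
    "\<forall>i. fiber k i (imat_app g Xp) Ym \<in> T"
    using assms unfolding chi_inf_def by auto
  have "supported (B \<union> B') Xp" "supported (B \<union> B') Ym"
    using B by (auto simp: supported_def)
  then show thesis using x by (rule that)
qed

lemma outer_Inl_cong:
  assumes "\<And>a. Xp (Inl a) = Xp' (Inl a)" "\<And>a. Xm (Inl a) = Xm' (Inl a)"
    "\<And>a. Yp (Inl a) = Yp' (Inl a)" "\<And>a. Ym (Inl a) = Ym' (Inl a)"
  shows "outer \<alpha> Xp Xm Yp Ym = outer \<alpha> Xp' Xm' Yp' Ym'"
  unfolding outer_def using assms by simp

lemma imat_app_block_embed_Inl:
  assumes "supported B X"
  shows "imat_app (block_embed k u) X (Inl a) = X (Inl a)"
proof -
  have "imat_app (block_embed k u) X (Inl a) = imat_app imat_one X (Inl a)"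
    unfolding imat_app_def by (simp add: block_embed_def)
  then show ?thesis by (simp add: imat_app_one)
qed

lemma imat_app_block_embed_Inr:
  assumes "supported B X" "j < k"
  shows "imat_app (block_embed k u) X (Inr (j, i)) = (\<Sum>i'\<in>{i'. Inr (j, i') \<in> B}. u i i' * X (Inr (j, i')))"
    and "finite {i'. Inr (j, i') \<in> B}"
proof -
  let ?N = "{i'. Inr (j, i') \<in> B}"
  have inj: "inj_on (\<lambda>i'. Inr (j, i') :: index) A" for A by (simp add: inj_on_def)
  have fin: "finite B" using assms(1) by (simp add: supported_def)
  have "finite ((\<lambda>i'. Inr (j, i') :: index) ` ?N)" by (rule finite_subset[OF _ fin]) auto
  then show N: "finite ?N" using inj by (rule finite_imageD)
  have "imat_app (block_embed k u) X (Inr (j, i)) = (\<Sum>s\<in>B. block_embed k u (Inr (j, i)) s * X s)"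
    using assms(1) by (rule imat_app_eq_sum)
  also have "\<dots> = (\<Sum>s\<in>(\<lambda>i'. Inr (j, i')) ` ?N. block_embed k u (Inr (j, i)) s * X s)"
  proof (rule sum.mono_neutral_right[OF fin])
    show "\<forall>s\<in>B - (\<lambda>i'. Inr (j, i')) ` ?N. block_embed k u (Inr (j, i)) s * X s = 0"
    proof
      fix s assume s: "s \<in> B - (\<lambda>i'. Inr (j, i')) ` ?N"
      show "block_embed k u (Inr (j, i)) s * X s = 0"
      proof (cases s)
        case (Inr ji)
        obtain j' i' where "ji = (j', i')" by (cases ji)
        then show ?thesis using s Inr by (auto simp: block_embed_def imat_one_def)
      qed (simp add: block_embed_def imat_one_def)
    qed
  qed auto
  also have "\<dots> = (\<Sum>i'\<in>?N. u i i' * X (Inr (j, i')))"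
    using assms(2) by (subst sum.reindex[OF inj]) (simp add: block_embed_def)
  finally show "imat_app (block_embed k u) X (Inr (j, i)) = (\<Sum>i'\<in>?N. u i i' * X (Inr (j, i')))" .
qed

lemma fiber_comb:
  fixes Q :: "'a::field vec set"
  assumes Q: "subspace class_ring Q (module_vec TYPE('a) (k + k))"
    and F: "\<And>i. fiber k i Xp Xm \<in> Q"
  shows "vec k (\<lambda>j. \<Sum>i\<in>N. c i * Xp (Inr (j, i))) @\<^sub>v vec k (\<lambda>j. \<Sum>i\<in>N. c i * Xm (Inr (j, i))) \<in> Q"
proof (induction N rule: infinite_finite_induct)
  case (insert i N)
  have "vec k (\<lambda>j. \<Sum>i\<in>insert i N. c i * Xp (Inr (j, i))) @\<^sub>v vec k (\<lambda>j. \<Sum>i\<in>insert i N. c i * Xm (Inr (j, i)))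
      = (vec k (\<lambda>j. \<Sum>i\<in>N. c i * Xp (Inr (j, i))) @\<^sub>v vec k (\<lambda>j. \<Sum>i\<in>N. c i * Xm (Inr (j, i))))
        + c i \<cdot>\<^sub>v fiber k i Xp Xm"
    using insert.hyps by (intro eq_vecI) (auto simp: fiber_def)
  then show ?case using insert.IH F[of i] Q unfolding subspace_module_vec_iff by simp
next
  case (infinite N)
  have "vec k (\<lambda>j. 0) @\<^sub>v vec k (\<lambda>j. 0) = (0\<^sub>v (k + k) :: 'a vec)" by auto
  then show ?case using infinite Q unfolding subspace_module_vec_iff by simp
next
  case empty
  have "vec k (\<lambda>j. 0) @\<^sub>v vec k (\<lambda>j. 0) = (0\<^sub>v (k + k) :: 'a vec)" by auto
  then show ?case using Q unfolding subspace_module_vec_iff by simp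
qed

text \<open>Acting by the same \<open>u\<close> in all \<open>k\<close> blocks replaces each fiber
  by a linear combination of fibers with coefficients from a row of \<open>u\<close>, and a subspace
  is closed under these.\<close>

lemma fiber_block_embed:
  fixes Q :: "'a::field vec set"
  assumes Q: "subspace class_ring Q (module_vec TYPE('a) (k + k))"
    and F: "\<And>i. fiber k i Xp Xm \<in> Q" and B: "supported B Xp" "supported B Xm"
  shows "fiber k i (imat_app (block_embed k u) Xp) (imat_app (block_embed k u) Xm) \<in> Q"
proof -
  \<comment> \<open>A finite set of fiber numbers that serves all blocks at once; the combination
    must run over the same fibers in every block.\<close>
  define N where "N = (\<Union>j\<in>{..<k}. {i'. Inr (j, i') \<in> B})"
  have "finite N" unfolding N_def using imat_app_block_embed_Inr(2)[OF B(1)] by auto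
  have *: "imat_app (block_embed k u) X (Inr (j, i)) = (\<Sum>i'\<in>N. u i i' * X (Inr (j, i')))"
    if "supported B X" "j < k" for X j
    unfolding imat_app_block_embed_Inr(1)[OF that]
    using that \<open>finite N\<close> by (intro sum.mono_neutral_left) (auto simp: N_def supported_def)
  have "fiber k i (imat_app (block_embed k u) Xp) (imat_app (block_embed k u) Xm) =
      vec k (\<lambda>j. \<Sum>i'\<in>N. u i i' * Xp (Inr (j, i'))) @\<^sub>v vec k (\<lambda>j. \<Sum>i'\<in>N. u i i' * Xm (Inr (j, i')))"
    unfolding fiber_def by (intro arg_cong2[of _ _ _ _ "(@\<^sub>v)"] eq_vecI) (simp_all add: * B)
  then show ?thesis using fiber_comb[OF Q F] by simp
qed

lemma fin_supp_block_embed: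
  assumes "fin_supp S u"
  shows "fin_supp (Inr ` ({..<k} \<times> S)) (block_embed k u)"
  using assms unfolding fin_supp_def
  by (auto simp: block_embed_def imat_one_def image_iff split: sum.splits)

lemma block_embed_transpose: "imat_transpose (block_embed k u) = block_embed k (imat_transpose u)"
  by (auto simp: block_embed_def imat_one_def fun_eq_iff split: sum.splits)

lemma block_embed_inverse:
  assumes u: "fin_supp S u" and v: "fin_supp S v" and uv: "imat_mult u v = imat_one"
    and X: "supported B X"
  shows "imat_app (block_embed k u) (imat_app (block_embed k v) X) = X"
proof
  fix r
  let ?S = "Inr ` ({..<k} \<times> S)"
  have fu: "fin_supp ?S (block_embed k u)" and fv: "fin_supp ?S (block_embed k v)"
    using u v by (auto intro: fin_supp_block_embed)
  have finS: "finite ?S" using fu by (simp add: fin_supp_def)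
  define C where "C = B \<union> ?S"
  have C: "supported C X" using X finS by (auto simp: supported_def C_def)
  have vX: "supported C (imat_app (block_embed k v) X)"
    by (rule supported_imat_app[OF fv C]) (simp add: C_def)
  show "imat_app (block_embed k u) (imat_app (block_embed k v) X) r = X r"
  proof (cases "r \<in> ?S")
    case False
    then show ?thesis
      by (simp add: imat_app_outside[OF fu vX] imat_app_outside[OF fv C])
  next
    case True
    then obtain j i where r: "r = Inr (j, i)" "j < k" "i \<in> S" by auto
    let ?N = "{i'. Inr (j, i') \<in> C}"
    have SN: "S \<subseteq> ?N" using r(2) by (auto simp: C_def)
    have N: "finite ?N" using imat_app_block_embed_Inr(2)[OF C r(2)] .
    have "imat_app (block_embed k u) (imat_app (block_embed k v) X) r
        = (\<Sum>s\<in>?N. \<Sum>t\<in>?N. u i s * v s t * X (Inr (j, t)))"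
      unfolding r(1) imat_app_block_embed_Inr(1)[OF vX r(2)] imat_app_block_embed_Inr(1)[OF C r(2)]
      by (simp add: sum_distrib_left mult.assoc)
    also have "\<dots> = (\<Sum>t\<in>?N. \<Sum>s\<in>?N. u i s * v s t * X (Inr (j, t)))" by (rule sum.swap)
    also have "\<dots> = (\<Sum>t\<in>?N. imat_mult u v i t * X (Inr (j, t)))"
      using N by (intro sum.cong) (simp_all add: imat_mult_eq_sum[OF u v SN] sum_distrib_right)
    also have "\<dots> = (\<Sum>t\<in>?N. if t = i then X (Inr (j, t)) else 0)"
      unfolding uv by (intro sum.cong) (auto simp: imat_one_def)
    also have "\<dots> = X r" using N SN r by auto
    finally show ?thesis .
  qed
qed

lemma K_groupE:
  assumes "a \<in> K_group k"
  obtains u S where "a = block_embed k u" "fin_supp S u" "imat_mult u (imat_transpose u) = imat_one"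
    "imat_mult (imat_transpose u) u = imat_one"
proof -
  obtain u where u: "a = block_embed k u" "u \<in> fin_O" using assms unfolding K_group_def by blast
  then have "finitary UNIV u" unfolding fin_O_def fin_GL_def by blast
  then obtain S where "fin_supp S u" unfolding finitary_iff by blast
  with u show thesis using that[of u S] unfolding fin_O_def by simp
qed

text \<open>An orthogonal matrix is its own inverse transpose, so \<open>a\<close> acts alike on the
  plus and minus halves. This keeps the fibers in \<open>Q\<close> and \<open>T\<close> and fixes
  the outer coordinates. A right factor is absorbed by a substitution in \<open>x\<close>, a left
  factor by one in \<open>y\<close>; the transpose of \<open>a\<close> gives the reverse
  substitution.\<close>

lemma chi_inf_mult_K:
  fixes Q T :: "'p::prime_card padic vec set"
  assumes Q: "subspace class_ring Q (module_vec TYPE('p padic) (k + k))"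
    and T: "subspace class_ring T (module_vec TYPE('p padic) (k + k))"
    and g: "fin_supp S0 g" and a: "a \<in> K_group k"
  shows "chi_inf \<alpha> k (imat_mult g a) Q T = chi_inf \<alpha> k g Q T"
    and "chi_inf \<alpha> k (imat_mult a g) Q T = chi_inf \<alpha> k g Q T"
proof -
  obtain u Su where u: "a = block_embed k u" "fin_supp Su u"
    "imat_mult u (imat_transpose u) = imat_one" "imat_mult (imat_transpose u) u = imat_one"
    using a by (rule K_groupE)
  let ?Sa = "Inr ` ({..<k} \<times> Su) :: index set"
  let ?S = "S0 \<union> ?Sa"
  have fa: "fin_supp ?Sa a" unfolding u(1) using u(2) by (rule fin_supp_block_embed)
  have finS: "finite ?S" using g fa by (simp add: fin_supp_def)
  define aT where "aT = imat_transpose a"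
  have aT: "aT = block_embed k (imat_transpose u)" by (simp add: aT_def u(1) block_embed_transpose)
  have ga: "fin_supp ?S g" "fin_supp ?S a" "fin_supp ?S aT" "fin_supp ?S (imat_transpose g)"
    using fin_supp_mono[OF g _ finS] fin_supp_mono[OF fa _ finS] by (auto simp: aT_def fin_supp_transpose)
  have aat: "imat_app a (imat_app aT X) = X" "imat_app aT (imat_app a X) = X" if "supported B X" for B X
    unfolding aT unfolding u(1)
    using block_embed_inverse[OF u(2) fin_supp_transpose[OF u(2)] u(3) that]
      block_embed_inverse[OF fin_supp_transpose[OF u(2)] u(2) u(4) that] by simp_all
  have fib: "fiber k i (imat_app b Xp) (imat_app b Xm) \<in> R"
    if "b = a \<or> b = aT" "\<forall>i. fiber k i Xp Xm \<in> R" "supported B Xp" "supported B Xm"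
      "subspace class_ring R (module_vec TYPE('p padic) (k + k))" for b Xp Xm R B i
    using that(1) fiber_block_embed[OF that(5) _ that(3,4)] that(2) unfolding aT unfolding u(1) by blast
  have Inl: "imat_app b X (Inl c) = X (Inl c)" if "b = a \<or> b = aT" "supported B X" for b X B c
    using that(1) imat_app_block_embed_Inl[OF that(2)] unfolding aT unfolding u(1) by blast
  \<comment> \<open>Once the support contains \<open>?S\<close>, it also supports all images under
    \<open>g\<close>, \<open>a\<close> and their transposes.\<close>
  have extend: "\<exists>C. supported C Xp \<and> supported C Ym \<and> ?S \<subseteq> C" if "supported B Xp" "supported B Ym"
    for B and Xp Ym :: "index \<Rightarrow> 'p padic"
    using that finS by (intro exI[of _ "B \<union> ?S"]) (auto simp: supported_def)
  have tr1: "imat_transpose (imat_mult g a) = imat_mult aT (imat_transpose g)"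
    unfolding aT_def by (rule imat_mult_transpose)
  have tr2: "imat_transpose (imat_mult a g) = imat_mult (imat_transpose g) aT"
    unfolding aT_def by (rule imat_mult_transpose)
  note app = imat_app_mult[where S = ?S] and supp = supported_imat_app[where S = ?S]
  show "chi_inf \<alpha> k (imat_mult g a) Q T = chi_inf \<alpha> k g Q T"
  proof (intro equalityI subsetI)
    fix x assume "x \<in> chi_inf \<alpha> k (imat_mult g a) Q T"
    then obtain B Xp Ym where B: "supported B Xp" "supported B Ym"
      and x: "x = outer \<alpha> Xp (imat_app (imat_transpose (imat_mult g a)) Ym) (imat_app (imat_mult g a) Xp) Ym"
      and f: "\<forall>i. fiber k i Xp (imat_app (imat_transpose (imat_mult g a)) Ym) \<in> Q"
        "\<forall>i. fiber k i (imat_app (imat_mult g a) Xp) Ym \<in> T"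
      by (rule chi_infE)
    obtain C where C: "supported C Xp" "supported C Ym" "?S \<subseteq> C" using extend[OF B] by blast
    define Xp' where "Xp' = imat_app a Xp"
    define Xm' where "Xm' = imat_app (imat_transpose g) Ym"
    have Xp': "supported C Xp'" unfolding Xp'_def by (rule supp[OF ga(2) C(1,3)])
    have Xm': "supported C Xm'" unfolding Xm'_def by (rule supp[OF ga(4) C(2,3)])
    have Yp: "imat_app (imat_mult g a) Xp = imat_app g Xp'"
      unfolding Xp'_def by (rule app[OF ga(1,2) C(1,3)])
    have Xm: "imat_app (imat_transpose (imat_mult g a)) Ym = imat_app aT Xm'"
      unfolding Xm'_def tr1 by (rule app[OF ga(3,4) C(2,3)])
    have "x = outer \<alpha> Xp' Xm' (imat_app g Xp') Ym"
      unfolding x Yp Xm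
      by (rule outer_Inl_cong) (simp_all add: Xp'_def Inl[OF _ C(1)] Inl[OF _ Xm'])
    moreover have "fiber k i Xp' Xm' \<in> Q" for i
    proof -
      have "fiber k i (imat_app a Xp) (imat_app a (imat_app aT Xm')) \<in> Q"
        using f(1) supp[OF ga(3) Xm' C(3)] unfolding Xm by (intro fib[OF _ _ C(1) _ Q]) auto
      then show ?thesis unfolding aat(1)[OF Xm'] Xp'_def .
    qed
    ultimately show "x \<in> chi_inf \<alpha> k g Q T"
      using chi_infI[OF Xp' C(2), of k g Q T \<alpha>] f(2) unfolding Yp Xm'_def by simp
  next
    fix x assume "x \<in> chi_inf \<alpha> k g Q T"
    then obtain B Xp Ym where B: "supported B Xp" "supported B Ym"
      and x: "x = outer \<alpha> Xp (imat_app (imat_transpose g) Ym) (imat_app g Xp) Ym"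
      and f: "\<forall>i. fiber k i Xp (imat_app (imat_transpose g) Ym) \<in> Q"
        "\<forall>i. fiber k i (imat_app g Xp) Ym \<in> T"
      by (rule chi_infE)
    obtain C where C: "supported C Xp" "supported C Ym" "?S \<subseteq> C" using extend[OF B] by blast
    define Xp' where "Xp' = imat_app aT Xp"
    have Xp': "supported C Xp'" unfolding Xp'_def by (rule supp[OF ga(3) C(1,3)])
    have Xm': "supported C (imat_app (imat_transpose g) Ym)" by (rule supp[OF ga(4) C(2,3)])
    have Yp: "imat_app (imat_mult g a) Xp' = imat_app g Xp"
      unfolding app[OF ga(1,2) Xp' C(3)] unfolding Xp'_def aat(1)[OF C(1)] ..
    have Xm: "imat_app (imat_transpose (imat_mult g a)) Ym = imat_app aT (imat_app (imat_transpose g) Ym)"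
      unfolding tr1 by (rule app[OF ga(3,4) C(2,3)])
    have "x = outer \<alpha> Xp' (imat_app (imat_transpose (imat_mult g a)) Ym) (imat_app (imat_mult g a) Xp') Ym"
      unfolding x Yp Xm
      by (rule outer_Inl_cong) (simp_all add: Xp'_def Inl[OF _ C(1)] Inl[OF _ Xm'])
    moreover have "fiber k i Xp' (imat_app (imat_transpose (imat_mult g a)) Ym) \<in> Q" for i
      unfolding Xp'_def Xm by (rule fib[OF _ f(1) C(1) Xm' Q]) simp
    ultimately show "x \<in> chi_inf \<alpha> k (imat_mult g a) Q T"
      using chi_infI[OF Xp' C(2), of k "imat_mult g a" Q T \<alpha>] f(2) unfolding Yp by simp
  qed
  show "chi_inf \<alpha> k (imat_mult a g) Q T = chi_inf \<alpha> k g Q T"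
  proof (intro equalityI subsetI)
    fix x assume "x \<in> chi_inf \<alpha> k (imat_mult a g) Q T"
    then obtain B Xp Ym where B: "supported B Xp" "supported B Ym"
      and x: "x = outer \<alpha> Xp (imat_app (imat_transpose (imat_mult a g)) Ym) (imat_app (imat_mult a g) Xp) Ym"
      and f: "\<forall>i. fiber k i Xp (imat_app (imat_transpose (imat_mult a g)) Ym) \<in> Q"
        "\<forall>i. fiber k i (imat_app (imat_mult a g) Xp) Ym \<in> T"
      by (rule chi_infE)
    obtain C where C: "supported C Xp" "supported C Ym" "?S \<subseteq> C" using extend[OF B] by blast
    define Ym' where "Ym' = imat_app aT Ym"
    have Ym': "supported C Ym'" unfolding Ym'_def by (rule supp[OF ga(3) C(2,3)])
    have Yp': "supported C (imat_app g Xp)" by (rule supp[OF ga(1) C(1,3)])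
    have Yp: "imat_app (imat_mult a g) Xp = imat_app a (imat_app g Xp)" by (rule app[OF ga(2,1) C(1,3)])
    have Xm: "imat_app (imat_transpose (imat_mult a g)) Ym = imat_app (imat_transpose g) Ym'"
      unfolding Ym'_def tr2 by (rule app[OF ga(4,3) C(2,3)])
    have "x = outer \<alpha> Xp (imat_app (imat_transpose g) Ym') (imat_app g Xp) Ym'"
      unfolding x Yp Xm
      by (rule outer_Inl_cong) (simp_all add: Ym'_def Inl[OF _ C(2)] Inl[OF _ Yp'])
    moreover have "fiber k i (imat_app g Xp) Ym' \<in> T" for i
    proof -
      have "fiber k i (imat_app aT (imat_app a (imat_app g Xp))) (imat_app aT Ym) \<in> T"
        using f(2) supp[OF ga(2) Yp' C(3)] unfolding Yp by (intro fib[OF _ _ _ C(2) T]) auto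
      then show ?thesis unfolding aat(2)[OF Yp'] Ym'_def .
    qed
    ultimately show "x \<in> chi_inf \<alpha> k g Q T"
      using chi_infI[OF C(1) Ym', of k g Q T \<alpha>] f(1) unfolding Xm by simp
  next
    fix x assume "x \<in> chi_inf \<alpha> k g Q T"
    then obtain B Xp Ym where B: "supported B Xp" "supported B Ym"
      and x: "x = outer \<alpha> Xp (imat_app (imat_transpose g) Ym) (imat_app g Xp) Ym"
      and f: "\<forall>i. fiber k i Xp (imat_app (imat_transpose g) Ym) \<in> Q"
        "\<forall>i. fiber k i (imat_app g Xp) Ym \<in> T"
      by (rule chi_infE)
    obtain C where C: "supported C Xp" "supported C Ym" "?S \<subseteq> C" using extend[OF B] by blast
    define Ym' where "Ym' = imat_app a Ym"
    have Ym': "supported C Ym'" unfolding Ym'_def by (rule supp[OF ga(2) C(2,3)])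
    have Yp': "supported C (imat_app g Xp)" by (rule supp[OF ga(1) C(1,3)])
    have Yp: "imat_app (imat_mult a g) Xp = imat_app a (imat_app g Xp)" by (rule app[OF ga(2,1) C(1,3)])
    have Xm: "imat_app (imat_transpose (imat_mult a g)) Ym' = imat_app (imat_transpose g) Ym"
      unfolding tr2 unfolding app[OF ga(4,3) Ym' C(3)] unfolding Ym'_def aat(2)[OF C(2)] ..
    have "x = outer \<alpha> Xp (imat_app (imat_transpose (imat_mult a g)) Ym') (imat_app (imat_mult a g) Xp) Ym'"
      unfolding x Yp Xm
      by (rule outer_Inl_cong) (simp_all add: Ym'_def Inl[OF _ C(2)] Inl[OF _ Yp'])
    moreover have "fiber k i (imat_app (imat_mult a g) Xp) Ym' \<in> T" for i
      unfolding Ym'_def Yp by (rule fib[OF _ f(2) Yp' C(2) T]) simp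
    ultimately show "x \<in> chi_inf \<alpha> k (imat_mult a g) Q T"
      using chi_infI[OF C(1) Ym', of k "imat_mult a g" Q T \<alpha>] f(1) unfolding Xm by simp
  qed
qed

lemma level_embed_fin_supp: "fin_supp (level_indices \<alpha> k m) (level_embed \<alpha> k m g)"
  by (simp add: fin_supp_def level_embed_def)

lemma imat_app_inside:
  assumes g: "fin_supp S g" and X: "supported B X" and r: "r \<in> S"
  shows "imat_app g X r = mat_app S g X r"
proof -
  have "supported (B \<union> S) X" using X g by (auto simp: supported_def fin_supp_def)
  then have "imat_app g X r = (\<Sum>s\<in>B \<union> S. g r s * X s)" by (rule imat_app_eq_sum)
  also have "\<dots> = (\<Sum>s\<in>S. g r s * X s)"
  proof (rule sum.mono_neutral_right)
    show "finite (B \<union> S)" using X g by (auto simp: supported_def fin_supp_def)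
    show "\<forall>s\<in>B \<union> S - S. g r s * X s = 0"
      using fin_supp_zero[OF g] r by (metis Diff_iff mult_zero_left)
  qed auto
  finally show ?thesis by (simp add: mat_app_def)
qed

lemma imat_app_level_embed:
  assumes X: "supported B X"
  shows "imat_app (level_embed \<alpha> k m g) X r = (if r \<in> level_indices \<alpha> k m
      then mat_app (level_indices \<alpha> k m) (coord_mat \<alpha> m g) X r else X r)"
    and "imat_app (imat_transpose (level_embed \<alpha> k m g)) X r = (if r \<in> level_indices \<alpha> k m
      then mat_app (level_indices \<alpha> k m) (imat_transpose (coord_mat \<alpha> m g)) X r else X r)"
proof -
  note L = level_embed_fin_supp[of \<alpha> k m g]
  show "imat_app (level_embed \<alpha> k m g) X r = (if r \<in> level_indices \<alpha> k m
      then mat_app (level_indices \<alpha> k m) (coord_mat \<alpha> m g) X r else X r)"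
  proof (cases "r \<in> level_indices \<alpha> k m")
    case True
    then have "imat_app (level_embed \<alpha> k m g) X r = mat_app (level_indices \<alpha> k m) (level_embed \<alpha> k m g) X r"
      by (rule imat_app_inside[OF L X])
    also have "\<dots> = mat_app (level_indices \<alpha> k m) (coord_mat \<alpha> m g) X r"
      using True by (intro mat_app_cong) (simp_all add: level_embed_def coord_mat_def)
    finally show ?thesis using True by simp
  qed (simp add: imat_app_outside[OF L X])
  show "imat_app (imat_transpose (level_embed \<alpha> k m g)) X r = (if r \<in> level_indices \<alpha> k m
      then mat_app (level_indices \<alpha> k m) (imat_transpose (coord_mat \<alpha> m g)) X r else X r)"
  proof (cases "r \<in> level_indices \<alpha> k m")
    case True
    then have "imat_app (imat_transpose (level_embed \<alpha> k m g)) X r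
        = mat_app (level_indices \<alpha> k m) (imat_transpose (level_embed \<alpha> k m g)) X r"
      by (rule imat_app_inside[OF fin_supp_transpose[OF L] X])
    also have "\<dots> = mat_app (level_indices \<alpha> k m) (imat_transpose (coord_mat \<alpha> m g)) X r"
      using True by (intro mat_app_cong) (simp_all add: level_embed_def coord_mat_def)
    finally show ?thesis using True by simp
  qed (simp add: imat_app_outside[OF fin_supp_transpose[OF L] X])
qed

text \<open>In one direction the fibers beyond level \<open>m\<close> are forgotten. In the other a
  solution is cut off outside \<open>?I\<close>; its fibers with \<open>i \<ge> m\<close> become
  zero and lie in every subspace.\<close>

lemma chi_inf_level_embed:
  fixes Q T :: "'a::field vec set"
  assumes Q: "subspace class_ring Q (module_vec TYPE('a) (k + k))"
    and T: "subspace class_ring T (module_vec TYPE('a) (k + k))"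
  shows "chi_inf \<alpha> k (level_embed \<alpha> k m g) Q T = chi_coord \<alpha> k m (coord_mat \<alpha> m g) Q T"
proof -
  let ?I = "level_indices \<alpha> k m" and ?L = "level_embed \<alpha> k m g" and ?\<gamma> = "coord_mat \<alpha> m g"
  show ?thesis
  proof (intro equalityI subsetI)
    fix x assume "x \<in> chi_inf \<alpha> k ?L Q T"
    then obtain B Xp Ym where B: "supported B Xp" "supported B Ym"
      and x: "x = outer \<alpha> Xp (imat_app (imat_transpose ?L) Ym) (imat_app ?L Xp) Ym"
      and f: "\<forall>i. fiber k i Xp (imat_app (imat_transpose ?L) Ym) \<in> Q"
        "\<forall>i. fiber k i (imat_app ?L Xp) Ym \<in> T"
      by (rule chi_infE)
    have p: "imat_app ?L Xp r = mat_app ?I ?\<gamma> Xp r" if "r \<in> ?I" for r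
      using that by (simp add: imat_app_level_embed(1)[OF B(1)])
    have q: "imat_app (imat_transpose ?L) Ym r = mat_app ?I (imat_transpose ?\<gamma>) Ym r" if "r \<in> ?I" for r
      using that by (simp add: imat_app_level_embed(2)[OF B(2)])
    have "x = outer \<alpha> Xp (mat_app ?I (imat_transpose ?\<gamma>) Ym) (mat_app ?I ?\<gamma> Xp) Ym"
      unfolding x by (rule outer_cong[where k = k and m = m]) (simp_all add: p q)
    also have "\<dots> \<in> chi_coord \<alpha> k m ?\<gamma> Q T"
    proof (rule chi_coordI)
      fix i assume i: "i < m"
      have "fiber k i Xp (imat_app (imat_transpose ?L) Ym) = fiber k i Xp (mat_app ?I (imat_transpose ?\<gamma>) Ym)"
        by (rule fiber_cong[where m = m and \<alpha> = \<alpha>]) (simp_all add: q i)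
      then show "fiber k i Xp (mat_app ?I (imat_transpose ?\<gamma>) Ym) \<in> Q" using f(1) by metis
      have "fiber k i (imat_app ?L Xp) Ym = fiber k i (mat_app ?I ?\<gamma> Xp) Ym"
        by (rule fiber_cong[where m = m and \<alpha> = \<alpha>]) (simp_all add: p i)
      then show "fiber k i (mat_app ?I ?\<gamma> Xp) Ym \<in> T" using f(2) by metis
    qed
    finally show "x \<in> chi_coord \<alpha> k m ?\<gamma> Q T" .
  next
    fix x assume "x \<in> chi_coord \<alpha> k m ?\<gamma> Q T"
    then obtain Xp Ym where x: "x = outer \<alpha> Xp (mat_app ?I (imat_transpose ?\<gamma>) Ym) (mat_app ?I ?\<gamma> Xp) Ym"
      and fQ: "\<forall>i<m. fiber k i Xp (mat_app ?I (imat_transpose ?\<gamma>) Ym) \<in> Q"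
      and fT: "\<forall>i<m. fiber k i (mat_app ?I ?\<gamma> Xp) Ym \<in> T"
      by (rule chi_coordE)
    define Xp' where "Xp' r = (if r \<in> ?I then Xp r else 0)" for r
    define Ym' where "Ym' r = (if r \<in> ?I then Ym r else 0)" for r
    have B: "supported ?I Xp'" "supported ?I Ym'" by (simp_all add: supported_def Xp'_def Ym'_def)
    have p: "imat_app ?L Xp' r = (if r \<in> ?I then mat_app ?I ?\<gamma> Xp r else 0)" for r
      unfolding imat_app_level_embed(1)[OF B(1)]
      using mat_app_cong[of ?I ?\<gamma> ?\<gamma> Xp' Xp r] by (simp add: Xp'_def)
    have q: "imat_app (imat_transpose ?L) Ym' r = (if r \<in> ?I then mat_app ?I (imat_transpose ?\<gamma>) Ym r else 0)" for r
      unfolding imat_app_level_embed(2)[OF B(2)]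
      using mat_app_cong[of ?I "imat_transpose ?\<gamma>" "imat_transpose ?\<gamma>" Ym' Ym r] by (simp add: Ym'_def)
    have zero: "fiber k i (X :: index \<Rightarrow> 'a) Y = 0\<^sub>v (k + k)"
      if "\<not> i < m" "\<And>r. r \<notin> ?I \<Longrightarrow> X r = 0" "\<And>r. r \<notin> ?I \<Longrightarrow> Y r = 0" for i X Y
      using that by (intro eq_vecI) (auto simp: fiber_def)
    have "x = outer \<alpha> Xp' (imat_app (imat_transpose ?L) Ym') (imat_app ?L Xp') Ym'"
      unfolding x by (rule outer_cong[where k = k and m = m]) (simp_all add: p q Xp'_def Ym'_def)
    also have "\<dots> \<in> chi_inf \<alpha> k ?L Q T"
    proof (rule chi_infI[OF B])
      fix i
      show "fiber k i Xp' (imat_app (imat_transpose ?L) Ym') \<in> Q"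
      proof (cases "i < m")
        case True
        have "fiber k i Xp' (imat_app (imat_transpose ?L) Ym') = fiber k i Xp (mat_app ?I (imat_transpose ?\<gamma>) Ym)"
          by (rule fiber_cong[where m = m and \<alpha> = \<alpha>]) (simp_all add: q Xp'_def True)
        then show ?thesis using fQ True by metis
      next
        case False
        then have "fiber k i Xp' (imat_app (imat_transpose ?L) Ym') = 0\<^sub>v (k + k)"
          by (rule zero) (simp_all add: q Xp'_def)
        then show ?thesis using Q unfolding subspace_module_vec_iff by simp
      qed
      show "fiber k i (imat_app ?L Xp') Ym' \<in> T"
      proof (cases "i < m")
        case True
        have "fiber k i (imat_app ?L Xp') Ym' = fiber k i (mat_app ?I ?\<gamma> Xp) Ym"
          by (rule fiber_cong[where m = m and \<alpha> = \<alpha>]) (simp_all add: p Ym'_def True)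
        then show ?thesis using fT True by metis
      next
        case False
        then have "fiber k i (imat_app ?L Xp') Ym' = 0\<^sub>v (k + k)"
          by (rule zero) (simp_all add: p Ym'_def)
        then show ?thesis using T unfolding subspace_module_vec_iff by simp
      qed
    qed
    finally show "x \<in> chi_inf \<alpha> k ?L Q T" .
  qed
qed

section \<open>Representatives of double cosets at finite levels\<close>

lemma imat_one_in_K_group: "imat_one \<in> (K_group k :: (index, 'p::prime_card padic) imat set)"
proof -
  have "block_embed k (imat_one :: (nat, 'p padic) imat) = imat_one"
    by (intro ext) (auto simp: block_embed_def imat_one_def split: sum.splits)
  moreover have "(imat_one :: (nat, 'p padic) imat) \<in> fin_O"
  proof -
    have "finitary UNIV (imat_one :: (nat, 'p padic) imat)" by (simp add: finitary_def)
    moreover have "imat_one i j \<in> (padic_integers :: 'p padic set)" for i j :: nat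
      unfolding padic_integers_def imat_one_def
      using rangeI[of to_fract "0 :: 'p padic_int"] rangeI[of to_fract "1 :: 'p padic_int"] by simp
    moreover have "imat_transpose imat_one = (imat_one :: (nat, 'p padic) imat)"
      by (intro ext) (rule imat_one_commute)
    ultimately show ?thesis unfolding fin_O_def fin_GL_def by (auto simp: imat_mult_one)
  qed
  ultimately show ?thesis unfolding K_group_def by (metis imageI)
qed

lemma in_double_coset_self: "g \<in> double_coset k g"
  unfolding double_coset_def
  using imat_one_in_K_group[of k] by (force simp: imat_mult_one)

lemma imat_mult_level:
  assumes g: "fin_supp (level_indices \<alpha> k m) g" and h: "fin_supp (level_indices \<alpha> k m) h"
    and t: "t \<in> level_indices \<alpha> k m"
  shows "imat_mult g h r t = (\<Sum>s\<in>level_indices \<alpha> k m. g r s * h s t)"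
  using imat_mult_eq_sum[OF g h subset_refl _ t] by simp

lemma level_embed_mult:
  fixes g h :: "'a::field mat"
  assumes g: "g \<in> carrier_mat (\<alpha> + k * m) (\<alpha> + k * m)" and h: "h \<in> carrier_mat (\<alpha> + k * m) (\<alpha> + k * m)"
    and gh: "g * h = 1\<^sub>m (\<alpha> + k * m)"
  shows "imat_mult (level_embed \<alpha> k m g) (level_embed \<alpha> k m h) = imat_one"
proof (intro ext)
  fix r t
  let ?I = "level_indices \<alpha> k m"
  note L = level_embed_fin_supp
  show "imat_mult (level_embed \<alpha> k m g) (level_embed \<alpha> k m h) r t = imat_one r t"
  proof (cases "r \<in> ?I \<and> t \<in> ?I")
    case True
    then have "imat_mult (level_embed \<alpha> k m g) (level_embed \<alpha> k m h) r t
        = (\<Sum>s\<in>?I. g $$ (position \<alpha> m r, position \<alpha> m s) * h $$ (position \<alpha> m s, position \<alpha> m t))"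
      by (simp add: imat_mult_level[OF L L] level_embed_def)
    also have "\<dots> = (\<Sum>l<\<alpha> + k * m. g $$ (position \<alpha> m r, l) * h $$ (l, position \<alpha> m t))"
      by (rule sum_position)
    also have "\<dots> = (g * h) $$ (position \<alpha> m r, position \<alpha> m t)"
      using g h True position_less[of r \<alpha> k m] position_less[of t \<alpha> k m]
      by (simp add: scalar_prod_def atLeast0LessThan)
    also have "\<dots> = imat_one r t"
      unfolding gh using True position_less[of r \<alpha> k m] position_less[of t \<alpha> k m] position_eq_iff[of r \<alpha> k m t]
      by (simp add: imat_one_def)
    finally show ?thesis .
  next
    case False
    then show ?thesis by (intro imat_mult_outside[OF L L]) blast
  qed
qed

lemma finitary_level_embed: "finitary (indices \<alpha> k) (level_embed \<alpha> k m g)"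
proof -
  have "level_indices \<alpha> k m \<subseteq> indices \<alpha> k" by (auto simp: level_indices_def indices_def)
  then show ?thesis unfolding finitary_iff using level_embed_fin_supp by blast
qed

lemma level_embed_in_G_group:
  assumes "g \<in> GL (\<alpha> + k * m)"
  shows "level_embed \<alpha> k m g \<in> G_group \<alpha> k"
proof -
  have g: "g \<in> carrier_mat (\<alpha> + k * m) (\<alpha> + k * m)" using assms by (simp add: GL_def)
  obtain h where h: "h \<in> carrier_mat (\<alpha> + k * m) (\<alpha> + k * m)" "g * h = 1\<^sub>m (\<alpha> + k * m)" "h * g = 1\<^sub>m (\<alpha> + k * m)"
    using assms by (rule GL_inverse)
  show ?thesis
    unfolding G_group_def fin_GL_def mem_Collect_eq
    by (intro conjI exI[of _ "level_embed \<alpha> k m h"] finitary_level_embed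
        level_embed_mult[OF g h(1,2)] level_embed_mult[OF h(1) g h(3)])
qed

text \<open>The level has to contain the support of the inverse as well, so that both matrices cut
  down to mutually inverse square matrices.\<close>

lemma level_representative:
  assumes "g0 \<in> (G_group \<alpha> k :: (index, 'p::prime_card padic) imat set)"
  obtains m g where "g \<in> GL (\<alpha> + k * m)" "level_embed \<alpha> k m g = g0"
proof -
  obtain h0 where fin: "finitary (indices \<alpha> k) g0" "finitary (indices \<alpha> k) h0"
    and inv: "imat_mult g0 h0 = imat_one" "imat_mult h0 g0 = imat_one"
    using assms unfolding G_group_def fin_GL_def by blast
  obtain S S' where S: "S \<subseteq> indices \<alpha> k" "fin_supp S g0" "S' \<subseteq> indices \<alpha> k" "fin_supp S' h0"
    using fin unfolding finitary_iff by blast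
  have finS: "finite (S \<union> S')" using S by (simp add: fin_supp_def)
  \<comment> \<open>\<open>Suc i\<close>, because level \<open>m\<close> has the coordinates
    \<open>i < m\<close>. Outer indices belong to every level.\<close>
  define lev where "lev r = (case r of Inl _ \<Rightarrow> 0 | Inr (j, i) \<Rightarrow> Suc i)" for r :: index
  define m where "m = Max (insert 0 (lev ` (S \<union> S')))"
  have lev: "lev r \<le> m" if "r \<in> S \<union> S'" for r
    unfolding m_def using finS that by (intro Max_ge) auto
  have sub: "S \<union> S' \<subseteq> level_indices \<alpha> k m"
  proof
    fix r assume r: "r \<in> S \<union> S'"
    then have "r \<in> indices \<alpha> k" using S by blast
    then show "r \<in> level_indices \<alpha> k m"
      using lev[OF r] by (auto simp: indices_def level_indices_def lev_def)
  qed
  let ?I = "level_indices \<alpha> k m" and ?n = "\<alpha> + k * m"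
  have g0: "fin_supp ?I g0" and h0: "fin_supp ?I h0"
    using fin_supp_mono[OF S(2)] fin_supp_mono[OF S(4)] sub by auto
  define idx where "idx = the_inv_into ?I (position \<alpha> m)"
  have idx: "idx (position \<alpha> m r) = r" if "r \<in> ?I" for r
    unfolding idx_def using bij_betw_position[of \<alpha> m k] that by (simp add: bij_betw_def the_inv_into_f_f)
  define M where "M f = mat ?n ?n (\<lambda>(a, b). f (idx a) (idx b))" for f :: "(index, 'p padic) imat"
  have M: "M f $$ (position \<alpha> m r, position \<alpha> m s) = f r s" if "r \<in> ?I" "s \<in> ?I" for f r s
    using that by (simp add: M_def idx position_less)
  have Mc: "M f \<in> carrier_mat ?n ?n" for f by (simp add: M_def)
  have M_mult: "M f * M f' = 1\<^sub>m ?n"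
    if f: "fin_supp ?I f" and f': "fin_supp ?I f'" and ff': "imat_mult f f' = imat_one" for f f'
  proof (rule eq_matI)
    fix a b assume "a < dim_row (1\<^sub>m ?n :: 'p padic mat)" "b < dim_col (1\<^sub>m ?n :: 'p padic mat)"
    then have ab: "a < ?n" "b < ?n" by simp_all
    obtain r where r: "r \<in> ?I" "position \<alpha> m r = a" using ab(1) by (rule position_surj)
    obtain t where t: "t \<in> ?I" "position \<alpha> m t = b" using ab(2) by (rule position_surj)
    have "(M f * M f') $$ (a, b) = (\<Sum>l<?n. M f $$ (a, l) * M f' $$ (l, b))"
      using ab Mc[of f] Mc[of f'] by (simp add: scalar_prod_def atLeast0LessThan)
    also have "\<dots> = (\<Sum>s\<in>?I. M f $$ (a, position \<alpha> m s) * M f' $$ (position \<alpha> m s, b))"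
      by (rule sum_position[symmetric])
    also have "\<dots> = (\<Sum>s\<in>?I. f r s * f' s t)"
      using r t by (intro sum.cong refl) (auto simp: M)
    also have "\<dots> = imat_mult f f' r t" using imat_mult_level[OF f f' t(1)] by simp
    also have "\<dots> = (1\<^sub>m ?n) $$ (a, b)"
      using ab position_eq_iff[OF r(1) t(1)] r(2) t(2) by (simp add: ff' imat_one_def)
    finally show "(M f * M f') $$ (a, b) = (1\<^sub>m ?n) $$ (a, b)" .
  qed (use Mc in auto)
  have "inverts_mat (M g0) (M h0)" "inverts_mat (M h0) (M g0)"
    using M_mult[OF g0 h0 inv(1)] M_mult[OF h0 g0 inv(2)] by (simp_all add: inverts_mat_def M_def)
  then have "M g0 \<in> GL ?n" using Mc[of g0] unfolding GL_def invertible_mat_def by auto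
  moreover have "level_embed \<alpha> k m (M g0) = g0"
  proof (intro ext)
    fix r s
    show "level_embed \<alpha> k m (M g0) r s = g0 r s"
      using g0 M[of r s g0] by (auto simp: level_embed_def fin_supp_def)
  qed
  ultimately show thesis by (rule that)
qed

text \<open>Every member of the union defining \<open>chi\<close> is the level-free set of
  \<open>g0\<close>, and there is at least one member because \<open>g0\<close> itself occurs at
  some level. The union is thus over a singleton.\<close>

lemma chi_double_coset:
  fixes Q T :: "'p::prime_card padic vec set"
  assumes g0: "g0 \<in> G_group \<alpha> k"
    and Q: "subspace class_ring Q (module_vec TYPE('p padic) (k + k))"
    and T: "subspace class_ring T (module_vec TYPE('p padic) (k + k))"
  shows "chi \<alpha> k (double_coset k g0) Q T = chi_inf \<alpha> k g0 Q T"
proof -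
  obtain S where S: "fin_supp S g0" using g0 unfolding G_group_def fin_GL_def finitary_iff by blast
  have eq: "chi_matrix \<alpha> k m g Q T = chi_inf \<alpha> k g0 Q T"
    if g: "g \<in> GL (\<alpha> + k * m)" and L: "level_embed \<alpha> k m g \<in> double_coset k g0" for m g
  proof -
    obtain a b where ab: "level_embed \<alpha> k m g = imat_mult (imat_mult a g0) b" "a \<in> K_group k" "b \<in> K_group k"
      using L unfolding double_coset_def by blast
    obtain u Su where "a = block_embed k u" "fin_supp Su u" using ab(2) by (rule K_groupE)
    then have a: "fin_supp (Inr ` ({..<k} \<times> Su)) a" by (simp add: fin_supp_block_embed)
    let ?S = "S \<union> Inr ` ({..<k} \<times> Su)"
    have fin: "finite ?S" using S a by (simp add: fin_supp_def)
    have "fin_supp ?S (imat_mult a g0)"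
      using fin_supp_mono[OF a _ fin] fin_supp_mono[OF S _ fin] by (intro fin_supp_imat_mult) auto
    then have "chi_inf \<alpha> k (level_embed \<alpha> k m g) Q T = chi_inf \<alpha> k (imat_mult a g0) Q T"
      unfolding ab(1) using ab(3) by (rule chi_inf_mult_K(1)[OF Q T])
    also have "\<dots> = chi_inf \<alpha> k g0 Q T" using S ab(2) by (rule chi_inf_mult_K(2)[OF Q T])
    finally show ?thesis
      unfolding chi_inf_level_embed[OF Q T] chi_matrix_eq_chi_coord[OF g] .
  qed
  obtain m g where mg: "g \<in> GL (\<alpha> + k * m)" "level_embed \<alpha> k m g = g0"
    using g0 by (rule level_representative)
  have self: "level_embed \<alpha> k m g \<in> double_coset k g0"
    unfolding mg(2) by (rule in_double_coset_self)
  have "(\<exists>m g. x = chi_matrix \<alpha> k m g Q T \<and> g \<in> GL (\<alpha> + k * m) \<and> level_embed \<alpha> k m g \<in> double_coset k g0)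
      \<longleftrightarrow> x = chi_inf \<alpha> k g0 Q T" for x
  proof (intro iffI; (elim exE conjE)?)
    fix m' g'
    assume x: "x = chi_matrix \<alpha> k m' g' Q T" and g': "g' \<in> GL (\<alpha> + k * m')" "level_embed \<alpha> k m' g' \<in> double_coset k g0"
    show "x = chi_inf \<alpha> k g0 Q T" unfolding x using g' by (rule eq)
  next
    assume x: "x = chi_inf \<alpha> k g0 Q T"
    show "\<exists>m g. x = chi_matrix \<alpha> k m g Q T \<and> g \<in> GL (\<alpha> + k * m) \<and> level_embed \<alpha> k m g \<in> double_coset k g0"
      unfolding x using eq[OF mg(1) self, symmetric] mg(1) self by (intro exI conjI)
  qed
  then show ?thesis unfolding chi_def by simp
qed

lemma chi_level_embed:
  fixes Q T :: "'p::prime_card padic vec set"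
  assumes "g \<in> GL (\<alpha> + k * m)" and Q: "Q \<in> LGr (J_mat k)" and T: "T \<in> LGr (J_mat k)"
  shows "chi \<alpha> k (double_coset k (level_embed \<alpha> k m g)) Q T = chi_coord \<alpha> k m (coord_mat \<alpha> m g) Q T"
  using chi_double_coset[OF level_embed_in_G_group[OF assms(1)] H.LGr_subspace[OF Q] H.LGr_subspace[OF T]]
    chi_inf_level_embed[OF H.LGr_subspace[OF Q] H.LGr_subspace[OF T]] by simp

lemma double_coset_representative:
  assumes "\<gg> \<in> (double_cosets \<alpha> k :: (index, 'p::prime_card padic) imat set set)"
  obtains m g where "g \<in> GL (\<alpha> + k * m)" "\<gg> = double_coset k (level_embed \<alpha> k m g)"
proof -
  obtain g0 where g0: "g0 \<in> G_group \<alpha> k" "\<gg> = double_coset k g0"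
    using assms unfolding double_cosets_def by blast
  obtain m g where "g \<in> GL (\<alpha> + k * m)" "level_embed \<alpha> k m g = g0" using g0(1) by (rule level_representative)
  then show thesis using that g0(2) by blast
qed

section \<open>Arithmetic of p-adic integers\<close>

abbreviation p_elem :: "'p::prime_card padic_int" where "p_elem \<equiv> of_nat CARD('p)"

lemma residue_of_int: "residue (of_int a :: 'p::prime_card padic_int) n = a mod int CARD('p) ^ n"
proof (induction a rule: int_induct[where k = 0])
  case base
  show ?case by (simp add: zero_padic_int.rep_eq)
next
  case (step1 i)
  then show ?case
    by (simp add: plus_padic_int.rep_eq one_padic_int.rep_eq mod_simps)
next
  case (step2 i)
  then show ?case
    by (simp add: minus_padic_int.rep_eq one_padic_int.rep_eq mod_simps)
qed

lemma residue_p_power: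
  "residue (p_elem ^ s :: 'p::prime_card padic_int) n = int CARD('p) ^ s mod int CARD('p) ^ n"
  using residue_of_int[of "int CARD('p) ^ s" n, where 'p = 'p] by simp

text \<open>If the residue at \<open>s\<close> vanishes, so do all later ones modulo
  \<open>p ^ s\<close>. The quotient has residue \<open>residue x (n + s) div p ^ s\<close> at
  position \<open>n\<close>.\<close>

lemma p_power_dvd_iff:
  fixes x :: "'p::prime_card padic_int"
  shows "p_elem ^ s dvd x \<longleftrightarrow> residue x s = 0"
proof
  assume "p_elem ^ s dvd x"
  then obtain y where "x = p_elem ^ s * y" by (elim dvdE)
  then show "residue x s = 0"
    by (simp add: times_padic_int.rep_eq residue_p_power)
next
  assume 0: "residue x s = 0"
  let ?p = "int CARD('p)"
  have p0: "0 < ?p" by simp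
  have ys: "(residue x (Suc n + s) div ?p ^ s) mod ?p ^ n = residue x (n + s) div ?p ^ s" for n
  proof -
    have "residue x (n + s) = residue x (Suc n + s) mod (?p ^ s * ?p ^ n)"
      using residue_mod[of "n + s" "Suc n + s" x] by (simp add: power_add mult.commute)
    also have "\<dots> = ?p ^ s * (residue x (Suc n + s) div ?p ^ s mod ?p ^ n) + residue x (Suc n + s) mod ?p ^ s"
      by (rule zmod_zmult2_eq) simp
    also have "residue x (Suc n + s) mod ?p ^ s = 0"
      using residue_mod[of s "Suc n + s" x] 0 by simp
    finally show ?thesis by simp
  qed
  define y :: "'p padic_int" where "y = Abs_padic_int (\<lambda>n. residue x (n + s) div ?p ^ s)"
  have y: "residue y = (\<lambda>n. residue x (n + s) div ?p ^ s)"
    unfolding y_def by (rule Abs_padic_int_inverse) (use ys in auto)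
  have "x = p_elem ^ s * y"
  proof (rule residue_inject[THEN iffD1], rule ext)
    fix n
    have "?p ^ s dvd residue x (n + s)"
      using residue_mod[of s "n + s" x] 0 by (simp add: dvd_eq_mod_eq_0)
    then have "residue x (n + s) mod ?p ^ n = (?p ^ s * residue y n) mod ?p ^ n"
      by (simp add: y)
    then show "residue x n = residue (p_elem ^ s * y) n"
      using residue_mod[of n "n + s" x]
      by (simp add: times_padic_int.rep_eq residue_p_power mod_simps)
  qed
  then show "p_elem ^ s dvd x" by simp
qed

lemma p_power_dvd_diff_residue:
  "p_elem ^ s dvd (x :: 'p::prime_card padic_int) - of_int (residue x s)"
  unfolding p_power_dvd_iff
  using residue_mod[of s s x] by (simp add: minus_padic_int.rep_eq residue_of_int)

lemma residue_range: "residue (x :: 'p::prime_card padic_int) s \<in> {0..<int CARD('p) ^ s}"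
  using residue_mod[of s s x] by (metis atLeastLessThan_iff mod_int_pos_iff order_refl
      pos_mod_bound of_nat_0_less_iff zero_less_card_finite zero_less_power pos_mod_sign)

lemma p_power_dvd_of_int_iff:
  "(p_elem :: 'p::prime_card padic_int) ^ s dvd of_int a \<longleftrightarrow> int CARD('p) ^ s dvd a"
  by (simp add: p_power_dvd_iff residue_of_int dvd_eq_mod_eq_0)

lemma ex_not_p_power_dvd:
  assumes "(x :: 'p::prime_card padic_int) \<noteq> 0"
  obtains s where "\<not> p_elem ^ s dvd x"
proof -
  have "residue x \<noteq> residue (0 :: 'p padic_int)" using assms by (simp add: residue_inject)
  then obtain s where "residue x s \<noteq> 0" by (auto simp: zero_padic_int.rep_eq fun_eq_iff)
  then show thesis using that by (simp add: p_power_dvd_iff)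
qed

lemma p_elem_neq_0: "(p_elem :: 'p::prime_card padic_int) \<noteq> 0"
proof
  have p1: "1 < int CARD('p)"
    using prime_card[where ?'a = 'p] prime_gt_1_nat[of "CARD('p)"] by simp
  assume "(p_elem :: 'p padic_int) = 0"
  then have "residue (p_elem ^ 1 :: 'p padic_int) 2 = 0" by (simp add: zero_padic_int.rep_eq)
  then have "int CARD('p) mod (int CARD('p))\<^sup>2 = 0" by (simp only: residue_p_power) simp
  then have "(int CARD('p))\<^sup>2 dvd int CARD('p)" by (simp add: dvd_eq_mod_eq_0)
  then have "(int CARD('p))\<^sup>2 \<le> int CARD('p)" using p1 by (intro zdvd_imp_le) auto
  then show False using p1 by (simp add: power2_eq_square)
qed

text \<open>Inverses of the residues exist modulo each \<open>p ^ n\<close>. Being unique there,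
  they fit together to one p-adic integer.\<close>

lemma padic_int_unit:
  fixes x :: "'p::prime_card padic_int"
  assumes "\<not> p_elem dvd x"
  shows "x dvd 1"
proof -
  let ?p = "int CARD('p)"
  have p: "prime ?p" using prime_card[where ?'a = 'p] by simp
  have "coprime (residue x n) (?p ^ n)" for n
  proof (cases n)
    case (Suc n')
    have "\<not> ?p dvd residue x n"
    proof
      assume "?p dvd residue x n"
      then have "residue x 1 = 0"
        using residue_mod[of 1 n x] Suc by (simp add: dvd_eq_mod_eq_0)
      then show False using assms p_power_dvd_iff[of 1 x] by simp
    qed
    then show ?thesis using p by (metis coprime_commute coprime_power_right_iff prime_imp_coprime)
  qed simp
  then have "\<forall>n. \<exists>y. [residue x n * y = 1] (mod ?p ^ n)" using cong_solve_coprime_int by blast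
  then obtain y where y: "\<And>n. [residue x n * y n = 1] (mod ?p ^ n)" by metis
  have comp: "y (Suc n) mod ?p ^ n = y n mod ?p ^ n" for n
  proof -
    have "[residue x (Suc n) * y (Suc n) = 1] (mod ?p ^ n)"
      using y[of "Suc n"] by (rule cong_dvd_modulus) (simp add: le_imp_power_dvd)
    moreover have "[residue x (Suc n) = residue x n] (mod ?p ^ n)"
      using residue_Suc[of x n] residue_mod[of n n x] by (simp add: Cong.cong_def)
    ultimately have "[residue x n * y (Suc n) = residue x n * y n] (mod ?p ^ n)"
      by (meson cong_mult cong_refl cong_sym cong_trans y)
    then have "[y (Suc n) = y n] (mod ?p ^ n)"
      using \<open>coprime (residue x n) (?p ^ n)\<close> by (simp add: cong_mult_lcancel)
    then show ?thesis by (simp add: Cong.cong_def)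
  qed
  define z :: "'p padic_int" where "z = Abs_padic_int (\<lambda>n. y n mod ?p ^ n)"
  have z: "residue z = (\<lambda>n. y n mod ?p ^ n)"
    unfolding z_def
    by (rule Abs_padic_int_inverse) (simp only: mem_Collect_eq mod_power_Suc_cancel comp simp_thms)
  have "x * z = 1"
  proof (rule residue_inject[THEN iffD1], rule ext)
    fix n
    show "residue (x * z) n = residue (1 :: 'p padic_int) n"
      using y[of n] by (simp add: times_padic_int.rep_eq one_padic_int.rep_eq z mod_simps Cong.cong_def)
  qed
  then show ?thesis by (metis dvd_triv_left)
qed

text \<open>In terms of valuations: \<open>x\<close> has valuation below \<open>a\<close>, the
  product at least \<open>a + b\<close>. The factors \<open>p\<close> of \<open>x\<close> are
  removed one by one until a unit is left.\<close>

lemma p_power_dvd_mult_cancel: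
  fixes x y :: "'p::prime_card padic_int"
  assumes "p_elem ^ (a + b) dvd x * y" and "\<not> p_elem ^ a dvd x"
  shows "p_elem ^ b dvd y"
  using assms
proof (induction a arbitrary: x)
  case (Suc a)
  show ?case
  proof (cases "p_elem dvd x")
    case True
    then obtain x' where x': "x = p_elem * x'" by (elim dvdE)
    have "p_elem ^ (a + b) dvd x' * y" and "\<not> p_elem ^ a dvd x'"
      using Suc.prems p_elem_neq_0[where ?'p = 'p] by (auto simp: x' mult.assoc)
    then show ?thesis by (rule Suc.IH)
  next
    case False
    then obtain x' where "x * x' = 1" using padic_int_unit by (metis dvd_def)
    then have "y = x * y * x'" by (simp add: mult.commute mult.left_commute)
    moreover have "p_elem ^ b dvd x * y"
      using Suc.prems(1) by (metis add.commute power_add dvd_mult_left)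
    ultimately show ?thesis by (metis dvd_mult2)
  qed
qed simp

text \<open>A nonzero element is a power of \<open>p\<close> times a unit, so powers of
  \<open>p\<close> suffice as denominators.\<close>

lemma padic_int_dvd_p_power:
  assumes "(x :: 'p::prime_card padic_int) \<noteq> 0"
  shows "\<exists>s. x dvd p_elem ^ s"
proof -
  obtain s where "\<not> p_elem ^ s dvd x" using assms by (rule ex_not_p_power_dvd)
  then show ?thesis
  proof (induction s arbitrary: x)
    case (Suc s)
    show ?case
    proof (cases "p_elem dvd x")
      case True
      then obtain y where y: "x = p_elem * y" by (elim dvdE)
      then have "\<not> p_elem ^ s dvd y" using Suc.prems by (auto simp: mult_dvd_mono)
      then obtain t where "y dvd p_elem ^ t" using Suc.IH by blast
      then have "x dvd p_elem ^ Suc t" by (simp add: y mult_dvd_mono)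
      then show ?thesis by blast
    next
      case False
      then show ?thesis using padic_int_unit by (metis power_0)
    qed
  qed simp
qed

lemma to_fract_of_nat: "to_fract (of_nat n) = of_nat n"
  by (induction n) simp_all

lemma to_fract_power: "to_fract (x ^ n) = to_fract x ^ n"
  by (induction n) simp_all

lemma padic_times_p_power_integral:
  "\<exists>s. \<forall>t\<ge>s. \<exists>z. (x :: 'p::prime_card padic) * of_nat CARD('p) ^ t = to_fract z"
proof -
  obtain a b where x: "x = Fract a b" "b \<noteq> 0" by (cases x) auto
  obtain s where "b dvd p_elem ^ s" using padic_int_dvd_p_power[OF x(2)] by blast
  then obtain c where c: "p_elem ^ s = b * c" by (elim dvdE)
  have "x * of_nat CARD('p) ^ t = to_fract (a * c * p_elem ^ (t - s))" if "s \<le> t" for t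
  proof -
    have "x * of_nat CARD('p) ^ t = Fract a b * to_fract (p_elem ^ s * p_elem ^ (t - s))"
      using that by (simp add: x power_add[symmetric] to_fract_power to_fract_of_nat)
    also have "\<dots> = to_fract (a * c * p_elem ^ (t - s))"
      using x(2) by (simp add: c to_fract_def eq_fract algebra_simps)
    finally show ?thesis .
  qed
  then show ?thesis by blast
qed

lemma infinite_padic: "infinite (UNIV :: 'p::prime_card padic set)"
proof -
  have "inj (\<lambda>n. to_fract (p_elem ^ n) :: 'p padic)"
  proof (rule injI)
    fix m n :: nat assume "to_fract (p_elem ^ m :: 'p padic_int) = to_fract (p_elem ^ n)"
    then have "(p_elem ^ m :: 'p padic_int) = p_elem ^ n" by simp
    then have dvd: "(p_elem ^ m :: 'p padic_int) dvd p_elem ^ n" "(p_elem ^ n :: 'p padic_int) dvd p_elem ^ m"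
      by simp_all
    have "m \<le> n" if "(p_elem ^ m :: 'p padic_int) dvd p_elem ^ n" for m n
    proof (rule ccontr)
      assume "\<not> m \<le> n"
      then have "int CARD('p) ^ n < int CARD('p) ^ m"
        using prime_card[where ?'a = 'p] prime_gt_1_nat[of "CARD('p)"]
        by (intro power_strict_increasing) auto
      then have "residue (p_elem ^ n :: 'p padic_int) m = int CARD('p) ^ n"
        by (simp add: residue_p_power)
      with that show False by (simp add: p_power_dvd_iff)
    qed
    with dvd show "m = n" by (meson le_antisym)
  qed
  then show ?thesis using finite_subset[OF subset_UNIV] infinite_UNIV_nat
    by (metis finite_imageD)
qed

section \<open>Zero sets of polynomials over the p-adic integers\<close>

text \<open>A polynomial of degree at most \<open>n\<close> whose coefficient of \<open>x\<^sup>n\<close> is not too divisible by \<open>p\<close> takes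
  very divisible values only near at most \<open>n\<close> points: split off one approximate zero at a time.\<close>

lemma approximate_zeros:
  fixes h :: "'p::prime_card padic_int poly"
  assumes "degree h \<le> n" and "\<not> p_elem ^ \<gamma> dvd coeff h n" and "s \<ge> \<gamma> + n * t"
  shows "\<exists>X. finite X \<and> card X \<le> n \<and> (\<forall>x. p_elem ^ s dvd poly h x \<longrightarrow> (\<exists>x0\<in>X. p_elem ^ t dvd x - x0))"
  using assms
proof (induction n arbitrary: h s)
  case 0
  then obtain a where "h = [:a:]" by (metis degree_eq_zeroE le_zero_eq)
  then have "poly h x = coeff h 0" for x by simp
  moreover have "\<not> p_elem ^ s dvd coeff h 0"
    using power_le_dvd[of p_elem s "coeff h 0" \<gamma>] 0(2,3) by auto
  ultimately show ?case by (intro exI[of _ "{}"]) auto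
next
  case (Suc n)
  show ?case
  proof (cases "\<exists>x0. p_elem ^ s dvd poly h x0")
    case False
    then show ?thesis by (intro exI[of _ "{}"]) auto
  next
    case True
    then obtain x0 where x0: "p_elem ^ s dvd poly h x0" by blast
    define h1 where "h1 = synthetic_div h x0"
    have h: "h = pCons (poly h x0) h1 - Polynomial.smult x0 h1"
      using synthetic_div_correct[of h x0] by (simp add: h1_def algebra_simps)
    have eval: "poly h x = poly h x0 + (x - x0) * poly h1 x" for x
      by (subst h) (simp add: algebra_simps)
    have deg: "degree h1 \<le> n" using Suc.prems(1) by (simp add: h1_def degree_synthetic_div)
    then have "coeff h1 (Suc n) = 0" by (simp add: coeff_eq_0)
    then have "coeff h (Suc n) = coeff h1 n" by (subst h) simp
    then have lead: "\<not> p_elem ^ \<gamma> dvd coeff h1 n" using Suc.prems(2) by simp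
    \<comment> \<open>Each zero that is split off costs \<open>t\<close> of the exponent; the bound
      on \<open>s\<close> allows for one such loss per degree.\<close>
    have "\<gamma> + n * t \<le> s - t" using Suc.prems(3) by simp
    with deg lead have "\<exists>X. finite X \<and> card X \<le> n \<and>
        (\<forall>x. p_elem ^ (s - t) dvd poly h1 x \<longrightarrow> (\<exists>x0\<in>X. p_elem ^ t dvd x - x0))"
      by (rule Suc.IH)
    then obtain X where X: "finite X" "card X \<le> n"
      "\<forall>x. p_elem ^ (s - t) dvd poly h1 x \<longrightarrow> (\<exists>x0\<in>X. p_elem ^ t dvd x - x0)"
      by (elim exE conjE) (rule that)
    have "\<exists>x0\<in>insert x0 X. p_elem ^ t dvd x - x0" if x: "p_elem ^ s dvd poly h x" for x
    proof (cases "p_elem ^ t dvd x - x0")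
      case False
      have "p_elem ^ s dvd (x - x0) * poly h1 x"
        using dvd_diff[OF x x0] by (simp add: eval[of x])
      moreover have "s = t + (s - t)" using Suc.prems(3) by simp
      ultimately have "p_elem ^ (t + (s - t)) dvd (x - x0) * poly h1 x" by simp
      then have "p_elem ^ (s - t) dvd poly h1 x" using False by (rule p_power_dvd_mult_cancel)
      then show ?thesis using X(3) by blast
    qed auto
    moreover have "card (insert x0 X) \<le> Suc n" using X by (simp add: card_insert_if)
    ultimately show ?thesis using X(1) by (intro exI[of _ "insert x0 X"]) auto
  qed
qed

text \<open>The analogue of \<open>poly_fun\<close> over a ring; over the p-adic integers
  divisibility by powers of \<open>p\<close> is meaningful.\<close>

inductive_set int_poly_fun :: "'e set \<Rightarrow> (('e \<Rightarrow> 'a::comm_ring_1) \<Rightarrow> 'a) set" for E :: "'e set"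
  where
    const: "(\<lambda>_. c) \<in> int_poly_fun E"
  | var: "e \<in> E \<Longrightarrow> (\<lambda>w. w e) \<in> int_poly_fun E"
  | add: "f \<in> int_poly_fun E \<Longrightarrow> g \<in> int_poly_fun E \<Longrightarrow> (\<lambda>w. f w + g w) \<in> int_poly_fun E"
  | mult: "f \<in> int_poly_fun E \<Longrightarrow> g \<in> int_poly_fun E \<Longrightarrow> (\<lambda>w. f w * g w) \<in> int_poly_fun E"

lemma int_poly_fun_sum:
  "(\<And>i. i \<in> S \<Longrightarrow> f i \<in> int_poly_fun E) \<Longrightarrow> (\<lambda>w. \<Sum>i\<in>S. f i w) \<in> int_poly_fun E"
  by (induction S rule: infinite_finite_induct) (auto intro: int_poly_fun.intros)

text \<open>For \<open>d\<close> a power of \<open>p\<close> this reduces values to residues of the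
  arguments. For \<open>d = 0\<close> it says that \<open>f\<close> depends only on the coordinates
  in \<open>E\<close>.\<close>

lemma int_poly_fun_cong:
  assumes "f \<in> int_poly_fun E" and "\<And>e. e \<in> E \<Longrightarrow> d dvd v e - w e"
  shows "d dvd f v - f w"
  using assms(1)
proof induction
  case (add f g)
  then have "d dvd (f v - f w) + (g v - g w)" by (intro dvd_add) auto
  then show ?case by (simp add: algebra_simps)
next
  case (mult f g)
  then have "d dvd f v * (g v - g w) + g w * (f v - f w)" by (intro dvd_add dvd_mult) auto
  then show ?case by (simp add: algebra_simps)
qed (use assms(2) in auto)

text \<open>\<open>f\<close> as a polynomial in the coordinate \<open>e\<close>, its coefficients
  being polynomials in the others. The degree bound is uniform in \<open>w\<close>, so there is a
  last coefficient that does not vanish identically.\<close>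

lemma int_poly_fun_insert:
  assumes "f \<in> int_poly_fun (insert e E)"
  shows "\<exists>C n. (\<forall>w. f w = poly (C w) (w e)) \<and> (\<forall>i. (\<lambda>w. coeff (C w) i) \<in> int_poly_fun E) \<and>
    (\<forall>w. degree (C w) \<le> n)"
  using assms
proof induction
  case (const c)
  then show ?case
    by (intro exI[of _ "\<lambda>_. [:c:]"] exI[of _ 0])
      (auto simp: coeff_pCons split: nat.split intro!: int_poly_fun.const)
next
  case (var d)
  show ?case
  proof (cases "d = e")
    case True
    then show ?thesis
      by (intro exI[of _ "\<lambda>_. [:0, 1:]"] exI[of _ 1]) (auto intro: int_poly_fun.const)
  next
    case False
    then have d: "d \<in> E" using var by auto
    have "(\<lambda>w. coeff [:w d:] i) \<in> int_poly_fun E" for i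
      using d by (cases i) (auto intro: int_poly_fun.intros)
    then show ?thesis by (intro exI[of _ "\<lambda>w. [:w d:]"] exI[of _ 0]) auto
  qed
next
  case (add f g)
  then obtain C n C' n' where
    f: "\<forall>w. f w = poly (C w) (w e)" "\<forall>i. (\<lambda>w. coeff (C w) i) \<in> int_poly_fun E" "\<forall>w. degree (C w) \<le> n"
    and g: "\<forall>w. g w = poly (C' w) (w e)" "\<forall>i. (\<lambda>w. coeff (C' w) i) \<in> int_poly_fun E" "\<forall>w. degree (C' w) \<le> n'"
    by (elim exE conjE) (rule that)
  have "degree (C w + C' w) \<le> max n n'" for w
    using f(3) g(3) by (meson degree_add_le_max max.mono order_trans)
  then show ?case
    using f g by (intro exI[of _ "\<lambda>w. C w + C' w"] exI[of _ "max n n'"])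
      (auto intro: int_poly_fun.add)
next
  case (mult f g)
  then obtain C n C' n' where
    f: "\<forall>w. f w = poly (C w) (w e)" "\<forall>i. (\<lambda>w. coeff (C w) i) \<in> int_poly_fun E" "\<forall>w. degree (C w) \<le> n"
    and g: "\<forall>w. g w = poly (C' w) (w e)" "\<forall>i. (\<lambda>w. coeff (C' w) i) \<in> int_poly_fun E" "\<forall>w. degree (C' w) \<le> n'"
    by (elim exE conjE) (rule that)
  have "degree (C w * C' w) \<le> n + n'" for w
    using f(3) g(3) by (meson add_mono degree_mult_le order_trans)
  moreover have "(\<lambda>w. coeff (C w * C' w) i) \<in> int_poly_fun E" for i
    unfolding coeff_mult using f(2) g(2)
    by (intro int_poly_fun_sum int_poly_fun.mult) (simp_all)
  moreover have "f w * g w = poly (C w * C' w) (w e)" for w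
    using f(1) g(1) by simp
  ultimately show ?case by (intro exI[of _ "\<lambda>w. C w * C' w"] exI[of _ "n + n'"] conjI allI)
qed

section \<open>Counting residues modulo powers of p\<close>

definition residue_box :: "'p::prime_card itself \<Rightarrow> 'e set \<Rightarrow> nat \<Rightarrow> ('e \<Rightarrow> int) set"
  where "residue_box _ E s = (\<Pi>\<^sub>E e\<in>E. {0..<int CARD('p) ^ s})"

lemma finite_residue_box: "finite E \<Longrightarrow> finite (residue_box TYPE('p::prime_card) E s)"
  by (simp add: residue_box_def finite_PiE)

lemma card_residue_box:
  "finite E \<Longrightarrow> card (residue_box TYPE('p::prime_card) E s) = CARD('p) ^ (s * card E)"
  by (simp add: residue_box_def card_PiE power_mult nat_power_eq)

text \<open>Each coordinate is split into remainder and quotient modulo \<open>p ^ \<gamma>\<close>.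
  The remainders form an element of \<open>B\<close>, the quotients are arbitrary below
  \<open>p ^ (s - \<gamma>)\<close>.\<close>

lemma card_residue_box_mod:
  fixes A :: "('e \<Rightarrow> int) set"
  assumes E: "finite E" and \<gamma>: "\<gamma> \<le> s" and B: "B \<subseteq> residue_box TYPE('p::prime_card) E \<gamma>"
    and A: "A \<subseteq> residue_box TYPE('p) E s"
    and AB: "\<And>a. a \<in> A \<Longrightarrow> (\<lambda>e\<in>E. a e mod int CARD('p) ^ \<gamma>) \<in> B"
  shows "card A \<le> card B * CARD('p) ^ ((s - \<gamma>) * card E)"
proof -
  let ?p = "int CARD('p)"
  define \<phi> where "\<phi> a = ((\<lambda>e\<in>E. a e mod ?p ^ \<gamma>), (\<lambda>e\<in>E. a e div ?p ^ \<gamma>))" for a :: "'e \<Rightarrow> int"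
  have fin: "finite (B \<times> residue_box TYPE('p) E (s - \<gamma>))"
    using finite_subset[OF B] finite_residue_box[OF E] by blast
  have "\<phi> ` A \<subseteq> B \<times> residue_box TYPE('p) E (s - \<gamma>)"
  proof
    fix b assume "b \<in> \<phi> ` A"
    then obtain a where a: "a \<in> A" "b = \<phi> a" by blast
    have "a e div ?p ^ \<gamma> \<in> {0..<?p ^ (s - \<gamma>)}" if "e \<in> E" for e
    proof -
      have ae: "0 \<le> a e" "a e < ?p ^ s" using a A that by (auto simp: residue_box_def PiE_iff subset_iff)
      have "?p ^ s = ?p ^ \<gamma> * ?p ^ (s - \<gamma>)" using \<gamma> by (simp flip: power_add)
      moreover have "?p ^ \<gamma> * (a e div ?p ^ \<gamma>) \<le> a e"
      proof -
        have "0 \<le> a e mod ?p ^ \<gamma>" by simp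
        then show ?thesis using minus_mod_eq_mult_div[of "a e" "?p ^ \<gamma>"] by linarith
      qed
      ultimately have "?p ^ \<gamma> * (a e div ?p ^ \<gamma>) < ?p ^ \<gamma> * ?p ^ (s - \<gamma>)" using ae(2) by linarith
      then have "a e div ?p ^ \<gamma> < ?p ^ (s - \<gamma>)" by simp
      then show ?thesis using ae by (simp add: pos_imp_zdiv_nonneg_iff)
    qed
    then show "b \<in> B \<times> residue_box TYPE('p) E (s - \<gamma>)"
      using a AB by (auto simp: \<phi>_def residue_box_def PiE_iff)
  qed
  moreover have "inj_on \<phi> A"
  proof (rule inj_onI)
    fix a b assume ab: "a \<in> A" "b \<in> A" "\<phi> a = \<phi> b"
    have "a e = b e" if e: "e \<in> E" for e
    proof -
      have "a e mod ?p ^ \<gamma> = b e mod ?p ^ \<gamma>" "a e div ?p ^ \<gamma> = b e div ?p ^ \<gamma>"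
        using ab(3) e unfolding \<phi>_def by (auto dest!: fun_cong[of _ _ e])
      then show ?thesis by (metis div_mult_mod_eq)
    qed
    moreover have "a e = b e" if "e \<notin> E" for e
    proof -
      have *: "c e = undefined" if "c \<in> A" for c
        using A that \<open>e \<notin> E\<close> unfolding residue_box_def by (meson PiE_arb subsetD)
      show ?thesis by (simp add: *[OF ab(1)] *[OF ab(2)])
    qed
    ultimately show "a = b" by blast
  qed
  ultimately have "card A \<le> card (B \<times> residue_box TYPE('p) E (s - \<gamma>))"
    using fin by (metis card_image card_mono)
  then show ?thesis using E by (simp add: card_cartesian_product card_residue_box)
qed

text \<open>A residue near a point of \<open>X\<close> reduces modulo \<open>p ^ t\<close> to the
  residue of that point. A single coordinate is treated as a box over \<open>{()}\<close>.\<close>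

lemma card_residues_near:
  fixes X :: "'p::prime_card padic_int set"
  assumes X: "finite X" and t: "t \<le> s"
    and A: "A \<subseteq> {0..<int CARD('p) ^ s}"
    and near: "\<And>a. a \<in> A \<Longrightarrow> \<exists>x\<in>X. p_elem ^ t dvd of_int a - x"
  shows "card A \<le> card X * CARD('p) ^ (s - t)"
proof -
  let ?p = "int CARD('p)"
  define B where "B = (\<lambda>x. \<lambda>_\<in>{()}. residue x t) ` X"
  have "card ((\<lambda>a. \<lambda>_\<in>{()}. a) ` A) \<le> card B * CARD('p) ^ ((s - t) * card {()})"
  proof (rule card_residue_box_mod)
    show "B \<subseteq> residue_box TYPE('p) {()} t"
      unfolding B_def residue_box_def using residue_range[where 'p = 'p] by (auto simp: PiE_iff)
    show "(\<lambda>a. \<lambda>_\<in>{()}. a) ` A \<subseteq> residue_box TYPE('p) {()} s"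
      unfolding residue_box_def using A by (auto simp: PiE_iff)
    fix b assume "b \<in> (\<lambda>a. \<lambda>_\<in>{()}. a) ` A"
    then obtain a where a: "a \<in> A" "b = (\<lambda>_\<in>{()}. a)" by blast
    obtain x where x: "x \<in> X" "p_elem ^ t dvd of_int a - x" using near[OF a(1)] by blast
    then have "p_elem ^ t dvd (of_int a - x) + (x - of_int (residue x t))"
      by (intro dvd_add p_power_dvd_diff_residue)
    then have "p_elem ^ t dvd (of_int (a - residue x t) :: 'p padic_int)" by simp
    then have "?p ^ t dvd a - residue x t" by (simp only: p_power_dvd_of_int_iff)
    then have "a mod ?p ^ t = residue x t"
      using residue_mod[of t t x] by (metis mod_eq_dvd_iff order_refl)
    then show "(\<lambda>e\<in>{()}. b e mod ?p ^ t) \<in> B"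
      unfolding B_def using x(1) by (auto simp: a(2) intro!: image_eqI[of _ _ x])
  qed (use t in auto)
  moreover have "card ((\<lambda>a. \<lambda>_\<in>{()}. a) ` A) = card A"
    by (rule card_image) (auto simp: inj_on_def restrict_def fun_eq_iff)
  moreover have "card B \<le> card X" unfolding B_def using X by (rule card_image_le)
  ultimately show ?thesis
    using order_trans[OF _ mult_le_mono1[of "card B" "card X" "CARD('p) ^ (s - t)"]] by simp
qed

text \<open>Approximate zeros: residues of an integral zero of \<open>f\<close> belong to this
  finite set for every \<open>s\<close>, so its size bounds the number of balls needed to cover the
  integral zeros.\<close>

definition zero_residues :: "'e set \<Rightarrow> nat \<Rightarrow> (('e \<Rightarrow> 'p::prime_card padic_int) \<Rightarrow> 'p padic_int) \<Rightarrow> ('e \<Rightarrow> int) set"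
  where "zero_residues E s f = {a \<in> residue_box TYPE('p) E s. p_elem ^ s dvd f (\<lambda>e. of_int (a e))}"

lemma zero_residues_density:
  fixes f :: "('e \<Rightarrow> 'p::prime_card padic_int) \<Rightarrow> 'p padic_int"
  assumes "finite E" and "f \<in> int_poly_fun E" and "f w \<noteq> 0" and "\<eta> > 0"
  shows "\<exists>s0. \<forall>s\<ge>s0. real (card (zero_residues E s f)) \<le> \<eta> * real CARD('p) ^ (s * card E)"
  using assms
proof (induction E arbitrary: f w \<eta> rule: finite_induct)
  case empty
  obtain s0 where s0: "\<not> p_elem ^ s0 dvd f w" using empty(2) by (rule ex_not_p_power_dvd)
  have const: "f v = f w" for v
    using int_poly_fun_cong[OF empty(1), of 0 v w] by simp
  have "\<not> p_elem ^ s dvd f v" if "s \<ge> s0" for s v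
  proof
    assume "p_elem ^ s dvd f v"
    then have "p_elem ^ s0 dvd f v" using that by (rule power_le_dvd)
    with s0 const[of v] show False by simp
  qed
  then have "zero_residues {} s f = {}" if "s \<ge> s0" for s
    using that by (simp add: zero_residues_def)
  then show ?case using empty(3) by (intro exI[of _ s0]) auto
next
  case (insert e E)
  let ?p = "int CARD('p)" and ?q = "real CARD('p)"
  have p1: "1 < CARD('p)" using prime_card[where ?'a = 'p] prime_gt_1_nat by blast
  obtain C n0 where C: "\<forall>w. f w = poly (C w) (w e)"
    "\<forall>i. (\<lambda>w. coeff (C w) i) \<in> int_poly_fun E" "\<forall>w. degree (C w) \<le> n0"
    using int_poly_fun_insert[OF insert.prems(1)] by (elim exE conjE) (rule that)
  \<comment> \<open>The largest exponent whose coefficient is not identically zero;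
    \<open>f w \<noteq> 0\<close> provides one. The degree may drop at particular points, so it
    cannot replace \<open>n\<close>.\<close>
  define n where "n = (GREATEST n. \<exists>v. coeff (C v) n \<noteq> 0)"
  have bound: "n' \<le> n0" if "\<exists>v. coeff (C v) n' \<noteq> 0" for n'
    using that C(3) by (metis le_degree order_trans)
  have "C w \<noteq> 0" using insert.prems(2) C(1) by auto
  then have "\<exists>n v. coeff (C v) n \<noteq> 0" by (metis leading_coeff_0_iff)
  then have "\<exists>v. coeff (C v) n \<noteq> 0"
    unfolding n_def by (rule GreatestI_ex_nat[where b = n0]) (rule bound)
  then obtain v where v: "coeff (C v) n \<noteq> 0" by blast
  have deg: "degree (C v) \<le> n" for v
  proof (rule degree_le, intro allI impI)
    fix i assume "n < i"
    then show "coeff (C v) i = 0"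
      unfolding n_def using bound Greatest_le_nat[of "\<lambda>n. \<exists>v. coeff (C v) n \<noteq> 0" i n0] by force
  qed
  define c where "c v = coeff (C v) n" for v
  have c: "c \<in> int_poly_fun E" using C(2) by (simp add: c_def[abs_def])
  have "\<eta> / 2 > 0" using insert.prems(3) by simp
  from insert.IH[OF c v[folded c_def] this] obtain \<gamma> where
    \<gamma>: "real (card (zero_residues E \<gamma> c)) \<le> \<eta> / 2 * ?q ^ (\<gamma> * card E)" by blast
  have "(\<lambda>t. real n * (1 / ?q) ^ t) \<longlonglongrightarrow> real n * 0"
    using p1 by (intro tendsto_mult tendsto_const LIMSEQ_power_zero) auto
  then have "eventually (\<lambda>t. real n * (1 / ?q) ^ t < \<eta> / 2) sequentially"
    using insert.prems(3) by (intro order_tendstoD(2)) auto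
  then obtain t where t: "real n * (1 / ?q) ^ t < \<eta> / 2" by (auto simp: eventually_sequentially)
  \<comment> \<open>The part \<open>\<gamma> + n * t\<close> is what
    \<open>approximate_zeros\<close> requires; the additional \<open>t\<close> ensures
    \<open>t \<le> s\<close> also when \<open>n = 0\<close>.\<close>
  show ?case
  proof (intro exI[of _ "\<gamma> + n * t + t"] allI impI)
    fix s assume s: "\<gamma> + n * t + t \<le> s"
    let ?N = "zero_residues (insert e E) s f"
    define A where "A = {a \<in> residue_box TYPE('p) E s. p_elem ^ \<gamma> dvd c (\<lambda>e. of_int (a e))}"
    have "card A \<le> card (zero_residues E \<gamma> c) * CARD('p) ^ ((s - \<gamma>) * card E)"
    proof (rule card_residue_box_mod)
      show "zero_residues E \<gamma> c \<subseteq> residue_box TYPE('p) E \<gamma>" by (auto simp: zero_residues_def)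
      fix a assume a: "a \<in> A"
      let ?a = "\<lambda>e\<in>E. a e mod ?p ^ \<gamma>"
      have "p_elem ^ \<gamma> dvd c (\<lambda>e. of_int (a e)) - c (\<lambda>e. of_int (?a e))"
      proof (rule int_poly_fun_cong[OF c])
        fix d assume "d \<in> E"
        then have "?p ^ \<gamma> dvd a d - ?a d" by (simp add: minus_mod_eq_mult_div)
        then have "p_elem ^ \<gamma> dvd (of_int (a d - ?a d) :: 'p padic_int)"
          by (simp only: p_power_dvd_of_int_iff)
        then show "p_elem ^ \<gamma> dvd (of_int (a d) - of_int (?a d) :: 'p padic_int)" by simp
      qed
      then have "p_elem ^ \<gamma> dvd c (\<lambda>e. of_int (?a e))"
        using dvd_diff[of _ "c (\<lambda>e. of_int (a e))"] a unfolding A_def by fastforce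
      moreover have "?a \<in> residue_box TYPE('p) E \<gamma>"
        using p1 by (auto simp: residue_box_def PiE_iff)
      ultimately show "?a \<in> zero_residues E \<gamma> c" by (simp add: zero_residues_def)
    qed (use insert.hyps s in \<open>auto simp: A_def\<close>)
    then have A: "real (card A) \<le> \<eta> / 2 * ?q ^ (s * card E)"
    proof -
      assume "card A \<le> card (zero_residues E \<gamma> c) * CARD('p) ^ ((s - \<gamma>) * card E)"
      then have "real (card A) \<le> real (card (zero_residues E \<gamma> c)) * ?q ^ ((s - \<gamma>) * card E)"
        by (metis of_nat_le_iff of_nat_mult of_nat_power)
      also have "\<dots> \<le> \<eta> / 2 * ?q ^ (\<gamma> * card E) * ?q ^ ((s - \<gamma>) * card E)"
        using \<gamma> by (intro mult_right_mono) auto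
      also have "\<dots> = \<eta> / 2 * ?q ^ (s * card E)"
        using s by (simp add: mult.assoc flip: power_add distrib_right)
      finally show ?thesis .
    qed
    define F where "F a = {x \<in> {0..<?p ^ s}. p_elem ^ s dvd poly (C (\<lambda>e. of_int (a e))) (of_int x)}" for a :: "'e \<Rightarrow> int"
    have F: "card (F a) \<le> n * CARD('p) ^ (s - t)" if nz: "\<not> p_elem ^ \<gamma> dvd c (\<lambda>e. of_int (a e))" for a
    proof -
      obtain X where X: "finite X" "card X \<le> n"
        "\<forall>x. p_elem ^ s dvd poly (C (\<lambda>e. of_int (a e))) x \<longrightarrow> (\<exists>x0\<in>X. p_elem ^ t dvd x - x0)"
        using approximate_zeros[OF deg nz[unfolded c_def], of t s] s by auto
      have "card (F a) \<le> card X * CARD('p) ^ (s - t)"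
        by (rule card_residues_near[OF X(1)]) (use X(3) s in \<open>auto simp: F_def\<close>)
      then show ?thesis using X(2) by (meson mult_le_mono1 order_trans)
    qed
    define G where "G = Sigma (residue_box TYPE('p) E s) (\<lambda>a. if a \<in> A then {0..<?p ^ s} else F a)"
    have finF: "finite (F a)" for a
      unfolding F_def by (rule finite_subset[of _ "{0..<?p ^ s}"]) auto
    have finB: "finite (residue_box TYPE('p) E s)" using insert.hyps(1) by (rule finite_residue_box)
    have "card ?N \<le> card G"
    proof (rule card_inj_on_le)
      show "inj_on (\<lambda>a. (restrict a E, a e)) ?N"
      proof (rule inj_onI)
        fix a b assume "a \<in> ?N" "b \<in> ?N" and eq: "(restrict a E, a e) = (restrict b E, b e)"
        then have "a \<in> extensional (insert e E)" "b \<in> extensional (insert e E)"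
          by (auto simp: zero_residues_def residue_box_def PiE_iff)
        moreover have "a d = b d" if "d \<in> insert e E" for d
          using eq that by (auto simp: restrict_def fun_eq_iff split: if_splits)
        ultimately show "a = b" by (rule extensionalityI)
      qed
      show "finite G" unfolding G_def using finB finF by auto
      show "(\<lambda>a. (restrict a E, a e)) ` ?N \<subseteq> G"
      proof (rule image_subsetI)
        fix a assume a: "a \<in> ?N"
        have box: "restrict a E \<in> residue_box TYPE('p) E s" "a e \<in> {0..<?p ^ s}"
          using a by (auto simp: zero_residues_def residue_box_def PiE_iff)
        \<comment> \<open>Modulus zero: the coefficients do not see the coordinate \<open>e\<close>,
          so restricting to \<open>E\<close> changes nothing.\<close>
        have "coeff (C (\<lambda>e. of_int (a e))) i = coeff (C (\<lambda>d. of_int (restrict a E d))) i" for i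
          using int_poly_fun_cong[OF C(2)[rule_format, of i], of 0 "\<lambda>e. of_int (a e)" "\<lambda>d. of_int (restrict a E d)"]
          by simp
        then have "C (\<lambda>e. of_int (a e)) = C (\<lambda>d. of_int (restrict a E d))" by (rule poly_eqI)
        then have "a e \<in> F (restrict a E)"
          using a box(2) C(1) by (simp add: F_def zero_residues_def)
        then show "(restrict a E, a e) \<in> G" unfolding G_def using box by auto
      qed
    qed
    also have "card G = (\<Sum>a\<in>residue_box TYPE('p) E s. card (if a \<in> A then {0..<?p ^ s} else F a))"
      unfolding G_def using finB finF by (intro card_SigmaI) auto
    also have "\<dots> \<le> (\<Sum>a\<in>residue_box TYPE('p) E s. (if a \<in> A then CARD('p) ^ s else 0) + n * CARD('p) ^ (s - t))"
      using F by (intro sum_mono) (auto simp: A_def nat_power_eq)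
    also have "\<dots> = card A * CARD('p) ^ s + CARD('p) ^ (s * card E) * (n * CARD('p) ^ (s - t))"
    proof -
      have "(\<Sum>a\<in>residue_box TYPE('p) E s. if a \<in> A then CARD('p) ^ s else 0) = card A * CARD('p) ^ s"
        using finB by (subst sum.inter_restrict[symmetric]) (auto simp: A_def Int_def intro!: arg_cong[of _ _ card])
      then show ?thesis using insert.hyps by (simp add: sum.distrib card_residue_box)
    qed
    finally have "real (card ?N) \<le> real (card A * CARD('p) ^ s + CARD('p) ^ (s * card E) * (n * CARD('p) ^ (s - t)))"
      by (rule of_nat_mono)
    also have "\<dots> = real (card A) * ?q ^ s + ?q ^ (s * card E) * (real n * ?q ^ (s - t))" by simp
    also have "\<dots> \<le> (\<eta> / 2 * ?q ^ (s * card E)) * ?q ^ s + ?q ^ (s * card E) * (\<eta> / 2 * ?q ^ s)"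
    proof (intro add_mono mult_left_mono mult_right_mono A)
      have "?q ^ (s - t) = (1 / ?q) ^ t * ?q ^ s" using s p1 by (simp add: power_diff power_one_over)
      then have "real n * ?q ^ (s - t) = (real n * (1 / ?q) ^ t) * ?q ^ s" by simp
      also have "\<dots> \<le> \<eta> / 2 * ?q ^ s" using t by (intro mult_right_mono) auto
      finally show "real n * ?q ^ (s - t) \<le> \<eta> / 2 * ?q ^ s" .
    qed auto
    also have "\<dots> = \<eta> * ?q ^ (s * card (insert e E))"
      using insert.hyps by (simp add: power_add)
    finally show "real (card ?N) \<le> \<eta> * ?q ^ (s * card (insert e E))" .
  qed
qed

section \<open>Null sets\<close>

text \<open>In the extended nonnegative reals a divergent series has sum \<open>top\<close>, so
  summability is absorbed into the strict bound and double series can be rearranged freely.\<close>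

lemma haar_null_iff:
  fixes A :: "('e \<Rightarrow> 'p::prime_card padic) set"
  shows "haar_null E A \<longleftrightarrow> (\<forall>\<eta>>0. \<exists>c r. A \<subseteq> (\<Union>n::nat. padic_ball E (c n) (r n)) \<and>
    suminf (\<lambda>n. ennreal ((1 / real CARD('p)) ^ (r n * card E))) < ennreal \<eta>)"
proof -
  have eq: "summable (\<lambda>n. (1 / real CARD('p)) ^ (r n * card E)) \<and>
      suminf (\<lambda>n. (1 / real CARD('p)) ^ (r n * card E)) < \<eta> \<longleftrightarrow>
      suminf (\<lambda>n. ennreal ((1 / real CARD('p)) ^ (r n * card E))) < ennreal \<eta>" (is "?S \<and> ?s < _ \<longleftrightarrow> ?e < _")
    if "\<eta> > 0" for r :: "nat \<Rightarrow> nat" and \<eta> :: real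
  proof (cases ?S)
    case True
    then have "?e = ennreal ?s" by (intro suminf_ennreal2) auto
    moreover have "0 \<le> ?s" using True by (intro suminf_nonneg) auto
    ultimately show ?thesis using True by (simp add: ennreal_less_iff)
  next
    case False
    have "?e = Orderings.top"
    proof (rule ccontr)
      assume "?e \<noteq> Orderings.top"
      then have ?S by (intro summable_suminf_not_top) simp_all
      with False show False by blast
    qed
    then show ?thesis using False by simp
  qed
  show ?thesis unfolding haar_null_def by (simp add: eq)
qed

lemma haar_null_subset: "haar_null E B \<Longrightarrow> A \<subseteq> B \<Longrightarrow> haar_null E A"
  unfolding haar_null_def by (meson order_trans)

lemma haar_null_UN:
  fixes A :: "nat \<Rightarrow> ('e \<Rightarrow> 'p::prime_card padic) set"
  assumes "\<And>l. haar_null E (A l)"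
  shows "haar_null E (\<Union>l. A l)"
  unfolding haar_null_iff
proof (intro allI impI)
  fix \<eta> :: real assume \<eta>: "\<eta> > 0"
  let ?m = "\<lambda>r. ennreal ((1 / real CARD('p)) ^ (r * card E))"
  \<comment> \<open>The allowances \<open>\<eta> / 4 * (1 / 2) ^ l\<close> add up to
    \<open>\<eta> / 2\<close>, which leaves the final inequality strict.\<close>
  have "\<exists>c r. A l \<subseteq> (\<Union>n::nat. padic_ball E (c n) (r n)) \<and>
      suminf (\<lambda>n. ?m (r n)) < ennreal (\<eta> / 4 * (1 / 2) ^ l)" for l
    using assms[of l] \<eta> unfolding haar_null_iff by simp
  then have "\<forall>l. \<exists>cr. A l \<subseteq> (\<Union>n::nat. padic_ball E (fst cr n) (snd cr n)) \<and>
      suminf (\<lambda>n. ?m (snd cr n)) < ennreal (\<eta> / 4 * (1 / 2) ^ l)"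
    by simp
  from choice[OF this] obtain cr where
    cr: "\<forall>l. A l \<subseteq> (\<Union>n::nat. padic_ball E (fst (cr l) n) (snd (cr l) n)) \<and>
      suminf (\<lambda>n. ?m (snd (cr l) n)) < ennreal (\<eta> / 4 * (1 / 2) ^ l)" ..
  define c where "c l = fst (cr l)" for l
  define r where "r l = snd (cr l)" for l
  have c: "A l \<subseteq> (\<Union>n. padic_ball E (c l n) (r l n))"
    and r: "suminf (\<lambda>n. ?m (r l n)) < ennreal (\<eta> / 4 * (1 / 2) ^ l)" for l
    using cr by (simp_all add: c_def r_def)
  define c' where "c' n = (case prod_decode n of (l, i) \<Rightarrow> c l i)" for n
  define r' where "r' n = (case prod_decode n of (l, i) \<Rightarrow> r l i)" for n
  have "(\<Union>l. A l) \<subseteq> (\<Union>n. padic_ball E (c' n) (r' n))"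
  proof
    fix x assume "x \<in> (\<Union>l. A l)"
    then obtain l n where "x \<in> padic_ball E (c l n) (r l n)" using c by blast
    then have "x \<in> padic_ball E (c' (prod_encode (l, n))) (r' (prod_encode (l, n)))"
      by (simp add: c'_def r'_def)
    then show "x \<in> (\<Union>n. padic_ball E (c' n) (r' n))" by blast
  qed
  moreover have "suminf (\<lambda>n. ?m (r' n)) < ennreal \<eta>"
  proof -
    have "suminf (\<lambda>n. ?m (r' n)) = suminf (\<lambda>n. (\<lambda>(l, i). ?m (r l i)) (prod_decode n))"
      by (simp add: r'_def case_prod_beta)
    also have "\<dots> = suminf (\<lambda>l. suminf (\<lambda>i. ?m (r l i)))" by (rule suminf_ennreal_2dimen) simp
    also have "\<dots> \<le> suminf (\<lambda>l. ennreal (\<eta> / 4 * (1 / 2) ^ l))"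
      using r by (intro suminf_le summableI) (auto intro: less_imp_le)
    also have "\<dots> = ennreal (suminf (\<lambda>l. \<eta> / 4 * (1 / 2) ^ l))"
      using \<eta> by (intro suminf_ennreal2 summable_mult summable_geometric) auto
    also have "suminf (\<lambda>l. \<eta> / 4 * (1 / 2) ^ l) = \<eta> / 2"
      by (subst suminf_mult) (auto simp: suminf_geometric)
    also have "ennreal (\<eta> / 2) < ennreal \<eta>" using \<eta> by (simp add: ennreal_less_iff)
    finally show ?thesis .
  qed
  ultimately show "\<exists>c r. (\<Union>l. A l) \<subseteq> (\<Union>n. padic_ball E (c n) (r n)) \<and>
      suminf (\<lambda>n. ?m (r n)) < ennreal \<eta>" by blast
qed

lemma haar_null_Un:
  assumes "haar_null E A" "haar_null E B"
  shows "haar_null E (A \<union> B)"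
proof -
  have "haar_null E (\<Union>l::nat. if l = 0 then A else B)" by (rule haar_null_UN) (use assms in auto)
  then show ?thesis by (rule haar_null_subset) (auto intro: exI[of _ 0] exI[of _ 1])
qed

lemma prime_card_ge_2: "2 \<le> real CARD('p::prime_card)"
  using prime_card[where ?'a = 'p] prime_ge_2_nat[of "CARD('p)"] by simp

text \<open>A sequence of balls has to be completed by balls of positive but summable radii.\<close>

lemma finite_cover_completion:
  fixes A :: "('e \<Rightarrow> 'p::prime_card padic) set"
  assumes E: "finite E" "E \<noteq> {}" and C: "finite C" "A \<subseteq> (\<Union>c\<in>C. padic_ball E c r)"
    and small: "real (card C) * (1 / real CARD('p)) ^ (r * card E) < \<eta>"
  shows "\<exists>c r. A \<subseteq> (\<Union>n::nat. padic_ball E (c n) (r n)) \<and>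
    summable (\<lambda>n. (1 / real CARD('p)) ^ (r n * card E)) \<and>
    suminf (\<lambda>n. (1 / real CARD('p)) ^ (r n * card E)) < \<eta>"
proof -
  let ?q = "1 / real CARD('p)"
  define N where "N = card C"
  define \<tau> where "\<tau> = real N * ?q ^ (r * card E)"
  have q: "0 \<le> ?q" "?q \<le> 1 / 2" using prime_card_ge_2[where 'p = 'p] by (auto simp: field_simps)
  obtain h where h: "bij_betw h {0..<N} C" using C(1) ex_bij_betw_nat_finite N_def by blast
  have "(\<lambda>R. 2 * (1 / 2 :: real) ^ R) \<longlonglongrightarrow> 2 * 0"
    by (intro tendsto_mult tendsto_const LIMSEQ_power_zero) auto
  then have "eventually (\<lambda>R. 2 * (1 / 2 :: real) ^ R < \<eta> - \<tau>) sequentially"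
    by (rule order_tendstoD(2)) (use small in \<open>simp add: \<tau>_def N_def\<close>)
  then obtain R where R: "2 * (1 / 2 :: real) ^ R < \<eta> - \<tau>" by (auto simp: eventually_sequentially)
  \<comment> \<open>Beyond the \<open>N\<close> given balls the exponents \<open>n + R\<close> are
    used, with arbitrary centres. As \<open>E\<close> is nonempty and \<open>p\<close> at least 2,
    these balls have measure at most \<open>(1 / 2) ^ (n + R)\<close>, together at most
    \<open>2 * (1 / 2) ^ R\<close>.\<close>
  define r' where "r' n = (if n < N then r else n + R)" for n
  define g where "g n = (if n \<in> {..<N} then ?q ^ (r * card E) else 0) + (1 / 2) ^ R * (1 / 2 :: real) ^ n" for n
  have "(\<lambda>n. (1 / 2) ^ R * (1 / 2 :: real) ^ n) sums ((1 / 2) ^ R * 2)"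
    using geometric_sums[of "1 / 2 :: real"] by (intro sums_mult) simp
  moreover have "(\<lambda>n. if n \<in> {..<N} then ?q ^ (r * card E) else 0) sums (\<Sum>n<N. ?q ^ (r * card E))"
    by (rule sums_If_finite_set) simp
  ultimately have g: "g sums (\<tau> + (1 / 2) ^ R * 2)"
    unfolding g_def[abs_def] \<tau>_def by (intro sums_add) simp_all
  have le: "?q ^ (r' n * card E) \<le> g n" for n
  proof (cases "n < N")
    case False
    have "card E \<ge> 1" using E by (simp add: Suc_leI card_gt_0_iff)
    then have "n + R \<le> (n + R) * card E" by simp
    then have "?q ^ ((n + R) * card E) \<le> ?q ^ (n + R)" using q by (intro power_decreasing) auto
    also have "\<dots> \<le> (1 / 2) ^ (n + R)" using q by (intro power_mono) auto
    finally show ?thesis using False by (simp add: r'_def g_def power_add mult.commute)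
  qed (simp add: r'_def g_def)
  have sm: "summable (\<lambda>n. ?q ^ (r' n * card E))"
    by (rule summable_comparison_test'[OF sums_summable[OF g], of 0]) (use le in auto)
  have "suminf (\<lambda>n. ?q ^ (r' n * card E)) \<le> suminf g"
    using le sm g by (intro suminf_le) (auto simp: sums_iff)
  also have "\<dots> < \<eta>" using sums_unique[OF g] R by simp
  finally have "suminf (\<lambda>n. ?q ^ (r' n * card E)) < \<eta>" .
  moreover have "A \<subseteq> (\<Union>n. padic_ball E (h n) (r' n))"
  proof
    fix x assume "x \<in> A"
    then obtain c where c: "c \<in> C" "x \<in> padic_ball E c r" using C(2) by blast
    then obtain n where "n < N" "h n = c" using h by (auto simp: bij_betw_def)
    then have "x \<in> padic_ball E (h n) (r' n)" using c(2) by (simp add: r'_def)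
    then show "x \<in> (\<Union>n. padic_ball E (h n) (r' n))" by blast
  qed
  ultimately show ?thesis using sm by blast
qed

lemma poly_fun_scale: "f \<in> poly_fun E \<Longrightarrow> (\<lambda>w. f (\<lambda>e. c * w e)) \<in> poly_fun E"
  by (induction rule: poly_fun.induct) (auto intro: poly_fun.intros)

lemma poly_fun_cong:
  assumes "f \<in> poly_fun E" and vw: "\<And>e. e \<in> E \<Longrightarrow> v e = w e"
  shows "f v = f w"
  using assms(1) by induction (simp_all add: vw)

lemma poly_fun_clear_denominators:
  fixes f :: "('e \<Rightarrow> 'p::prime_card padic) \<Rightarrow> 'p padic"
  assumes "f \<in> poly_fun E"
  shows "\<exists>b g. b \<noteq> 0 \<and> g \<in> int_poly_fun E \<and>
    (\<forall>w. to_fract b * f (\<lambda>e. to_fract (w e)) = to_fract (g w))"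
  using assms
proof induction
  case (const c)
  obtain a b where c: "c = Fract a b" "b \<noteq> 0" by (cases c) auto
  then have "to_fract b * c = to_fract a" by (simp add: to_fract_def eq_fract)
  then show ?case using c(2) by (intro exI[of _ b] exI[of _ "\<lambda>_. a"]) (auto intro: int_poly_fun.const)
next
  case (var e)
  then show ?case by (intro exI[of _ 1] exI[of _ "\<lambda>w. w e"]) (auto intro: int_poly_fun.var)
next
  case (add f f')
  then obtain b g b' g' where b: "b \<noteq> 0" "b' \<noteq> 0" and g: "g \<in> int_poly_fun E" "g' \<in> int_poly_fun E"
    and eq: "\<forall>w. to_fract b * f (\<lambda>e. to_fract (w e)) = to_fract (g w)"
    "\<forall>w. to_fract b' * f' (\<lambda>e. to_fract (w e)) = to_fract (g' w)"
    by (elim exE conjE) (rule that)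
  have "to_fract (b * b') * (f (\<lambda>e. to_fract (w e)) + f' (\<lambda>e. to_fract (w e)))
      = to_fract (b' * g w + b * g' w)" for w
    by (simp add: eq[rule_format, symmetric] algebra_simps)
  moreover have "(\<lambda>w. b' * g w + b * g' w) \<in> int_poly_fun E"
    using g by (intro int_poly_fun.add int_poly_fun.mult int_poly_fun.const)
  ultimately show ?case using b by (intro exI[of _ "b * b'"] exI[of _ "\<lambda>w. b' * g w + b * g' w"]) simp
next
  case (mult f f')
  then obtain b g b' g' where b: "b \<noteq> 0" "b' \<noteq> 0" and g: "g \<in> int_poly_fun E" "g' \<in> int_poly_fun E"
    and eq: "\<forall>w. to_fract b * f (\<lambda>e. to_fract (w e)) = to_fract (g w)"
    "\<forall>w. to_fract b' * f' (\<lambda>e. to_fract (w e)) = to_fract (g' w)"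
    by (elim exE conjE) (rule that)
  have "to_fract (b * b') * (f (\<lambda>e. to_fract (w e)) * f' (\<lambda>e. to_fract (w e)))
      = to_fract (g w * g' w)" for w
    by (simp add: eq[rule_format, symmetric] algebra_simps)
  moreover have "(\<lambda>w. g w * g' w) \<in> int_poly_fun E" using g by (intro int_poly_fun.mult)
  ultimately show ?case using b by (intro exI[of _ "b * b'"] exI[of _ "\<lambda>w. g w * g' w"]) simp
qed

text \<open>Multiplication by \<open>p ^ t\<close> makes the points integral, and clearing
  denominators turns \<open>f\<close> into an integral polynomial \<open>g\<close>. Each approximate
  zero of \<open>g\<close> modulo \<open>p ^ s\<close> gives, after scaling back, one ball of
  exponent \<open>s - t\<close>. The point \<open>w0\<close> shows that \<open>g\<close> is not
  identically zero.\<close>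

lemma haar_null_zeros_bounded:
  fixes f :: "('e \<Rightarrow> 'p::prime_card padic) \<Rightarrow> 'p padic"
  assumes E: "finite E" "E \<noteq> {}" and f: "f \<in> poly_fun E" and w0: "f w0 \<noteq> 0"
    and z0: "\<And>e. e \<in> E \<Longrightarrow> \<exists>z. w0 e * of_nat CARD('p) ^ t = to_fract z"
  shows "haar_null E {w. f w = 0 \<and> (\<forall>e\<in>E. \<exists>z. w e * of_nat CARD('p) ^ t = to_fract z)}"
  unfolding haar_null_def
proof (intro allI impI)
  fix \<eta> :: real assume \<eta>: "\<eta> > 0"
  let ?P = "of_nat CARD('p) :: 'p padic" and ?q = "real CARD('p)" and ?d = "card E"
  let ?A = "{w. f w = 0 \<and> (\<forall>e\<in>E. \<exists>z. w e * ?P ^ t = to_fract z)}"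
  have P: "?P = to_fract p_elem" by (simp add: to_fract_of_nat)
  have P0: "?P \<noteq> 0" unfolding P by (simp only: to_fract_eq_0_iff p_elem_neq_0 not_False_eq_True)
  have q0: "?q > 0" using prime_card_ge_2[where 'p = 'p] by linarith
  obtain b g where b: "b \<noteq> 0" and g: "g \<in> int_poly_fun E"
    and bg: "\<forall>w. to_fract b * f (\<lambda>e. 1 / ?P ^ t * to_fract (w e)) = to_fract (g w)"
    using poly_fun_clear_denominators[OF poly_fun_scale[OF f, of "1 / ?P ^ t"]]
    by (elim exE conjE) (rule that)
  have g_eq: "to_fract (g z) = to_fract b * f w" if "\<And>e. e \<in> E \<Longrightarrow> w e * ?P ^ t = to_fract (z e)" for w z
  proof -
    have "f (\<lambda>e. 1 / ?P ^ t * to_fract (z e)) = f w"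
      using f by (rule poly_fun_cong) (simp add: that[symmetric] P0)
    then show ?thesis using bg[rule_format, of z] by simp
  qed
  obtain z where z: "\<And>e. e \<in> E \<Longrightarrow> w0 e * ?P ^ t = to_fract (z e)" using z0 by metis
  have "to_fract (g z) \<noteq> 0" using g_eq[of w0 z] z b w0 by simp
  then have gz: "g z \<noteq> 0" by simp
  \<comment> \<open>The factor \<open>?q ^ (t * ?d)\<close> is the volume of the set of points with
    denominator \<open>p ^ t\<close>; the half keeps the bound strict.\<close>
  define \<eta>' where "\<eta>' = \<eta> / 2 / ?q ^ (t * ?d)"
  have "\<eta>' > 0" using \<eta> q0 by (simp add: \<eta>'_def)
  from zero_residues_density[OF E(1) g gz this] obtain s0 where
    s0: "\<And>s. s \<ge> s0 \<Longrightarrow> real (card (zero_residues E s g)) \<le> \<eta>' * ?q ^ (s * ?d)" by blast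
  define s where "s = max s0 t"
  define ctr where "ctr a = (\<lambda>e. of_int (a e) / ?P ^ t)" for a :: "'e \<Rightarrow> int"
  let ?C = "ctr ` zero_residues E s g"
  show "\<exists>c r. ?A \<subseteq> (\<Union>n. padic_ball E (c n) (r n)) \<and>
      summable (\<lambda>n. (1 / ?q) ^ (r n * ?d)) \<and> suminf (\<lambda>n. (1 / ?q) ^ (r n * ?d)) < \<eta>"
  proof (rule finite_cover_completion[OF E])
    have fin: "finite (zero_residues E s g)"
      unfolding zero_residues_def
      by (rule finite_subset[OF _ finite_residue_box[OF E(1), where 'p = 'p, of s]]) auto
    then show "finite ?C" by simp
    have "real (card ?C) \<le> real (card (zero_residues E s g))"
      using fin by (simp add: card_image_le)
    also have "\<dots> \<le> \<eta>' * ?q ^ (s * ?d)" by (rule s0) (simp add: s_def)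
    finally have "real (card ?C) * (1 / ?q) ^ ((s - t) * ?d) \<le> \<eta>' * ?q ^ (s * ?d) * (1 / ?q) ^ ((s - t) * ?d)"
      using q0 by (intro mult_right_mono) auto
    also have "?q ^ (s * ?d) = ?q ^ (t * ?d) * ?q ^ ((s - t) * ?d)"
      by (simp add: s_def flip: power_add distrib_right)
    also have "\<eta>' * (?q ^ (t * ?d) * ?q ^ ((s - t) * ?d)) * (1 / ?q) ^ ((s - t) * ?d) = \<eta> / 2"
      using q0 by (simp add: \<eta>'_def power_one_over)
    also have "\<eta> / 2 < \<eta>" using \<eta> by simp
    finally show "real (card ?C) * (1 / ?q) ^ ((s - t) * ?d) < \<eta>" .
    show "?A \<subseteq> (\<Union>c\<in>?C. padic_ball E c (s - t))"
    proof
      fix w assume w: "w \<in> ?A"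
      then have "\<forall>e\<in>E. \<exists>z. w e * ?P ^ t = to_fract z" by simp
      then obtain z where z: "\<And>e. e \<in> E \<Longrightarrow> w e * ?P ^ t = to_fract (z e)" by metis
      define a where "a = (\<lambda>e\<in>E. residue (z e) s)"
      have "to_fract (g z) = 0" using g_eq[of w z] z w by simp
      then have "g z = 0" by simp
      moreover have diff: "p_elem ^ s dvd z e - of_int (a e)" if "e \<in> E" for e
        using that p_power_dvd_diff_residue by (simp add: a_def)
      have "p_elem ^ s dvd of_int (a e) - z e" if "e \<in> E" for e
        using diff[OF that] by (metis dvd_minus_iff minus_diff_eq)
      then have "p_elem ^ s dvd g (\<lambda>e. of_int (a e)) - g z" by (rule int_poly_fun_cong[OF g])
      ultimately have "p_elem ^ s dvd g (\<lambda>e. of_int (a e))" by simp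
      moreover have "a \<in> residue_box TYPE('p) E s"
        unfolding a_def residue_box_def using residue_range[where 'p = 'p] by (auto simp: PiE_iff)
      ultimately have "a \<in> zero_residues E s g" by (simp add: zero_residues_def)
      moreover have "w \<in> padic_ball E (ctr a) (s - t)"
        unfolding padic_ball_def
      proof (intro CollectI ballI)
        fix e assume e: "e \<in> E"
        obtain y where y: "z e - of_int (a e) = p_elem ^ s * y" using diff[OF e] by (elim dvdE)
        have of_int: "to_fract (of_int i) = (of_int i :: 'p padic)" for i
          by (induction i rule: int_induct[where k = 0]) simp_all
        have "to_fract (z e) = to_fract (of_int (a e) + p_elem ^ s * y)" using y by (simp add: algebra_simps)
        then have "w e * ?P ^ t = of_int (a e) + ?P ^ s * to_fract y"
          using z[OF e] by (simp add: of_int to_fract_power to_fract_of_nat)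
        moreover have "?P ^ s = ?P ^ (s - t) * ?P ^ t" by (simp add: s_def flip: power_add)
        ultimately have "w e * ?P ^ t = (ctr a e + ?P ^ (s - t) * to_fract y) * ?P ^ t"
          using P0 by (simp add: ctr_def algebra_simps)
        then have "w e = ctr a e + ?P ^ (s - t) * to_fract y" using P0 by simp
        then show "\<exists>y\<in>padic_integers. w e = ctr a e + ?P ^ (s - t) * y"
          unfolding padic_integers_def by blast
      qed
      ultimately show "w \<in> (\<Union>c\<in>?C. padic_ball E c (s - t))" by blast
    qed
  qed
qed

lemma haar_null_zeros:
  fixes f :: "('e \<Rightarrow> 'p::prime_card padic) \<Rightarrow> 'p padic"
  assumes E: "finite E" "E \<noteq> {}" and f: "f \<in> poly_fun E" and w0: "f w0 \<noteq> 0"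
  shows "haar_null E {w. f w = 0}"
proof -
  let ?P = "of_nat CARD('p) :: 'p padic"
  have common: "\<exists>s. \<forall>t\<ge>s. \<forall>e\<in>E. \<exists>z. w e * ?P ^ t = to_fract z" for w :: "'e \<Rightarrow> 'p padic"
  proof -
    have "\<forall>e. \<exists>s. \<forall>t\<ge>s. \<exists>z. w e * ?P ^ t = to_fract z"
      using padic_times_p_power_integral by blast
    from choice[OF this] obtain s where s: "\<forall>e. \<forall>t\<ge>s e. \<exists>z. w e * ?P ^ t = to_fract z" ..
    have "s e \<le> sum s E" if "e \<in> E" for e using E(1) that by (rule member_le_sum[rotated 2]) auto
    then have "\<exists>z. w e * ?P ^ t = to_fract z" if "sum s E \<le> t" "e \<in> E" for e t
      using s[rule_format, of e t] that by (meson order_trans)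
    then show ?thesis by blast
  qed
  obtain s where s: "\<forall>t\<ge>s. \<forall>e\<in>E. \<exists>z. w0 e * ?P ^ t = to_fract z" using common by blast
  \<comment> \<open>Exponents start at \<open>s\<close>, so that \<open>w0\<close> itself satisfies
    the integrality condition in every set of the union.\<close>
  let ?A = "\<lambda>l. {w. f w = 0 \<and> (\<forall>e\<in>E. \<exists>z. w e * ?P ^ (s + l) = to_fract z)}"
  have "haar_null E (\<Union>l. ?A l)"
    by (intro haar_null_UN haar_null_zeros_bounded[OF E f w0]) (use s in auto)
  moreover have "{w. f w = 0} \<subseteq> (\<Union>l. ?A l)"
  proof
    fix w assume w: "w \<in> {w. f w = 0}"
    obtain t where t: "\<forall>t'\<ge>t. \<forall>e\<in>E. \<exists>z. w e * ?P ^ t' = to_fract z" using common by blast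
    have "w \<in> ?A t" using w t by simp
    then show "w \<in> (\<Union>l. ?A l)" by blast
  qed
  ultimately show ?thesis by (rule haar_null_subset)
qed

text \<open>A cover by balls of total measure less than one would give a cover of the space of digit
  sequences, with independent uniformly distributed digits, by events of total probability less
  than one.\<close>

lemma not_haar_null_UNIV:
  assumes E: "finite (E :: 'e set)"
  shows "\<not> haar_null E (UNIV :: ('e \<Rightarrow> 'p::prime_card padic) set)"
proof
  assume null: "haar_null E (UNIV :: ('e \<Rightarrow> 'p padic) set)"
  have one: "(0 :: real) < 1" by simp
  obtain c r where
    cover: "UNIV \<subseteq> (\<Union>n::nat. padic_ball E (c n :: 'e \<Rightarrow> 'p padic) (r n))"
    and small: "suminf (\<lambda>n. ennreal ((1 / real CARD('p)) ^ (r n * card E))) < ennreal 1"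
    using haar_null_iff[THEN iffD1, rule_format, OF null one]
    by (elim exE conjE) (rule that)
  let ?p = "int CARD('p)"
  have p0: "CARD('p) > 0" by simp
  let ?Q = "measure_pmf (pmf_of_set {..<CARD('p)})"
  let ?I = "E \<times> (UNIV :: nat set)"
  interpret product_prob_space "\<lambda>_. measure_pmf (pmf_of_set {..<CARD('p)})" ?I
    by unfold_locales
  let ?M = "PiM ?I (\<lambda>_. ?Q)"
  \<comment> \<open>Reduction modulo \<open>p\<close> gives a digit for every
    \<open>\<omega>\<close>, although coordinates outside \<open>{..<p}\<close> have probability
    zero: the sample space consists of all families of naturals.\<close>
  define dig :: "('e \<times> nat \<Rightarrow> nat) \<Rightarrow> 'e \<Rightarrow> nat \<Rightarrow> int" where "dig \<omega> e i = int (\<omega> (e, i) mod CARD('p))" for \<omega> e i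
  define part :: "('e \<times> nat \<Rightarrow> nat) \<Rightarrow> 'e \<Rightarrow> nat \<Rightarrow> int" where "part \<omega> e n = (\<Sum>i<n. dig \<omega> e i * ?p ^ i)" for \<omega> e n
  have dig: "0 \<le> dig \<omega> e i" "dig \<omega> e i \<le> ?p - 1" for \<omega> e i
  proof -
    have "\<omega> (e, i) mod CARD('p) < CARD('p)" by simp
    then show "0 \<le> dig \<omega> e i" "dig \<omega> e i \<le> ?p - 1" unfolding dig_def by linarith+
  qed
  have part: "0 \<le> part \<omega> e n \<and> part \<omega> e n < ?p ^ n" for \<omega> e n
  proof (induction n)
    case (Suc n)
    have "dig \<omega> e n * ?p ^ n \<le> (?p - 1) * ?p ^ n" using dig by (intro mult_right_mono) auto
    moreover have "0 \<le> dig \<omega> e n * ?p ^ n" using dig by simp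
    ultimately show ?case using Suc by (simp add: part_def algebra_simps)
  qed (simp add: part_def)
  have part_mod: "part \<omega> e (Suc n) mod ?p ^ n = part \<omega> e n" for \<omega> e n
    using part[of \<omega> e n] by (simp add: part_def)
  define X :: "('e \<times> nat \<Rightarrow> nat) \<Rightarrow> 'e \<Rightarrow> 'p padic_int" where "X \<omega> e = Abs_padic_int (part \<omega> e)" for \<omega> e
  have X: "residue (X \<omega> e) = part \<omega> e" for \<omega> e
    unfolding X_def by (rule Abs_padic_int_inverse) (simp add: part_mod)
  define S where "S n = {\<omega> \<in> space ?M. (\<lambda>e. to_fract (X \<omega> e)) \<in> padic_ball E (c n) (r n)}" for n
  \<comment> \<open>A measurable event containing \<open>S n\<close>, with probability at most the
    measure of the ball. The points of \<open>S n\<close> share their digits below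
    \<open>r n\<close>, read off from one of them; without a point of \<open>S n\<close> the empty
    event is taken.\<close>
  define T where "T n = (if S n = {} then {} else
    {\<omega> \<in> space ?M. \<forall>x\<in>E \<times> {..<r n}. \<omega> x \<in> {d. d mod CARD('p) = (SOME \<omega>0. \<omega>0 \<in> S n) x mod CARD('p)}})" for n
  \<comment> \<open>Two integral points of one ball differ by a multiple of \<open>p ^ r n\<close>,
    so their residues at \<open>r n\<close> agree, and with these all earlier residues and the
    digits.\<close>
  have same: "\<omega> x mod CARD('p) = \<omega>' x mod CARD('p)"
    if \<omega>: "\<omega> \<in> S n" and \<omega>': "\<omega>' \<in> S n" and x: "x \<in> E \<times> {..<r n}" for \<omega> \<omega>' x n
  proof -
    obtain e i where ei: "x = (e, i)" "e \<in> E" "i < r n" using x by auto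
    obtain y where y: "to_fract (X \<omega> e) = c n e + of_nat CARD('p) ^ r n * to_fract y"
      using \<omega> ei(2) unfolding S_def padic_ball_def padic_integers_def by blast
    obtain y' where y': "to_fract (X \<omega>' e) = c n e + of_nat CARD('p) ^ r n * to_fract y'"
      using \<omega>' ei(2) unfolding S_def padic_ball_def padic_integers_def by blast
    have "to_fract (X \<omega> e - X \<omega>' e) = to_fract (p_elem ^ r n * (y - y'))"
      using y y' by (simp add: to_fract_power to_fract_of_nat algebra_simps)
    then have "X \<omega> e - X \<omega>' e = p_elem ^ r n * (y - y')" by (simp only: to_fract_eq_iff)
    then have "p_elem ^ r n dvd X \<omega> e - X \<omega>' e" by simp
    then have "residue (X \<omega> e - X \<omega>' e) (r n) = 0" by (simp only: p_power_dvd_iff)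
    then have "(part \<omega> e (r n) - part \<omega>' e (r n)) mod ?p ^ r n = 0"
      by (simp add: minus_padic_int.rep_eq X)
    then have "part \<omega> e (r n) mod ?p ^ r n = part \<omega>' e (r n) mod ?p ^ r n"
      by (simp add: mod_eq_dvd_iff dvd_eq_mod_eq_0)
    then have top: "part \<omega> e (r n) = part \<omega>' e (r n)" using part by (simp add: mod_pos_pos_trivial)
    have eq: "part \<omega> e l = part \<omega>' e l" if "l \<le> r n" for l
      using that top
    proof (induction rule: inc_induct)
      case (step l)
      then show ?case using part_mod by metis
    qed
    have "dig \<omega> e i * ?p ^ i = dig \<omega>' e i * ?p ^ i"
      using eq[of i] eq[of "Suc i"] ei(3) by (simp add: part_def)
    then show ?thesis by (simp add: dig_def ei(1))
  qed
  have ST: "S n \<subseteq> T n" for n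
  proof
    fix \<omega> assume \<omega>: "\<omega> \<in> S n"
    then have "(SOME \<omega>0. \<omega>0 \<in> S n) \<in> S n" by (rule someI[of "\<lambda>\<omega>. \<omega> \<in> S n"])
    from same[OF \<omega> this] \<omega> show "\<omega> \<in> T n" unfolding T_def S_def by auto
  qed
  have Qd: "emeasure ?Q {d. d mod CARD('p) = d0 mod CARD('p)} = ennreal (1 / real CARD('p))" for d0
  proof -
    have "{..<CARD('p)} \<inter> {d. d mod CARD('p) = d0 mod CARD('p)} = {d0 mod CARD('p)}" by auto
    then show ?thesis
      using p0 by (subst emeasure_pmf_of_set) (auto simp: divide_ennreal lessThan_empty_iff)
  qed
  have T: "T n \<in> sets ?M" "emeasure ?M (T n) \<le> ennreal ((1 / real CARD('p)) ^ (r n * card E))" for n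
  proof -
    let ?X = "\<lambda>x. {d. d mod CARD('p) = (SOME \<omega>0. \<omega>0 \<in> S n) x mod CARD('p)}"
    let ?T = "{\<omega> \<in> space ?M. \<forall>x\<in>E \<times> {..<r n}. \<omega> x \<in> ?X x}"
    have J: "E \<times> {..<r n} \<subseteq> ?I" "finite (E \<times> {..<r n})" using E by auto
    have "emeasure ?M ?T = (\<Prod>x\<in>E \<times> {..<r n}. emeasure ?Q (?X x))"
      by (rule emeasure_PiM_Collect[OF J]) simp
    also have "\<dots> = ennreal ((1 / real CARD('p)) ^ (r n * card E))"
      by (simp add: Qd card_cartesian_product mult.commute ennreal_power)
    finally have "emeasure ?M ?T = ennreal ((1 / real CARD('p)) ^ (r n * card E))" .
    then show "emeasure ?M (T n) \<le> ennreal ((1 / real CARD('p)) ^ (r n * card E))"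
      unfolding T_def by auto
    have "?T \<in> sets ?M"
    proof (rule sets.sets_Collect_finite_All[OF _ J(2)])
      fix x assume "x \<in> E \<times> {..<r n}"
      then have "(\<lambda>\<omega>. \<omega> x) \<in> measurable ?M ?Q"
        using J(1) by (intro measurable_component_singleton) auto
      from measurable_sets[OF this, of "?X x"] show "{\<omega> \<in> space ?M. \<omega> x \<in> ?X x} \<in> sets ?M"
        by (simp add: vimage_def Int_def conj_commute)
    qed
    then show "T n \<in> sets ?M" unfolding T_def by auto
  qed
  have "space ?M \<subseteq> (\<Union>n. T n)"
  proof
    fix \<omega> assume "\<omega> \<in> space ?M"
    moreover obtain n where "(\<lambda>e. to_fract (X \<omega> e)) \<in> padic_ball E (c n) (r n)" using cover by blast
    ultimately have "\<omega> \<in> S n" unfolding S_def by simp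
    then show "\<omega> \<in> (\<Union>n. T n)" using ST by blast
  qed
  then have "emeasure ?M (space ?M) \<le> emeasure ?M (\<Union>n. T n)"
    using T(1) by (intro emeasure_mono) auto
  also have "\<dots> \<le> suminf (\<lambda>n. emeasure ?M (T n))"
    using T(1) by (intro emeasure_subadditive_countably) auto
  also have "\<dots> \<le> suminf (\<lambda>n. ennreal ((1 / real CARD('p)) ^ (r n * card E)))"
    using T(2) by (intro suminf_le summableI) auto
  also have "\<dots> < ennreal 1" by (rule small)
  finally show False using P.emeasure_space_1 by simp
qed

section \<open>General position\<close>

lemma rational_LGr2_cong:
  assumes "\<And>Q T. Q \<in> LGr (J_mat k) \<Longrightarrow> T \<in> LGr (J_mat k) \<Longrightarrow> \<Phi> Q T = \<Psi> Q T"
    and "rational_LGr2 \<alpha> k \<Phi>"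
  shows "rational_LGr2 \<alpha> k \<Psi>"
proof -
  have "case_prod \<Phi> (pair_chart k \<epsilon> \<delta> w) = case_prod \<Psi> (pair_chart k \<epsilon> \<delta> w)" for \<epsilon> \<delta> w
    using assms(1)[OF pair_chart_in_LGr(1)[of k \<epsilon> \<delta> w] pair_chart_in_LGr(2)[of k \<epsilon> \<delta> w]]
    by (simp add: case_prod_beta)
  then show ?thesis using assms(2) unfolding rational_LGr2_def by simp
qed

lemma finite_pair_coords: "finite (pair_coords k)"
proof -
  have "sym_coords k \<subseteq> {..<k} \<times> {..<k}" by (auto simp: sym_coords_def)
  then have "finite (sym_coords k)" by (rule finite_subset) simp
  then show ?thesis by (simp add: pair_coords_def)
qed

lemma pair_coords_nonempty: "k \<ge> 1 \<Longrightarrow> pair_coords k \<noteq> {}"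
  by (force simp: pair_coords_def sym_coords_def)

text \<open>The exceptional set is null as soon as some pair in the chart is nondegenerate.  Conversely, a
  set whose complement is null meets the set where the coordinates \<open>u\<^sup>+\<close>, \<open>v\<^sup>-\<close> can be used.\<close>

lemma almost_surely_graph_iff:
  fixes \<gamma> :: "(index, 'p::prime_card padic) imat"
  assumes k: "k \<ge> 1"
  shows "almost_surely_LGr2 k (\<lambda>Q T. \<exists>A\<in>Sp \<alpha>. chi_coord \<alpha> k m \<gamma> Q T = graph_of (\<alpha> + \<alpha>) A) \<longleftrightarrow>
    (\<forall>\<epsilon>\<subseteq>{..<k}. \<forall>\<delta>\<subseteq>{..<k}. \<exists>w. \<not> degenerate \<alpha> k m (source_coord \<alpha> k m \<gamma>) \<gamma>
      (fst (pair_chart k \<epsilon> \<delta> w)) (snd (pair_chart k \<epsilon> \<delta> w)))"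
proof -
  let ?R = "\<lambda>Q T. \<exists>A\<in>Sp \<alpha>. chi_coord \<alpha> k m \<gamma> Q T = graph_of (\<alpha> + \<alpha>) A"
  let ?deg = "\<lambda>\<rho> \<epsilon> \<delta> w. degenerate \<alpha> k m \<rho> \<gamma> (fst (pair_chart k \<epsilon> \<delta> w)) (snd (pair_chart k \<epsilon> \<delta> w))"
  note E = finite_pair_coords[of k] pair_coords_nonempty[OF k]
  have "haar_null (pair_coords k) {w. \<not> case_prod ?R (pair_chart k \<epsilon> \<delta> w)} \<longleftrightarrow>
      (\<exists>w. \<not> ?deg (source_coord \<alpha> k m \<gamma>) \<epsilon> \<delta> w)" for \<epsilon> \<delta>
  proof
    assume null: "haar_null (pair_coords k) {w. \<not> case_prod ?R (pair_chart k \<epsilon> \<delta> w)}"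
    have "\<exists>D\<in>poly_fun (pair_coords k). \<forall>w. D w = 0 \<longleftrightarrow> ?deg (mixed_coord \<alpha>) \<epsilon> \<delta> w"
      by (rule degenerate_polynomial) (rule mixed_coord_lin_forms)
    then obtain D where D: "D \<in> poly_fun (pair_coords k)" "\<forall>w. D w = 0 \<longleftrightarrow> ?deg (mixed_coord \<alpha>) \<epsilon> \<delta> w"
      by (elim bexE) (rule that)
    obtain w0 where "\<not> ?deg (mixed_coord \<alpha>) \<epsilon> \<delta> w0"
      using infinite_padic by (rule nondegenerate_pair)
    then have "D w0 \<noteq> 0" using D(2) by simp
    then have "haar_null (pair_coords k) {w. D w = 0}" by (rule haar_null_zeros[OF E D(1)])
    define U where "U = {w. \<not> case_prod ?R (pair_chart k \<epsilon> \<delta> w)} \<union> {w. D w = 0}"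
    have "haar_null (pair_coords k) U"
      unfolding U_def using null \<open>haar_null (pair_coords k) {w. D w = 0}\<close> by (rule haar_null_Un)
    then have "U \<noteq> UNIV" using not_haar_null_UNIV[OF E(1), where 'p = 'p] by metis
    then obtain w where "w \<notin> U" by blast
    then have w: "case_prod ?R (pair_chart k \<epsilon> \<delta> w) \<and> D w \<noteq> 0"
      unfolding U_def Un_iff mem_Collect_eq de_Morgan_disj not_not .
    from conjunct1[OF w] obtain A where A: "A \<in> Sp \<alpha>"
      "chi_coord \<alpha> k m \<gamma> (fst (pair_chart k \<epsilon> \<delta> w)) (snd (pair_chart k \<epsilon> \<delta> w)) = graph_of (\<alpha> + \<alpha>) A"
      unfolding case_prod_beta by (elim bexE) (rule that)
    have "A \<in> carrier_mat (\<alpha> + \<alpha>) (\<alpha> + \<alpha>)" using A(1) by (simp add: Sp_def)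
    moreover have "\<not> ?deg (mixed_coord \<alpha>) \<epsilon> \<delta> w" using conjunct2[OF w] D(2) by simp
    ultimately have "\<not> ?deg (source_coord \<alpha> k m \<gamma>) \<epsilon> \<delta> w" by (rule graph_imp_nondegenerate[OF A(2)])
    then show "\<exists>w. \<not> ?deg (source_coord \<alpha> k m \<gamma>) \<epsilon> \<delta> w" by (rule exI[where x = w])
  next
    assume "\<exists>w. \<not> ?deg (source_coord \<alpha> k m \<gamma>) \<epsilon> \<delta> w"
    then obtain w0 where w0: "\<not> ?deg (source_coord \<alpha> k m \<gamma>) \<epsilon> \<delta> w0" by (rule exE)
    have "\<exists>D\<in>poly_fun (pair_coords k). \<forall>w. D w = 0 \<longleftrightarrow> ?deg (source_coord \<alpha> k m \<gamma>) \<epsilon> \<delta> w"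
      by (rule degenerate_polynomial) (intro source_coord_lin_forms poly_fun.const)
    then obtain D where D: "D \<in> poly_fun (pair_coords k)"
      "\<forall>w. D w = 0 \<longleftrightarrow> ?deg (source_coord \<alpha> k m \<gamma>) \<epsilon> \<delta> w"
      by (elim bexE) (rule that)
    have "D w0 \<noteq> 0" using D(2) w0 by simp
    then have "haar_null (pair_coords k) {w. D w = 0}" by (rule haar_null_zeros[OF E D(1)])
    moreover have "{w. \<not> case_prod ?R (pair_chart k \<epsilon> \<delta> w)} \<subseteq> {w. D w = 0}"
    proof
      fix w assume w: "w \<in> {w. \<not> case_prod ?R (pair_chart k \<epsilon> \<delta> w)}"
      have "?deg (source_coord \<alpha> k m \<gamma>) \<epsilon> \<delta> w"
      proof (rule ccontr)
        assume "\<not> ?deg (source_coord \<alpha> k m \<gamma>) \<epsilon> \<delta> w"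
        from nondegenerate_imp_graph[OF this] w show False by (simp add: case_prod_beta)
      qed
      then show "w \<in> {w. D w = 0}" using D(2) by simp
    qed
    ultimately show "haar_null (pair_coords k) {w. \<not> case_prod ?R (pair_chart k \<epsilon> \<delta> w)}"
      by (rule haar_null_subset)
  qed
  then show ?thesis unfolding almost_surely_LGr2_def by simp
qed

lemma almost_surely_LGr2_cong:
  assumes "\<And>Q T. Q \<in> LGr (J_mat k) \<Longrightarrow> T \<in> LGr (J_mat k) \<Longrightarrow> R Q T \<longleftrightarrow> R' Q T"
  shows "almost_surely_LGr2 k R \<longleftrightarrow> almost_surely_LGr2 k R'"
proof -
  have "case_prod R (pair_chart k \<epsilon> \<delta> w) \<longleftrightarrow> case_prod R' (pair_chart k \<epsilon> \<delta> w)" for \<epsilon> \<delta> w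
    using assms[OF pair_chart_in_LGr(1)[of k \<epsilon> \<delta> w] pair_chart_in_LGr(2)[of k \<epsilon> \<delta> w]]
    by (simp add: case_prod_beta)
  then show ?thesis unfolding almost_surely_LGr2_def by simp
qed

text \<open>The set below is a finite union, over the charts, of intersections of zero sets; a product over
  the charts with independent choices of the points turns it into an intersection.\<close>

lemma proper_subvariety_degenerate:
  assumes inf: "infinite (UNIV :: 'a::field set)"
  shows "proper_subvariety_GL (\<alpha> + k * m) {g \<in> GL (\<alpha> + k * m).
    \<not> (\<forall>\<epsilon>\<subseteq>{..<k}. \<forall>\<delta>\<subseteq>{..<k}. \<exists>w. \<not> degenerate \<alpha> k m (source_coord \<alpha> k m (coord_mat \<alpha> m g))
      (coord_mat \<alpha> m g :: (index, 'a) imat) (fst (pair_chart k \<epsilon> \<delta> w)) (snd (pair_chart k \<epsilon> \<delta> w)))}"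
    (is "proper_subvariety_GL ?n ?X")
proof -
  let ?V = "{..<?n} \<times> {..<?n}" and ?C = "Pow {..<k} \<times> Pow {..<k}"
  define \<gamma> where "\<gamma> v r s = v (position \<alpha> m r, position \<alpha> m s)" for v :: "nat \<times> nat \<Rightarrow> 'a" and r s
  define deg where "deg v x w = degenerate \<alpha> k m (source_coord \<alpha> k m (\<gamma> v)) (\<gamma> v)
    (fst (pair_chart k (fst x) (snd x) w)) (snd (pair_chart k (fst x) (snd x) w))" for v x w
  have \<gamma>_mat: "\<gamma> (\<lambda>e. g $$ e) = coord_mat \<alpha> m g" for g
    by (simp add: \<gamma>_def coord_mat_def fun_eq_iff)
  have X: "?X = {g \<in> GL ?n. \<exists>x\<in>?C. \<forall>w. deg (\<lambda>e. g $$ e) x w}"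
    by (auto simp: deg_def \<gamma>_mat)
  have "\<forall>xw. \<exists>D. D \<in> poly_fun ?V \<and> (\<forall>v. D v = 0 \<longleftrightarrow> deg v (fst xw) (snd xw))"
  proof
    fix xw :: "(nat set \<times> nat set) \<times> (nat \<times> nat + nat \<times> nat \<Rightarrow> 'a)"
    have "\<exists>D\<in>poly_fun ?V. \<forall>v. D v = 0 \<longleftrightarrow> deg v (fst xw) (snd xw)"
      unfolding deg_def
    proof (rule degenerate_polynomial_matrix)
      fix r s assume "r \<in> level_indices \<alpha> k m" "s \<in> level_indices \<alpha> k m"
      then show "(\<lambda>v. \<gamma> v r s) \<in> poly_fun ?V"
        unfolding \<gamma>_def by (intro poly_fun.var) (simp add: position_less)
    qed
    then show "\<exists>D. D \<in> poly_fun ?V \<and> (\<forall>v. D v = 0 \<longleftrightarrow> deg v (fst xw) (snd xw))" by (elim bexE) blast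
  qed
  from choice[OF this] obtain D where
    D: "\<forall>xw. D xw \<in> poly_fun ?V \<and> (\<forall>v. D xw v = 0 \<longleftrightarrow> deg v (fst xw) (snd xw))" by (rule exE)
  define P where "P W v = (\<Prod>x\<in>?C. D (x, W x) v)"
    for W :: "nat set \<times> nat set \<Rightarrow> nat \<times> nat + nat \<times> nat \<Rightarrow> 'a" and v
  have P: "P W \<in> poly_fun ?V" for W
    unfolding P_def[abs_def] using D by (intro poly_fun_prod) blast
  have P0: "P W v = 0 \<longleftrightarrow> (\<exists>x\<in>?C. deg v x (W x))" for W v
    unfolding P_def using D by simp
  have "?X = {g \<in> GL ?n. \<forall>f\<in>range P. f (\<lambda>e. g $$ e) = 0}"
  proof -
    have "(\<exists>x\<in>?C. \<forall>w. deg v x w) \<longleftrightarrow> (\<forall>W. P W v = 0)" for v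
    proof
      assume R: "\<forall>W. P W v = 0"
      show "\<exists>x\<in>?C. \<forall>w. deg v x w"
      proof (rule ccontr)
        assume "\<not> (\<exists>x\<in>?C. \<forall>w. deg v x w)"
        then have "\<forall>x\<in>?C. \<exists>w. \<not> deg v x w" by blast
        from bchoice[OF this] obtain W where "\<forall>x\<in>?C. \<not> deg v x (W x)" by (rule exE)
        then have "P W v \<noteq> 0" unfolding P0 by blast
        with R show False by blast
      qed
    qed (use P0 in blast)
    then show ?thesis unfolding X by simp
  qed
  moreover have "?X \<noteq> GL ?n"
  proof -
    let ?one = "1\<^sub>m ?n :: 'a mat"
    have "?one \<in> GL ?n"
      unfolding GL_def invertible_mat_def inverts_mat_def by (auto intro!: exI[of _ ?one])
    moreover have "?one \<notin> ?X"
    proof -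
      have one: "coord_mat \<alpha> m ?one r s = (if r = s then 1 else 0)"
        if "r \<in> level_indices \<alpha> k m" "s \<in> level_indices \<alpha> k m" for r s
        using that by (simp add: coord_mat_def position_less position_eq_iff)
      have "\<exists>w. \<not> degenerate \<alpha> k m (source_coord \<alpha> k m (coord_mat \<alpha> m ?one)) (coord_mat \<alpha> m ?one)
          (fst (pair_chart k \<epsilon> \<delta> w)) (snd (pair_chart k \<epsilon> \<delta> w))" for \<epsilon> \<delta>
        by (rule identity_nondegenerate[OF inf one]) blast+
      then show ?thesis by blast
    qed
    ultimately show ?thesis by metis
  qed
  moreover have "range P \<subseteq> poly_fun ?V" using P by blast
  ultimately show ?thesis unfolding proper_subvariety_GL_def by blast
qed

theorem theorem4p9:
  fixes \<alpha> k :: nat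
  assumes "k \<ge> 1"
  shows
    "(\<forall>\<gg> \<in> (double_cosets \<alpha> k :: (index, 'p::prime_card padic) imat set set).
        \<forall>Q \<in> LGr (J_mat k). \<forall>T \<in> LGr (J_mat k). chi \<alpha> k \<gg> Q T \<in> LGr (J_ominus \<alpha>)) \<and>
     (\<forall>\<gg> \<in> (double_cosets \<alpha> k :: (index, 'p padic) imat set set).
        rational_LGr2 \<alpha> k (chi \<alpha> k \<gg>)) \<and>
     general_position \<alpha> k (\<lambda>\<gg> :: (index, 'p padic) imat set.
        almost_surely_LGr2 k (\<lambda>Q T. \<exists>A \<in> Sp \<alpha>. chi \<alpha> k \<gg> Q T = graph_of (\<alpha> + \<alpha>) A))"
proof (intro conjI ballI)
  fix \<gg> :: "(index, 'p padic) imat set" and Q T :: "'p padic vec set"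
  assume "\<gg> \<in> double_cosets \<alpha> k" and QT: "Q \<in> LGr (J_mat k)" "T \<in> LGr (J_mat k)"
  then obtain m g where g: "g \<in> GL (\<alpha> + k * m)" "\<gg> = double_coset k (level_embed \<alpha> k m g)"
    using double_coset_representative by blast
  show "chi \<alpha> k \<gg> Q T \<in> LGr (J_ominus \<alpha>)"
    unfolding g(2) chi_level_embed[OF g(1) QT] using QT by (rule chi_coord_in_LGr)
next
  fix \<gg> :: "(index, 'p padic) imat set"
  assume "\<gg> \<in> double_cosets \<alpha> k"
  then obtain m g where g: "g \<in> GL (\<alpha> + k * m)" "\<gg> = double_coset k (level_embed \<alpha> k m g)"
    using double_coset_representative by blast
  show "rational_LGr2 \<alpha> k (chi \<alpha> k \<gg>)"
  proof (rule rational_LGr2_cong)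
    show "rational_LGr2 \<alpha> k (chi_coord \<alpha> k m (coord_mat \<alpha> m g))"
      using infinite_padic by (rule rational_chi_coord)
    show "chi_coord \<alpha> k m (coord_mat \<alpha> m g) Q T = chi \<alpha> k \<gg> Q T"
      if "Q \<in> LGr (J_mat k)" "T \<in> LGr (J_mat k)" for Q T
      unfolding g(2) chi_level_embed[OF g(1) that] ..
  qed
next
  have iff: "almost_surely_LGr2 k (\<lambda>Q T. \<exists>A\<in>Sp \<alpha>.
        chi \<alpha> k (double_coset k (level_embed \<alpha> k m g)) Q T = graph_of (\<alpha> + \<alpha>) A) \<longleftrightarrow>
      (\<forall>\<epsilon>\<subseteq>{..<k}. \<forall>\<delta>\<subseteq>{..<k}. \<exists>w. \<not> degenerate \<alpha> k m (source_coord \<alpha> k m (coord_mat \<alpha> m g))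
        (coord_mat \<alpha> m g) (fst (pair_chart k \<epsilon> \<delta> w)) (snd (pair_chart k \<epsilon> \<delta> w)))"
    if g: "g \<in> GL (\<alpha> + k * m)" for m and g :: "'p padic mat"
  proof -
    have "almost_surely_LGr2 k (\<lambda>Q T. \<exists>A\<in>Sp \<alpha>.
        chi \<alpha> k (double_coset k (level_embed \<alpha> k m g)) Q T = graph_of (\<alpha> + \<alpha>) A) \<longleftrightarrow>
      almost_surely_LGr2 k (\<lambda>Q T. \<exists>A\<in>Sp \<alpha>. chi_coord \<alpha> k m (coord_mat \<alpha> m g) Q T = graph_of (\<alpha> + \<alpha>) A)"
      by (rule almost_surely_LGr2_cong) (simp add: chi_level_embed[OF g])
    then show ?thesis unfolding almost_surely_graph_iff[OF assms] .
  qed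
  \<comment> \<open>The failure set is literally the subvariety treated above, and it is proper at
    every level, so any threshold for \<open>m\<close> will do.\<close>
  have "{g \<in> GL (\<alpha> + k * m). \<not> almost_surely_LGr2 k (\<lambda>Q T. \<exists>A\<in>Sp \<alpha>.
        chi \<alpha> k (double_coset k (level_embed \<alpha> k m g)) Q T = graph_of (\<alpha> + \<alpha>) A)} =
      {g \<in> GL (\<alpha> + k * m). \<not> (\<forall>\<epsilon>\<subseteq>{..<k}. \<forall>\<delta>\<subseteq>{..<k}. \<exists>w.
        \<not> degenerate \<alpha> k m (source_coord \<alpha> k m (coord_mat \<alpha> m g)) (coord_mat \<alpha> m g :: (index, 'p padic) imat)
          (fst (pair_chart k \<epsilon> \<delta> w)) (snd (pair_chart k \<epsilon> \<delta> w)))}" for m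
    using iff by (intro Collect_cong conj_cong) simp_all
  then show "general_position \<alpha> k (\<lambda>\<gg> :: (index, 'p padic) imat set.
        almost_surely_LGr2 k (\<lambda>Q T. \<exists>A \<in> Sp \<alpha>. chi \<alpha> k \<gg> Q T = graph_of (\<alpha> + \<alpha>) A))"
    unfolding general_position_def
    using proper_subvariety_degenerate[OF infinite_padic[where 'p = 'p], of \<alpha> k] by simp
qed

end
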